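(* Let $M$ be an oriented Riemannian 2-manifold (viewed as a Riemann surface), let $\pi:SM\to M$ be its unit tangent circle bundle with the Sasaki metric, and let $e^0,e^1,e^2$ be the canonical global orthonormal coframe of $SM$ described in the context. Let $b_0,b_1,b_2:M\to\mathbb{R}$ be functions of class $\mathrm{C}^1$, regarded also as functions on $SM$ by pullback under $\pi$, and let $$\varphi=b_2\,e^0\wedge e^1+b_1\,e^2\wedge e^0+b_0\,e^1\wedge e^2 .$$ Then: 1. The 2-form $\varphi$ on $SM$ has comass 1 if and only if $\sup\{b_0(x)^2+b_1(x)^2+b_2(x)^2:\ x\in M\}=1$. 2. The form $\varphi$ is closed if and only if the function $b_1+\sqrt{-1}\,b_0$ is holomorphic on $M$.
   Context: The Sasaki metric on $SM$ is induced from that of $TM$: horizontal and vertical subspaces of the Levi-Civita connection are orthogonal and each is isometric to $T_{\pi(u)}M$. The global orthonormal frame $e_0,e_1,e_2$ of $SM$ is defined at $u\in SM$ as follows: $e_0$ is the horizontal lift of $u$ (the geodesic spray); $e_1$ is the horizontal lift of the vector $v\in T_{\pi(u)}M$ such that $(u,v)$ is a direct orthonormal basis of $T_{\pi(u)}M$; $e_2$ is the vertical lift of the same $v$ (tangent to the circle fibres). $e^0,e^1,e^2$ is the dual coframe. It satisfies $\mathrm{d}e^0=e^2\wedge e^1$, $\mathrm{d}e^1=e^0\wedge e^2$, $\mathrm{d}e^2=K\,e^1\wedge e^0$, where $K$ is the Gauss curvature of $M$ (pulled back to $SM$). The form $\varphi$ has comass 1 if $\sup_{u\in SM}\|\varphi\|^*_u=1$,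 where $\|\varphi\|^*_u=\sup\{\langle\varphi_u,\xi\rangle:\ \xi\text{ a unit simple 2-vector at }u\}$. Holomorphic is meant with respect to the complex structure of $M$ induced by the metric and the orientation. *)

theory Defs
  imports "HOL-Analysis.Analysis"
begin

unbundle no fps_syntax

section \<open>Functions of class $C^k$ on open sets\<close>

text \<open>Only used for open \<open>S\<close>. As the domain is finite-dimensional, it suffices to ask
  that the directional derivatives be of class $C^{k-1}$.\<close>

primrec Ck_on :: "nat \<Rightarrow> ('e::euclidean_space \<Rightarrow> 'f::real_normed_vector) \<Rightarrow> 'e set \<Rightarrow> bool" where
  "Ck_on 0 f S \<longleftrightarrow> continuous_on S f"
| "Ck_on (Suc k) f S \<longleftrightarrow>
     (\<exists>f'. (\<forall>x\<in>S. (f has_derivative f' x) (at x)) \<and> (\<forall>v. Ck_on k (\<lambda>x. f' x v) S))"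

definition smooth_on :: "('e::euclidean_space \<Rightarrow> 'f::real_normed_vector) \<Rightarrow> 'e set \<Rightarrow> bool" where
  "smooth_on f S \<longleftrightarrow> (\<forall>k. Ck_on k f S)"


section \<open>Oriented Riemannian 2-manifolds\<close>

text \<open>A chart is a pair of its domain and its coordinate map.\<close>

type_synonym 'a chart = "'a set \<times> ('a \<Rightarrow> real^2)"

definition chart_inv :: "'a chart \<Rightarrow> real^2 \<Rightarrow> 'a" where
  "chart_inv c = inv_into (fst c) (snd c)"

definition tangent_change :: "'a chart \<Rightarrow> 'a chart \<Rightarrow> 'a \<Rightarrow> real^2 \<Rightarrow> real^2" where
  "tangent_change c d p = frechet_derivative (snd d \<circ> chart_inv c) (at (snd c p))"

definition oriented_surface :: "'a topology \<Rightarrow> 'a chart set \<Rightarrow> bool" where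
  "oriented_surface M A \<longleftrightarrow>
     Hausdorff_space M \<and> second_countable M \<and>
     (\<Union>c\<in>A. fst c) = topspace M \<and>
     (\<forall>c\<in>A. openin M (fst c) \<and> open (snd c ` fst c) \<and>
        homeomorphic_map (subtopology M (fst c)) (top_of_set (snd c ` fst c)) (snd c)) \<and>
     (\<forall>c\<in>A. \<forall>d\<in>A.
        smooth_on (snd d \<circ> chart_inv c) (snd c ` (fst c \<inter> fst d)) \<and>
        (\<forall>p \<in> fst c \<inter> fst d. det (matrix (tangent_change c d p)) > 0))"

text \<open>The tangent space at \<open>p\<close> is represented by \<open>real^2\<close>, a tangent vector being identified
  with its components in a chart around \<open>p\<close> that is fixed once and for all, namely
  \<open>chart_at A p\<close>. Components in another chart \<open>c\<close> are obtained by
  \<open>tangent_change (chart_at A p) c p\<close>. Note that \<open>chart_at A p\<close> need not depend continuously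
  on \<open>p\<close>, so regularity is always expressed in the charts of the atlas.\<close>

definition chart_at :: "'a chart set \<Rightarrow> 'a \<Rightarrow> 'a chart" where
  "chart_at A p = (SOME c. c \<in> A \<and> p \<in> fst c)"

definition coord_at :: "'a chart set \<Rightarrow> 'a \<Rightarrow> real^2" where
  "coord_at A p = snd (chart_at A p) p"

definition Ck_fun :: "nat \<Rightarrow> 'a chart set \<Rightarrow> ('a \<Rightarrow> 'f::real_normed_vector) \<Rightarrow> bool" where
  "Ck_fun k A f \<longleftrightarrow> (\<forall>c\<in>A. Ck_on k (f \<circ> chart_inv c) (snd c ` fst c))"

text \<open>\<open>g p\<close> is the inner product of the tangent space at \<open>p\<close>; \<open>metric_coord A g c x\<close> is the
  same inner product at the point with coordinates \<open>x\<close>, in terms of components in the chart \<open>c\<close>.\<close>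

type_synonym 'a metric = "'a \<Rightarrow> real^2 \<Rightarrow> real^2 \<Rightarrow> real"

definition metric_coord ::
    "'a chart set \<Rightarrow> 'a metric \<Rightarrow> 'a chart \<Rightarrow> real^2 \<Rightarrow> real^2 \<Rightarrow> real^2 \<Rightarrow> real" where
  "metric_coord A g c x v w =
     (let p = chart_inv c x; T = tangent_change c (chart_at A p) p in g p (T v) (T w))"

definition oriented_riemannian_surface :: "'a topology \<Rightarrow> 'a chart set \<Rightarrow> 'a metric \<Rightarrow> bool" where
  "oriented_riemannian_surface M A g \<longleftrightarrow>
     oriented_surface M A \<and>
     (\<forall>p\<in>topspace M. bilinear (g p) \<and> (\<forall>v w. g p v w = g p w v) \<and> (\<forall>v. v \<noteq> 0 \<longrightarrow> g p v v > 0)) \<and>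
     (\<forall>c\<in>A. \<forall>v w. smooth_on (\<lambda>x. metric_coord A g c x v w) (snd c ` fst c))"


section \<open>Complex structure and holomorphic functions\<close>

text \<open>The rotation by $+\pi/2$ in the tangent space at \<open>p\<close>. For a unit vector \<open>u\<close>, it gives
  the vector \<open>v\<close> such that \<open>(u, v)\<close> is a direct orthonormal basis. As a field of endomorphisms,
  it is the complex structure induced by the metric and the orientation.\<close>

definition rot :: "'a metric \<Rightarrow> 'a \<Rightarrow> real^2 \<Rightarrow> real^2" where
  "rot g p u = (THE v. g p v v = g p u u \<and> g p u v = 0 \<and>
                       (u \<noteq> 0 \<longrightarrow> det (vector [u, v] :: real^2^2) > 0))"

text \<open>A function is holomorphic if it has at every point a differential that is complex linear
  from the tangent space, with the complex structure \<open>rot g p\<close>, to the complex numbers. See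
  \<open>holomorphic_iff_isothermal\<close> below for the description in holomorphic coordinates.\<close>

definition holomorphic_at :: "'a chart set \<Rightarrow> 'a metric \<Rightarrow> ('a \<Rightarrow> complex) \<Rightarrow> 'a \<Rightarrow> bool" where
  "holomorphic_at A g f p \<longleftrightarrow>
     (\<exists>D. ((f \<circ> chart_inv (chart_at A p)) has_derivative D) (at (coord_at A p)) \<and>
          (\<forall>v. D (rot g p v) = \<i> * D v))"

definition holomorphic_surface ::
    "'a topology \<Rightarrow> 'a chart set \<Rightarrow> 'a metric \<Rightarrow> ('a \<Rightarrow> complex) \<Rightarrow> bool" where
  "holomorphic_surface M A g f \<longleftrightarrow> (\<forall>p\<in>topspace M. holomorphic_at A g f p)"


section \<open>Levi-Civita connection\<close>

text \<open>The Christoffel symbols, as a bilinear map, of the metric with coefficients \<open>G\<close> on an open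
  set of the plane: the covariant derivative of a vector field \<open>Y\<close> in the direction \<open>a\<close> is
  \<open>D Y a + levi_civita G x a (Y x)\<close>. The connection is the unique one that is torsion-free and
  compatible with the metric.\<close>

definition levi_civita :: "(real^2 \<Rightarrow> real^2 \<Rightarrow> real^2 \<Rightarrow> real) \<Rightarrow> real^2 \<Rightarrow> real^2 \<Rightarrow> real^2 \<Rightarrow> real^2" where
  "levi_civita G x = (THE \<Gamma>. bilinear \<Gamma> \<and> (\<forall>a b. \<Gamma> a b = \<Gamma> b a) \<and>
     (\<forall>a b c. frechet_derivative (\<lambda>y. G y b c) (at x) a = G x (\<Gamma> a b) c + G x b (\<Gamma> a c)))"

definition christoffel :: "'a chart set \<Rightarrow> 'a metric \<Rightarrow> 'a \<Rightarrow> real^2 \<Rightarrow> real^2 \<Rightarrow> real^2" where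
  "christoffel A g p = levi_civita (metric_coord A g (chart_at A p)) (coord_at A p)"


section \<open>The tangent bundle and the unit tangent circle bundle\<close>

text \<open>A point of $TM$ is a pair \<open>(p, v)\<close>, the projection to $M$ being \<open>fst\<close>. Every chart \<open>c\<close> of
  $M$ induces the chart \<open>tm_chart A c\<close> of $TM$. Tangent vectors of $TM$ at \<open>(p, v)\<close> are
  represented by their components \<open>(\<xi>, \<eta>)\<close> in the chart induced by \<open>chart_at A p\<close>, in which
  \<open>(p, v)\<close> has coordinates \<open>(coord_at A p, v)\<close>. In particular the differential of the
  projection is \<open>fst\<close>.\<close>

type_synonym 'a tm = "'a \<times> (real^2)"
type_synonym tvec = "(real^2) \<times> (real^2)"

definition tm_chart :: "'a chart set \<Rightarrow> 'a chart \<Rightarrow> 'a tm \<Rightarrow> (real^2) \<times> (real^2)" where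
  "tm_chart A c u = (snd c (fst u), tangent_change (chart_at A (fst u)) c (fst u) (snd u))"

definition SM :: "'a topology \<Rightarrow> 'a metric \<Rightarrow> 'a tm set" where
  "SM M g = {(p, v). p \<in> topspace M \<and> g p v v = 1}"

text \<open>The tangent space of $SM$, which is a regular level set of the squared norm on $TM$.\<close>

definition SM_tangent :: "'a chart set \<Rightarrow> 'a metric \<Rightarrow> 'a tm \<Rightarrow> tvec set" where
  "SM_tangent A g u =
     {Z. frechet_derivative (\<lambda>(x, y). metric_coord A g (chart_at A (fst u)) x y y)
           (at (coord_at A (fst u), snd u)) Z = 0}"

text \<open>The connection map: its kernel is the horizontal subspace, and on the vertical subspace it
  is the canonical isomorphism with the tangent space of $M$.\<close>

definition connector :: "'a chart set \<Rightarrow> 'a metric \<Rightarrow> 'a tm \<Rightarrow> tvec \<Rightarrow> real^2" where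
  "connector A g u Z = snd Z + christoffel A g (fst u) (fst Z) (snd u)"

definition sasaki :: "'a chart set \<Rightarrow> 'a metric \<Rightarrow> 'a tm \<Rightarrow> tvec \<Rightarrow> tvec \<Rightarrow> real" where
  "sasaki A g u X Y =
     g (fst u) (fst X) (fst Y) + g (fst u) (connector A g u X) (connector A g u Y)"

definition horizontal_lift :: "'a chart set \<Rightarrow> 'a metric \<Rightarrow> 'a tm \<Rightarrow> real^2 \<Rightarrow> tvec" where
  "horizontal_lift A g u w = (THE Z. fst Z = w \<and> connector A g u Z = 0)"

definition vertical_lift :: "'a chart set \<Rightarrow> 'a metric \<Rightarrow> 'a tm \<Rightarrow> real^2 \<Rightarrow> tvec" where
  "vertical_lift A g u w = (THE Z. fst Z = 0 \<and> connector A g u Z = w)"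

definition frame0 :: "'a chart set \<Rightarrow> 'a metric \<Rightarrow> 'a tm \<Rightarrow> tvec" where
  "frame0 A g u = horizontal_lift A g u (snd u)"

definition frame1 :: "'a chart set \<Rightarrow> 'a metric \<Rightarrow> 'a tm \<Rightarrow> tvec" where
  "frame1 A g u = horizontal_lift A g u (rot g (fst u) (snd u))"

definition frame2 :: "'a chart set \<Rightarrow> 'a metric \<Rightarrow> 'a tm \<Rightarrow> tvec" where
  "frame2 A g u = vertical_lift A g u (rot g (fst u) (snd u))"

definition SM_frame :: "'a chart set \<Rightarrow> 'a metric \<Rightarrow> 'a tm \<Rightarrow> tvec set" where
  "SM_frame A g u = {frame0 A g u, frame1 A g u, frame2 A g u}"

definition coframe0 :: "'a chart set \<Rightarrow> 'a metric \<Rightarrow> 'a tm \<Rightarrow> tvec \<Rightarrow> real" where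
  "coframe0 A g u Z = representation (SM_frame A g u) Z (frame0 A g u)"

definition coframe1 :: "'a chart set \<Rightarrow> 'a metric \<Rightarrow> 'a tm \<Rightarrow> tvec \<Rightarrow> real" where
  "coframe1 A g u Z = representation (SM_frame A g u) Z (frame1 A g u)"

definition coframe2 :: "'a chart set \<Rightarrow> 'a metric \<Rightarrow> 'a tm \<Rightarrow> tvec \<Rightarrow> real" where
  "coframe2 A g u Z = representation (SM_frame A g u) Z (frame2 A g u)"


section \<open>2-forms on the unit tangent bundle\<close>

text \<open>A 2-form \<open>\<phi>\<close> on $SM$ is given by \<open>\<phi> u X Y\<close> for \<open>u \<in> SM M g\<close> and
  \<open>X, Y \<in> SM_tangent A g u\<close>; other values are irrelevant.\<close>

definition wedge :: "('u \<Rightarrow> 'v \<Rightarrow> real) \<Rightarrow> ('u \<Rightarrow> 'v \<Rightarrow> real) \<Rightarrow> 'u \<Rightarrow> 'v \<Rightarrow> 'v \<Rightarrow> real" where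
  "wedge \<alpha> \<beta> u X Y = \<alpha> u X * \<beta> u Y - \<alpha> u Y * \<beta> u X"

text \<open>A simple 2-vector $X \wedge Y$ is represented by the pair \<open>(X, Y)\<close>; the square of its norm
  is the Gram determinant. The suprema are taken in the extended reals, as the comass need not
  be finite.\<close>

definition unit_simple_2vectors :: "'a chart set \<Rightarrow> 'a metric \<Rightarrow> 'a tm \<Rightarrow> (tvec \<times> tvec) set" where
  "unit_simple_2vectors A g u =
     {(X, Y). X \<in> SM_tangent A g u \<and> Y \<in> SM_tangent A g u \<and>
              sqrt (sasaki A g u X X * sasaki A g u Y Y - (sasaki A g u X Y)\<^sup>2) = 1}"

definition comass_at ::
    "'a chart set \<Rightarrow> 'a metric \<Rightarrow> ('a tm \<Rightarrow> tvec \<Rightarrow> tvec \<Rightarrow> real) \<Rightarrow> 'a tm \<Rightarrow> ereal" where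
  "comass_at A g \<phi> u = (SUP (X, Y) \<in> unit_simple_2vectors A g u. ereal (\<phi> u X Y))"

definition comass ::
    "'a topology \<Rightarrow> 'a chart set \<Rightarrow> 'a metric \<Rightarrow> ('a tm \<Rightarrow> tvec \<Rightarrow> tvec \<Rightarrow> real) \<Rightarrow> ereal" where
  "comass M A g \<phi> = (SUP u \<in> SM M g. comass_at A g \<phi> u)"

text \<open>The differential at \<open>x\<close> of a map from an open set of \<open>real^3\<close> to $TM$.\<close>

definition tm_derivative :: "'a chart set \<Rightarrow> (real^3 \<Rightarrow> 'a tm) \<Rightarrow> real^3 \<Rightarrow> real^3 \<Rightarrow> tvec" where
  "tm_derivative A F x =
     frechet_derivative (tm_chart A (chart_at A (fst (F x))) \<circ> F) (at x)"

text \<open>Smooth local parametrizations of $SM$, i.e. inverses of charts of the 3-manifold $SM$.\<close>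

definition SM_parametrization ::
    "'a topology \<Rightarrow> 'a chart set \<Rightarrow> 'a metric \<Rightarrow> (real^3) set \<Rightarrow> (real^3 \<Rightarrow> 'a tm) \<Rightarrow> bool" where
  "SM_parametrization M A g V F \<longleftrightarrow>
     open V \<and> inj_on F V \<and> F ` V \<subseteq> SM M g \<and>
     (\<forall>c\<in>A. open {x \<in> V. fst (F x) \<in> fst c} \<and>
             smooth_on (tm_chart A c \<circ> F) {x \<in> V. fst (F x) \<in> fst c}) \<and>
     (\<forall>x\<in>V. inj (tm_derivative A F x))"

definition pullback ::
    "'a chart set \<Rightarrow> (real^3 \<Rightarrow> 'a tm) \<Rightarrow> ('a tm \<Rightarrow> tvec \<Rightarrow> tvec \<Rightarrow> real)
       \<Rightarrow> real^3 \<Rightarrow> real^3 \<Rightarrow> real^3 \<Rightarrow> real" where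
  "pullback A F \<phi> x a b = \<phi> (F x) (tm_derivative A F x a) (tm_derivative A F x b)"

text \<open>The exterior derivative of a 2-form on an open set of \<open>real^3\<close>.\<close>

definition ext_derivative ::
    "(real^3 \<Rightarrow> real^3 \<Rightarrow> real^3 \<Rightarrow> real) \<Rightarrow> real^3 \<Rightarrow> real^3 \<Rightarrow> real^3 \<Rightarrow> real^3 \<Rightarrow> real" where
  "ext_derivative \<theta> x a b c =
     frechet_derivative (\<lambda>y. \<theta> y b c) (at x) a
     - frechet_derivative (\<lambda>y. \<theta> y a c) (at x) b
     + frechet_derivative (\<lambda>y. \<theta> y a b) (at x) c"

definition closed_form ::
    "'a topology \<Rightarrow> 'a chart set \<Rightarrow> 'a metric \<Rightarrow> ('a tm \<Rightarrow> tvec \<Rightarrow> tvec \<Rightarrow> real) \<Rightarrow> bool" where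
  "closed_form M A g \<phi> \<longleftrightarrow>
     (\<forall>V F. SM_parametrization M A g V F \<longrightarrow>
        (\<forall>x\<in>V. \<forall>a b c. ext_derivative (pullback A F \<phi>) x a b c = 0))"


section \<open>Holomorphic functions in holomorphic coordinates\<close>

text \<open>An isothermal chart of an oriented atlas is a holomorphic coordinate of the Riemann surface.
  In such a coordinate, \<open>holomorphic_at\<close> is holomorphy in the usual sense.\<close>

definition isothermal_chart :: "'a chart set \<Rightarrow> 'a metric \<Rightarrow> 'a chart \<Rightarrow> bool" where
  "isothermal_chart A g c \<longleftrightarrow>
     (\<forall>x \<in> snd c ` fst c. \<exists>r>0. \<forall>v w. metric_coord A g c x v w = r * (v \<bullet> w))"

definition plane_of :: "complex \<Rightarrow> real^2" where
  "plane_of z = vector [Re z, Im z]"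

lemma plane_of_nth [simp]: "plane_of z $ 1 = Re z" "plane_of z $ 2 = Im z"
  by (simp_all add: plane_of_def)

lemma plane_of_linear: "bounded_linear plane_of"
  by (rule linear_conv_bounded_linear[THEN iffD1], rule linearI)
    (simp_all add: vec_eq_iff forall_2)

lemma complex_of_linear: "bounded_linear (\<lambda>x::real^2. Complex (x$1) (x$2))"
  by (rule linear_conv_bounded_linear[THEN iffD1], rule linearI)
    (simp_all add: complex_eq_iff)

lemma plane_of_Complex [simp]: "plane_of (Complex (x$1) (x$2)) = x"
  by (simp add: vec_eq_iff forall_2)

lemma Complex_plane_of [simp]: "Complex (plane_of z $ 1) (plane_of z $ 2) = z"
  by (simp add: complex_eq_iff)

context
  fixes M :: "'a topology" and A :: "'a chart set"
  assumes surf: "oriented_surface M A"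
begin

lemma chart_at_mem:
  assumes "p \<in> topspace M"
  shows "chart_at A p \<in> A" "p \<in> fst (chart_at A p)"
proof -
  have "\<exists>c. c \<in> A \<and> p \<in> fst c"
    using surf assms unfolding oriented_surface_def by blast
  then have "chart_at A p \<in> A \<and> p \<in> fst (chart_at A p)"
    unfolding chart_at_def by (rule someI_ex)
  then show "chart_at A p \<in> A" "p \<in> fst (chart_at A p)" by auto
qed

lemma dom_subset: "c \<in> A \<Longrightarrow> fst c \<subseteq> topspace M"
  using surf unfolding oriented_surface_def by blast

lemma chart_inj: 
  assumes "c \<in> A" shows "inj_on (snd c) (fst c)"
proof -
  have "homeomorphic_map (subtopology M (fst c)) (top_of_set (snd c ` fst c)) (snd c)"
    using surf assms unfolding oriented_surface_def by blast
  then have "inj_on (snd c) (topspace (subtopology M (fst c)))"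
    by (rule homeomorphic_imp_injective_map)
  moreover have "topspace (subtopology M (fst c)) = fst c"
    using dom_subset[OF assms] by auto
  ultimately show ?thesis by simp
qed

lemma chart_inv_chart: "c \<in> A \<Longrightarrow> p \<in> fst c \<Longrightarrow> chart_inv c (snd c p) = p"
  unfolding chart_inv_def by (rule inv_into_f_f[OF chart_inj])

lemma overlap_open:
  assumes "c \<in> A" "d \<in> A"
  shows "open (snd c ` (fst c \<inter> fst d))"
proof -
  have "homeomorphic_map (subtopology M (fst c)) (top_of_set (snd c ` fst c)) (snd c)"
    and o: "open (snd c ` fst c)" and "openin M (fst d)"
    using surf assms unfolding oriented_surface_def by blast+
  then have "open_map (subtopology M (fst c)) (top_of_set (snd c ` fst c)) (snd c)"
    by (simp add: homeomorphic_eq_everything_map)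
  moreover have "openin (subtopology M (fst c)) (fst c \<inter> fst d)"
    using \<open>openin M (fst d)\<close> by (metis inf_commute openin_subtopology_Int)
  ultimately have "openin (top_of_set (snd c ` fst c)) (snd c ` (fst c \<inter> fst d))"
    unfolding open_map_def by blast
  then show ?thesis using o by (metis openin_open_trans)
qed

lemma transition_derivative:
  assumes "c \<in> A" "d \<in> A" "p \<in> fst c" "p \<in> fst d"
  shows "((snd d \<circ> chart_inv c) has_derivative tangent_change c d p) (at (snd c p))"
proof -
  have "smooth_on (snd d \<circ> chart_inv c) (snd c ` (fst c \<inter> fst d))"
    using surf assms unfolding oriented_surface_def by blast
  then have "Ck_on (Suc 0) (snd d \<circ> chart_inv c) (snd c ` (fst c \<inter> fst d))"
    unfolding smooth_on_def by blast
  then have "\<exists>f'. ((snd d \<circ> chart_inv c) has_derivative f') (at (snd c p))"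
    using assms by auto
  then show ?thesis
    unfolding tangent_change_def by (metis frechet_derivative_at)
qed

lemma tangent_change_inverse:
  assumes "c \<in> A" "d \<in> A" "p \<in> fst c" "p \<in> fst d"
  shows "tangent_change c d p (tangent_change d c p v) = v"
proof -
  let ?S = "snd d ` (fst d \<inter> fst c)"
  have pd: "chart_inv d (snd d p) = p" using chart_inv_chart assms by blast
  have "((snd c \<circ> chart_inv d) has_derivative tangent_change d c p) (at (snd d p))"
    by (rule transition_derivative) (use assms in auto)
  moreover have "((snd d \<circ> chart_inv c) has_derivative tangent_change c d p)
      (at ((snd c \<circ> chart_inv d) (snd d p)))"
    using transition_derivative[OF assms] pd by simp
  ultimately have "((snd d \<circ> chart_inv c) \<circ> (snd c \<circ> chart_inv d) has_derivative
      tangent_change c d p \<circ> tangent_change d c p) (at (snd d p))"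
    by (rule diff_chain_at)
  then have "((\<lambda>x. x) has_derivative tangent_change c d p \<circ> tangent_change d c p) (at (snd d p))"
  proof (rule has_derivative_transform_within_open[where s = ?S])
    show "open ?S" using overlap_open assms by blast
    show "snd d p \<in> ?S" using assms by auto
    fix x assume "x \<in> ?S"
    then obtain q where "q \<in> fst d" "q \<in> fst c" "x = snd d q" by auto
    then show "((snd d \<circ> chart_inv c) \<circ> (snd c \<circ> chart_inv d)) x = x"
      using chart_inv_chart assms by simp
  qed
  then have "tangent_change c d p \<circ> tangent_change d c p = (\<lambda>x. x)"
    by (rule has_derivative_unique[OF _ has_derivative_ident])
  then show ?thesis by (metis comp_apply)
qed

lemma has_derivative_change_chart:
  assumes "c \<in> A" "d \<in> A" "p \<in> fst c" "p \<in> fst d"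
    and "((f \<circ> chart_inv d) has_derivative D) (at (snd d p))"
  shows "((f \<circ> chart_inv c) has_derivative D \<circ> tangent_change c d p) (at (snd c p))"
proof -
  let ?S = "snd c ` (fst c \<inter> fst d)"
  have pc: "chart_inv c (snd c p) = p" using chart_inv_chart assms by blast
  have "((f \<circ> chart_inv d) \<circ> (snd d \<circ> chart_inv c) has_derivative
      D \<circ> tangent_change c d p) (at (snd c p))"
    by (rule diff_chain_at[OF transition_derivative[OF assms(1-4)]]) (use assms pc in simp)
  then show ?thesis
  proof (rule has_derivative_transform_within_open[where s = ?S])
    show "open ?S" using overlap_open assms by blast
    show "snd c p \<in> ?S" using assms by auto
    fix x assume "x \<in> ?S"
    then obtain q where "q \<in> fst d" "q \<in> fst c" "x = snd c q" by auto
    then show "((f \<circ> chart_inv d) \<circ> (snd d \<circ> chart_inv c)) x = (f \<circ> chart_inv c) x"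
      using chart_inv_chart assms by simp
  qed
qed

lemma tangent_change_det:
  assumes "c \<in> A" "d \<in> A" "p \<in> fst c" "p \<in> fst d"
  shows "det (vector [tangent_change c d p v, tangent_change c d p w] :: real^2^2) > 0
     \<longleftrightarrow> det (vector [v, w] :: real^2^2) > 0"
proof -
  let ?T = "tangent_change c d p"
  have "linear ?T"
    using transition_derivative[OF assms] has_derivative_linear by blast
  then have T: "?T u = matrix ?T *v u" for u
    using matrix_vector_mul(2)[of ?T] by (simp add: fun_eq_iff)
  have "det (vector [?T v, ?T w] :: real^2^2) = det (matrix ?T) * det (vector [v, w] :: real^2^2)"
    by (subst T[of v], subst T[of w])
      (simp add: det_2 matrix_vector_mult_def sum_2 algebra_simps)
  moreover have "det (matrix ?T) > 0"
    using surf assms unfolding oriented_surface_def by blast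
  ultimately show ?thesis by (simp add: zero_less_mult_iff)
qed

lemma rot_isothermal:
  assumes "c \<in> A" "p \<in> fst c" and "r > 0"
    and r: "\<And>v w. metric_coord A g c (snd c p) v w = r * (v \<bullet> w)"
  shows "rot g p (tangent_change c (chart_at A p) p v)
       = tangent_change c (chart_at A p) p (vector [- v$2, v$1])"
proof -
  define d where "d = chart_at A p"
  define T where "T = tangent_change c d p"
  have "p \<in> topspace M" using dom_subset assms by blast
  then have d: "d \<in> A" "p \<in> fst d" unfolding d_def using chart_at_mem by auto
  have g: "g p (T v) (T w) = r * (v \<bullet> w)" for v w
    using r[of v w] chart_inv_chart[OF assms(1,2)]
    by (simp add: metric_coord_def T_def d_def Let_def)
  have dt: "det (vector [T v, T w] :: real^2^2) > 0 \<longleftrightarrow> det (vector [v, w] :: real^2^2) > 0" for v w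
    unfolding T_def by (rule tangent_change_det) (use assms d in auto)
  have TT: "T (tangent_change d c p z) = z" for z
    unfolding T_def by (rule tangent_change_inverse) (use assms d in auto)
  have "linear T"
    unfolding T_def using transition_derivative[of c d p] has_derivative_linear assms d by blast
  have T0: "T v \<noteq> 0 \<longleftrightarrow> v \<noteq> 0"
  proof -
    have "g p (T v) (T v) = r * (v \<bullet> v)" "T 0 = 0" "g p (T 0) (T 0) = 0"
      using g[of v v] g[of 0 0] linear_0[OF \<open>linear T\<close>] by auto
    then show ?thesis using \<open>r > 0\<close> by (metis inner_eq_zero_iff mult_eq_0_iff less_irrefl)
  qed
  have "rot g p (T v) = T (vector [- v$2, v$1])"
    unfolding rot_def
  proof (rule the_equality)
    have "v \<bullet> v > 0" if "v \<noteq> 0" using that by simp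
    then show "g p (T (vector [- v$2, v$1])) (T (vector [- v$2, v$1])) = g p (T v) (T v)
        \<and> g p (T v) (T (vector [- v$2, v$1])) = 0
        \<and> (T v \<noteq> 0 \<longrightarrow> 0 < det (vector [T v, T (vector [- v$2, v$1])] :: real^2^2))"
      unfolding g dt T0 by (simp add: inner_vec_def sum_2 det_2 algebra_simps)
  next
    fix z
    define y where "y = tangent_change d c p z"
    assume "g p z z = g p (T v) (T v) \<and> g p (T v) z = 0
        \<and> (T v \<noteq> 0 \<longrightarrow> 0 < det (vector [T v, z] :: real^2^2))"
    moreover have z: "z = T y" unfolding y_def TT by simp
    ultimately have yv: "y \<bullet> y = v \<bullet> v" "v \<bullet> y = 0" and
      det: "v \<noteq> 0 \<Longrightarrow> det (vector [v, y] :: real^2^2) > 0"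
      using \<open>r > 0\<close> unfolding z g dt T0 by auto
    have "y = vector [- v$2, v$1]"
    proof (cases "v = 0")
      case True
      then have "y = 0" using yv(1) by simp
      then show ?thesis using True by (simp add: vec_eq_iff forall_2)
    next
      case False
      define a b s t where "a = v$1" and "b = v$2" and "s = y$1" and "t = y$2"
      have 1: "s * s + t * t = a * a + b * b" "a * s + b * t = 0" "a * t - b * s > 0"
        using yv det[OF False]
        by (simp_all add: inner_vec_def sum_2 det_2 a_def b_def s_def t_def algebra_simps)
      define m where "m = a * a + b * b"
      have m: "m > 0"
        using inner_gt_zero_iff[THEN iffD2, OF False]
        by (simp add: m_def a_def b_def inner_vec_def sum_2)
      have "(a * t - b * s)\<^sup>2 + (a * s + b * t)\<^sup>2 = m * (s * s + t * t)"
        unfolding m_def by algebra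
      then have "(a * t - b * s)\<^sup>2 = m\<^sup>2"
        using 1 by (simp add: m_def power2_eq_square)
      then have e: "a * t - b * s = m"
        using 1 m by (simp add: power2_eq_iff_nonneg)
      have "m * s = m * (- b)" "m * t = m * a"
        using e 1(2) unfolding m_def by algebra+
      then have "s = - b" "t = a" using m mult_cancel_left[of m] by blast+
      then show ?thesis
        by (simp add: vec_eq_iff forall_2 a_def b_def s_def t_def)
    qed
    then show "z = T (vector [- v$2, v$1])" using z by simp
  qed
  then show ?thesis unfolding T_def d_def .
qed

lemma holomorphic_at_isothermal:
  assumes "c \<in> A" "p \<in> fst c" and "r > 0"
    and r: "\<And>v w. metric_coord A g c (snd c p) v w = r * (v \<bullet> w)"
  shows "holomorphic_at A g f p \<longleftrightarrow>
         (f \<circ> chart_inv c \<circ> plane_of) field_differentiable at (Complex (snd c p $ 1) (snd c p $ 2))"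
proof -
  define d where "d = chart_at A p"
  define T where "T = tangent_change c d p"
  define z where "z = Complex (snd c p $ 1) (snd c p $ 2)"
  have z: "plane_of z = snd c p" by (simp add: z_def)
  have "p \<in> topspace M" using dom_subset assms by blast
  then have d: "d \<in> A" "p \<in> fst d" unfolding d_def using chart_at_mem by auto
  have rot: "rot g p (T v) = T (vector [- v$2, v$1])" for v
    unfolding T_def d_def by (rule rot_isothermal[OF assms])
  have TT: "T (tangent_change d c p w) = w" for w
    unfolding T_def by (rule tangent_change_inverse) (use assms d in auto)
  have TT': "tangent_change d c p (T w) = w" for w
    unfolding T_def by (rule tangent_change_inverse) (use assms d in auto)
  have i: "vector [- plane_of h $ 2, plane_of h $ 1] = plane_of (\<i> * h)" for h
    by (simp add: vec_eq_iff forall_2)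
  show ?thesis
  proof
    assume "holomorphic_at A g f p"
    then obtain D where D: "((f \<circ> chart_inv d) has_derivative D) (at (snd d p))"
      and J: "\<And>v. D (rot g p v) = \<i> * D v"
      unfolding holomorphic_at_def coord_at_def d_def by blast
    define E where "E = D \<circ> T \<circ> plane_of"
    have "((f \<circ> chart_inv c) has_derivative D \<circ> T) (at (plane_of z))"
      unfolding T_def z by (rule has_derivative_change_chart) (use assms d D in auto)
    from diff_chain_at[OF bounded_linear_imp_has_derivative[OF plane_of_linear] this]
    have E: "((f \<circ> chart_inv c \<circ> plane_of) has_derivative E) (at z)"
      by (simp only: E_def comp_assoc)
    have Ei: "E (\<i> * h) = \<i> * E h" for h
      using J[of "T (plane_of h)"] unfolding rot i by (simp add: E_def)
    have lin: "linear E" using E has_derivative_linear by blast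
    have "E h = E 1 * h" for h
    proof -
      have "E h = E (Re h *\<^sub>R 1 + Im h *\<^sub>R (\<i> * 1))"
        by (rule arg_cong[where f = E]) (simp add: complex_eq_iff)
      also have "\<dots> = Re h *\<^sub>R E 1 + Im h *\<^sub>R (\<i> * E 1)"
        by (simp only: linear_add[OF lin] linear_scale[OF lin] Ei)
      also have "\<dots> = E 1 * h" by (simp add: complex_eq_iff algebra_simps)
      finally show ?thesis .
    qed
    then have "E = (*) (E 1)" by (rule ext)
    with E have "((f \<circ> chart_inv c \<circ> plane_of) has_derivative (*) (E 1)) (at z)" by simp
    then show "(f \<circ> chart_inv c \<circ> plane_of) field_differentiable
        at (Complex (snd c p $ 1) (snd c p $ 2))"
      unfolding field_differentiable_def has_field_derivative_def z_def by blast
  next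
    assume "(f \<circ> chart_inv c \<circ> plane_of) field_differentiable
        at (Complex (snd c p $ 1) (snd c p $ 2))"
    then obtain e where e: "((f \<circ> chart_inv c \<circ> plane_of) has_derivative (*) e) (at z)"
      unfolding field_differentiable_def has_field_derivative_def z_def by blast
    define L where "L = (\<lambda>x::real^2. Complex (x$1) (x$2))"
    have "(f \<circ> chart_inv c \<circ> plane_of \<circ> L has_derivative (*) e \<circ> L) (at (snd c p))"
      by (rule diff_chain_at[OF bounded_linear_imp_has_derivative])
        (use e complex_of_linear in \<open>simp_all add: L_def z_def\<close>)
    moreover have "f \<circ> chart_inv c \<circ> plane_of \<circ> L = f \<circ> chart_inv c"
      by (simp add: fun_eq_iff L_def)
    ultimately have "((f \<circ> chart_inv c) has_derivative (*) e \<circ> L) (at (snd c p))" by simp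
    then have *: "((f \<circ> chart_inv d) has_derivative (*) e \<circ> L \<circ> tangent_change d c p) (at (snd d p))"
      by (intro has_derivative_change_chart) (use assms d in auto)
    have Li: "L (vector [- w$2, w$1]) = \<i> * L w" for w
      by (simp add: L_def complex_eq_iff)
    have "((*) e \<circ> L \<circ> tangent_change d c p) (rot g p v)
        = \<i> * ((*) e \<circ> L \<circ> tangent_change d c p) v" for v
      using rot[of "tangent_change d c p v"] by (simp add: TT TT' Li)
    with * show "holomorphic_at A g f p"
      unfolding holomorphic_at_def coord_at_def d_def by blast
  qed
qed

lemma holomorphic_iff_isothermal:
  assumes "c \<in> A" and "isothermal_chart A g c"
  shows "(\<forall>p \<in> fst c. holomorphic_at A g f p) \<longleftrightarrow>
         (f \<circ> chart_inv c \<circ> plane_of) holomorphic_on (plane_of -` (snd c ` fst c))"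
proof -
  let ?S = "plane_of -` (snd c ` fst c)"
  have "open (snd c ` fst c)" using surf assms unfolding oriented_surface_def by blast
  moreover have "continuous_on UNIV plane_of"
    using plane_of_linear by (rule linear_continuous_on)
  ultimately have "open ?S" by (rule open_vimage)
  have S: "?S = (\<lambda>p. Complex (snd c p $ 1) (snd c p $ 2)) ` fst c"
  proof (intro equalityI subsetI)
    fix z assume "z \<in> ?S"
    then obtain p where "p \<in> fst c" "plane_of z = snd c p" by auto
    then have "z = Complex (snd c p $ 1) (snd c p $ 2)"
      using Complex_plane_of[of z] by simp
    then show "z \<in> (\<lambda>p. Complex (snd c p $ 1) (snd c p $ 2)) ` fst c"
      using \<open>p \<in> fst c\<close> by (rule image_eqI)
  qed auto
  have "holomorphic_at A g f p \<longleftrightarrow>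
         (f \<circ> chart_inv c \<circ> plane_of) field_differentiable at (Complex (snd c p $ 1) (snd c p $ 2))"
    if p: "p \<in> fst c" for p
  proof -
    obtain r where "r > 0" "\<And>v w. metric_coord A g c (snd c p) v w = r * (v \<bullet> w)"
      using assms(2) p unfolding isothermal_chart_def by blast
    then show ?thesis using holomorphic_at_isothermal assms(1) p by blast
  qed
  then show ?thesis
    using \<open>open ?S\<close> by (simp add: holomorphic_on_open field_differentiable_def S)
qed

end

end

theory Submission
  imports Defs
begin

text \<open>At a point of $SM$ every 2-vector is simple, and in the orthonormal coframe \<open>\<phi>\<close> is the linear
  form \<open>X \<and> Y \<mapsto> b \<bullet> (X \<times> Y)\<close> of $\mathbb{R}^3$, with comass the norm of \<open>b\<close>.

  For closedness, the equations $de^0 = e^2 \wedge e^1$ and $de^1 = e^0 \wedge e^2$ give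
  $\varphi = b_2\, e^0 \wedge e^1 - b_1\, de^1 - b_0\, de^0$, in which only forms that are easy to write in
  charts occur. Since $dd = 0$ and the $b_i$ are pulled back from the surface,
  $d\varphi = (db_1(Jv) + db_0(v))\, e^0 \wedge e^1 \wedge e^2$ at the unit vector $v$. Its vanishing for all
  $v$ is the Cauchy-Riemann equation; neither $de^2$ nor the curvature is needed.\<close>

section \<open>Calculus of functions of class $C^k$\<close>

text \<open>The obstacle is the representation of tangent vectors: at p they are stored in the chart
  \<open>chart_at A p\<close>, which may jump with p, so a form known only pointwise cannot be
  differentiated. Each form to be differentiated is therefore first rewritten in one chart fixed
  around the point (\<open>theta_chart\<close>). Derivatives are then taken covariantly along a map
  into that chart, so that the connection enters only through compatibility with the metric,
  vanishing torsion and parallelism of the area form. Replacing the wedges with e^2 by de^1 and de^0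
  has two benefits. The form e^2 contains the Christoffel symbols, and differentiating it would
  bring in derivatives of the connection. Moreover the b_i are only of class C^1, and after the
  replacement the second derivatives that cancel in dd = 0 all fall on smooth forms. Closedness is a
  statement about all parametrizations of SM. To extract the Cauchy-Riemann equation at p from it,
  actual parametrizations through enough unit vectors at p have to be exhibited, and their
  injectivity, smoothness and immersivity checked.\<close>

lemma frechet_derivative_eq: "(f has_derivative D) (at x) \<Longrightarrow> frechet_derivative f (at x) a = D a"
  by (metis frechet_derivative_at)

text \<open>If psi composed with Phi is the linear map l near y, the chain rule factors l through D,
  so l vanishes on the kernel of D. This shows that a map is an immersion from a differentiable left
  inverse, without computing the differential of the map.\<close>

lemma kernel_component:
  fixes \<Phi> :: "'e::real_normed_vector \<Rightarrow> 'f::real_normed_vector" and \<psi> :: "'f \<Rightarrow> real"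
  assumes \<Phi>: "(\<Phi> has_derivative D) (at y)" and \<psi>: "\<psi> differentiable at (\<Phi> y)"
    and N: "open N" "y \<in> N" and left: "\<And>z. z \<in> N \<Longrightarrow> \<psi> (\<Phi> z) = l z"
    and l: "bounded_linear l" and h: "D h = 0"
  shows "l h = 0"
proof -
  obtain E where E: "(\<psi> has_derivative E) (at (\<Phi> y))" using \<psi> unfolding differentiable_def by blast
  have "(\<psi> \<circ> \<Phi> has_derivative E \<circ> D) (at y)" by (rule diff_chain_at[OF \<Phi> E])
  then have "(l has_derivative E \<circ> D) (at y)"
    by (rule has_derivative_transform_within_open[OF _ N]) (simp add: left)
  then have "l = E \<circ> D" using has_derivative_unique bounded_linear_imp_has_derivative[OF l] by blast
  then show ?thesis using h linear_0[OF has_derivative_linear[OF E]] by simp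
qed

lemma Ck_on_cong:
  assumes "open S" "Ck_on k f S" "\<And>x. x \<in> S \<Longrightarrow> f x = h x"
  shows "Ck_on k h S"
proof (cases k)
  case 0
  then show ?thesis using assms continuous_on_cong[of S S f h] by simp
next
  case (Suc n)
  then obtain f' where f': "\<forall>x\<in>S. (f has_derivative f' x) (at x)" "\<forall>v. Ck_on n (\<lambda>x. f' x v) S"
    using assms(2) by auto
  have "(h has_derivative f' x) (at x)" if "x \<in> S" for x
    using has_derivative_transform_within_open[OF _ assms(1) that] f' that assms(3) by blast
  then show ?thesis using f' Suc by auto
qed

lemma Ck_on_subset: "Ck_on k f S \<Longrightarrow> T \<subseteq> S \<Longrightarrow> Ck_on k f T"
proof (induction k arbitrary: f)
  case 0
  then show ?case using continuous_on_subset by auto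
next
  case (Suc k)
  then show ?case by (simp add: subset_iff) blast
qed

lemma Ck_on_Suc_imp: "Ck_on (Suc k) f S \<Longrightarrow> Ck_on k f S"
proof (induction k arbitrary: f)
  case 0
  then obtain f' where "\<forall>x\<in>S. (f has_derivative f' x) (at x)" by auto
  then show ?case
    using has_derivative_continuous continuous_at_imp_continuous_on by (metis Ck_on.simps(1))
next
  case (Suc k)
  then obtain f' where "\<forall>x\<in>S. (f has_derivative f' x) (at x)" "\<forall>v. Ck_on (Suc k) (\<lambda>x. f' x v) S"
    by auto
  then show ?case using Suc.IH by (simp only: Ck_on.simps(2)[of k]) blast
qed

lemma Ck_on_imp_differentiable:
  "Ck_on (Suc k) f S \<Longrightarrow> x \<in> S \<Longrightarrow> (f has_derivative frechet_derivative f (at x)) (at x)"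
  by (metis Ck_on.simps(2) differentiableI frechet_derivative_works)

lemma Ck_on_frechet_derivative:
  assumes "open S" "Ck_on (Suc k) f S"
  shows "Ck_on k (\<lambda>x. frechet_derivative f (at x) v) S"
proof -
  obtain f' where f': "\<forall>x\<in>S. (f has_derivative f' x) (at x)" "\<forall>v. Ck_on k (\<lambda>x. f' x v) S"
    using assms(2) by auto
  have "frechet_derivative f (at x) = f' x" if "x \<in> S" for x
    using f'(1) that frechet_derivative_at by fastforce
  then show ?thesis using Ck_on_cong[OF assms(1), of k "\<lambda>x. f' x v"] f'(2) by simp
qed

lemma Ck_on_SucI:
  assumes "\<forall>x\<in>S. (f has_derivative f' x) (at x)" "\<And>v. Ck_on k (\<lambda>x. f' x v) S"
  shows "Ck_on (Suc k) f S"
  using assms by auto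

lemma Ck_on_const: "Ck_on k (\<lambda>x. c) S"
proof (induction k arbitrary: c)
  case (Suc k)
  have "(\<forall>x\<in>S. ((\<lambda>x. c) has_derivative (\<lambda>h. 0)) (at x))" by simp
  then show ?case by (rule Ck_on_SucI) (rule Suc)
qed simp

lemma Ck_on_bounded_linear_compose:
  "bounded_linear L \<Longrightarrow> Ck_on k f S \<Longrightarrow> Ck_on k (\<lambda>x. L (f x)) S"
proof (induction k arbitrary: f)
  case 0
  then show ?case using bounded_linear.continuous_on by auto
next
  case (Suc k)
  then obtain f' where f': "\<forall>x\<in>S. (f has_derivative f' x) (at x)" "\<forall>v. Ck_on k (\<lambda>x. f' x v) S"
    by auto
  have "\<forall>x\<in>S. ((\<lambda>x. L (f x)) has_derivative (\<lambda>h. L (f' x h))) (at x)"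
    using f'(1) Suc.prems(1) bounded_linear.has_derivative by blast
  moreover have "Ck_on k (\<lambda>x. L (f' x v)) S" for v using Suc f'(2) by blast
  ultimately show ?case by (rule Ck_on_SucI)
qed

lemma Ck_on_id: "Ck_on k (\<lambda>x. x) S"
proof (cases k)
  case (Suc n)
  have "\<forall>x\<in>S. ((\<lambda>x. x) has_derivative (\<lambda>h. h)) (at x)" by simp
  then show ?thesis unfolding Suc by (rule Ck_on_SucI) (rule Ck_on_const)
qed simp

lemma Ck_on_bounded_linear: "bounded_linear L \<Longrightarrow> Ck_on k L S"
  using Ck_on_bounded_linear_compose[OF _ Ck_on_id] by blast

lemma Ck_on_add: "Ck_on k f S \<Longrightarrow> Ck_on k h S \<Longrightarrow> Ck_on k (\<lambda>x. f x + h x) S"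
proof (induction k arbitrary: f h)
  case 0
  then show ?case by (simp add: continuous_on_add)
next
  case (Suc k)
  then obtain f' h' where f': "\<forall>x\<in>S. (f has_derivative f' x) (at x)" "\<forall>v. Ck_on k (\<lambda>x. f' x v) S"
    and h': "\<forall>x\<in>S. (h has_derivative h' x) (at x)" "\<forall>v. Ck_on k (\<lambda>x. h' x v) S"
    by auto
  have "\<forall>x\<in>S. ((\<lambda>x. f x + h x) has_derivative (\<lambda>v. f' x v + h' x v)) (at x)"
    using f'(1) h'(1) has_derivative_add by blast
  moreover have "Ck_on k (\<lambda>x. f' x v + h' x v) S" for v using Suc.IH f'(2) h'(2) by blast
  ultimately show ?case by (rule Ck_on_SucI)
qed

lemma Ck_on_sum: "(\<And>i. i \<in> I \<Longrightarrow> Ck_on k (f i) S) \<Longrightarrow> Ck_on k (\<lambda>x. \<Sum>i\<in>I. f i x) S"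
  by (induction I rule: infinite_finite_induct) (auto intro: Ck_on_const Ck_on_add)

lemma Ck_on_bilinear:
  assumes "bounded_bilinear p"
  shows "Ck_on k f S \<Longrightarrow> Ck_on k h S \<Longrightarrow> Ck_on k (\<lambda>x. p (f x) (h x)) S"
proof (induction k arbitrary: f h)
  case 0
  then show ?case using bounded_bilinear.continuous_on[OF assms] by auto
next
  case (Suc k)
  then obtain f' h' where f': "\<forall>x\<in>S. (f has_derivative f' x) (at x)" "\<forall>v. Ck_on k (\<lambda>x. f' x v) S"
    and h': "\<forall>x\<in>S. (h has_derivative h' x) (at x)" "\<forall>v. Ck_on k (\<lambda>x. h' x v) S"
    by auto
  have "\<forall>x\<in>S. ((\<lambda>x. p (f x) (h x)) has_derivative (\<lambda>v. p (f x) (h' x v) + p (f' x v) (h x))) (at x)"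
    using f'(1) h'(1) bounded_bilinear.FDERIV[OF assms] by blast
  moreover have "Ck_on k (\<lambda>x. p (f x) (h' x v) + p (f' x v) (h x)) S" for v
    using Suc.IH f'(2) h'(2) Suc.prems[THEN Ck_on_Suc_imp] by (intro Ck_on_add) blast+
  ultimately show ?case by (rule Ck_on_SucI)
qed

lemmas Ck_on_mult = Ck_on_bilinear[OF bounded_bilinear_mult]
lemmas Ck_on_scaleR = Ck_on_bilinear[OF bounded_bilinear_scaleR]
lemmas Ck_on_inner_left = Ck_on_bounded_linear_compose[OF bounded_linear_inner_left]
lemmas Ck_on_nth = Ck_on_bounded_linear_compose[OF bounded_linear_vec_nth]
lemmas Ck_on_fst = Ck_on_bounded_linear_compose[OF bounded_linear_fst]
lemmas Ck_on_snd = Ck_on_bounded_linear_compose[OF bounded_linear_snd]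

lemma Ck_on_minus: "Ck_on k f S \<Longrightarrow> Ck_on k (\<lambda>x. - f x) S"
  using Ck_on_bounded_linear_compose[OF bounded_linear_minus[OF bounded_linear_ident]] .

lemma Ck_on_diff: "Ck_on k f S \<Longrightarrow> Ck_on k h S \<Longrightarrow> Ck_on k (\<lambda>x. f x - h x) S"
  using Ck_on_add[OF _ Ck_on_minus] by force

lemma Ck_on_Pair:
  fixes f :: "'a::euclidean_space \<Rightarrow> 'b::real_normed_vector"
    and h :: "'a \<Rightarrow> 'c::real_normed_vector"
  assumes "Ck_on k f S" "Ck_on k h S"
  shows "Ck_on k (\<lambda>x. (f x, h x)) S"
proof -
  have "bounded_linear (\<lambda>x::'b. (x, 0::'c))" "bounded_linear (\<lambda>x::'c. (0::'b, x))"
    by (auto intro: bounded_linear_Pair bounded_linear_ident bounded_linear_zero)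
  then have "Ck_on k (\<lambda>x. (f x, 0::'c)) S" "Ck_on k (\<lambda>x. (0::'b, h x)) S"
    using assms by (auto dest: Ck_on_bounded_linear_compose)
  from Ck_on_add[OF this] show ?thesis by simp
qed

lemma Ck_on_compose:
  fixes f :: "'a::euclidean_space \<Rightarrow> 'b::euclidean_space"
  assumes "f ` S \<subseteq> T"
  shows "Ck_on k f S \<Longrightarrow> Ck_on k h T \<Longrightarrow> Ck_on k (\<lambda>x. h (f x)) S"
proof (induction k arbitrary: h)
  case 0
  then show ?case using assms continuous_on_compose2[of T h S f] by simp
next
  case (Suc k)
  then obtain f' h' where f': "\<forall>x\<in>S. (f has_derivative f' x) (at x)" "\<forall>v. Ck_on k (\<lambda>x. f' x v) S"
    and h': "\<forall>x\<in>T. (h has_derivative h' x) (at x)" "\<forall>v. Ck_on k (\<lambda>x. h' x v) T"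
    by auto
  \<comment> \<open>\<open>Ck_on\<close> controls \<open>h'\<close> only in fixed directions,
    whereas the chain rule applies it to a moving vector. Expanding that vector in the basis leaves
    scalar coefficients times \<open>h' (f x) i\<close> with i fixed, to which the induction
    hypothesis applies.\<close>
  have d: "\<forall>x\<in>S. ((\<lambda>x. h (f x)) has_derivative
      (\<lambda>v. \<Sum>i\<in>Basis. (f' x v \<bullet> i) *\<^sub>R h' (f x) i)) (at x)"
  proof
    fix x assume "x \<in> S"
    then have hf: "(h has_derivative h' (f x)) (at (f x))" using h' assms by blast
    have "((\<lambda>x. h (f x)) has_derivative (\<lambda>v. h' (f x) (f' x v))) (at x)"
      using diff_chain_at[of f "f' x" x h "h' (f x)"] hf f' \<open>x \<in> S\<close> by (simp add: o_def)
    moreover have "(\<lambda>v. h' (f x) (f' x v)) = (\<lambda>v. \<Sum>i\<in>Basis. (f' x v \<bullet> i) *\<^sub>R h' (f x) i)"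
    proof
      fix v
      define w where "w = f' x v"
      have l: "linear (h' (f x))" using hf has_derivative_linear by blast
      have "h' (f x) w = h' (f x) (\<Sum>i\<in>Basis. (w \<bullet> i) *\<^sub>R i)" by (simp add: euclidean_representation)
      then show "h' (f x) (f' x v) = (\<Sum>i\<in>Basis. (f' x v \<bullet> i) *\<^sub>R h' (f x) i)"
        by (simp add: linear_sum[OF l] linear_scale[OF l] w_def)
    qed
    ultimately show "((\<lambda>x. h (f x)) has_derivative
      (\<lambda>v. \<Sum>i\<in>Basis. (f' x v \<bullet> i) *\<^sub>R h' (f x) i)) (at x)" by (simp only:)
  qed
  have "Ck_on k f S" using Suc.prems Ck_on_Suc_imp by blast
  then have "Ck_on k (\<lambda>x. h' (f x) i) S" for i using Suc.IH h'(2) by blast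
  then have "Ck_on k (\<lambda>x. \<Sum>i\<in>Basis. (f' x v \<bullet> i) *\<^sub>R h' (f x) i) S" for v
    by (intro Ck_on_sum Ck_on_scaleR Ck_on_inner_left) (use f'(2) in auto)
  then show ?case by (rule Ck_on_SucI[OF d])
qed

text \<open>The exponent is arbitrary so that the induction passes from r to r - 1. The uses are r =
  1/2, for the area density, and r = -1/2, for normalising a vector.\<close>

lemma Ck_on_powr: "Ck_on k (\<lambda>s. s powr r) {0::real<..}"
proof (induction k arbitrary: r)
  case 0
  then show ?case by (auto intro!: continuous_intros)
next
  case (Suc k)
  have "\<forall>s\<in>{0::real<..}. ((\<lambda>s. s powr r) has_derivative (\<lambda>h. h * (r * s powr (r - 1)))) (at s)"
    using has_real_derivative_powr[of _ r] by (simp add: has_field_derivative_def mult.commute[of _ "r * _"])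
  moreover have "Ck_on k (\<lambda>s. v * (r * s powr (r - 1))) {0<..}" for v
    by (intro Ck_on_mult Ck_on_const Suc)
  ultimately show ?case by (rule Ck_on_SucI)
qed

text \<open>Both mixed second derivatives are limits of the same second difference quotient, which the
  mean value theorem identifies with values of the second derivative at nearby points.\<close>

lemma second_difference:
  fixes f :: "'a::euclidean_space \<Rightarrow> real"
  assumes f: "\<And>y. y \<in> ball x e \<Longrightarrow> (f has_derivative f' y) (at y)"
    and f': "\<And>y. y \<in> ball x e \<Longrightarrow> ((\<lambda>y. f' y a) has_derivative f'' y) (at y)"
    and s: "s > 0" "s * (norm a + norm b) < e"
  shows "\<exists>y\<in>ball x e. f (x + s *\<^sub>R a + s *\<^sub>R b) - f (x + s *\<^sub>R a) - f (x + s *\<^sub>R b) + f x = s\<^sup>2 * f'' y b"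
proof -
  have ball: "x + r *\<^sub>R a + t *\<^sub>R b \<in> ball x e" if "0 \<le> r" "r \<le> s" "0 \<le> t" "t \<le> s" for r t
  proof -
    have "norm (r *\<^sub>R a + t *\<^sub>R b) \<le> r * norm a + t * norm b"
      using norm_triangle_ineq[of "r *\<^sub>R a" "t *\<^sub>R b"] that by simp
    also have "\<dots> \<le> s * norm a + s * norm b"
      using that by (intro add_mono mult_right_mono) auto
    finally show ?thesis using s(2) by (simp add: dist_norm norm_minus_commute algebra_simps)
  qed
  \<comment> \<open>The second difference is the increment of h from 0 to s. One mean value theorem
    in r produces \<open>f'\<close> in direction a at two points differing by s times b, and another
    one along b produces \<open>f''\<close>.\<close>
  define h where "h r = f (x + r *\<^sub>R a + s *\<^sub>R b) - f (x + r *\<^sub>R a)" for r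
  have h': "(h has_real_derivative f' (x + r *\<^sub>R a + s *\<^sub>R b) a - f' (x + r *\<^sub>R a) a) (at r)"
    if "0 \<le> r" "r \<le> s" for r
  proof -
    have *: "((\<lambda>r. f (x + r *\<^sub>R a + t *\<^sub>R b)) has_derivative (\<lambda>h. h * f' (x + r *\<^sub>R a + t *\<^sub>R b) a)) (at r)"
      if "0 \<le> t" "t \<le> s" for t
    proof -
      have F: "(f has_derivative f' (x + r *\<^sub>R a + t *\<^sub>R b)) (at (x + r *\<^sub>R a + t *\<^sub>R b))"
        using f ball that \<open>0 \<le> r\<close> \<open>r \<le> s\<close> by blast
      have "((\<lambda>r. x + r *\<^sub>R a + t *\<^sub>R b) has_derivative (\<lambda>h. h *\<^sub>R a)) (at r)"
        by (auto intro!: derivative_eq_intros)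
      from diff_chain_at[OF this F] show ?thesis
        by (simp add: o_def linear_scale[OF has_derivative_linear[OF F]])
    qed
    have "((\<lambda>r. f (x + r *\<^sub>R a + s *\<^sub>R b) - f (x + r *\<^sub>R a + 0 *\<^sub>R b)) has_derivative
        (\<lambda>h. h * f' (x + r *\<^sub>R a + s *\<^sub>R b) a - h * f' (x + r *\<^sub>R a + 0 *\<^sub>R b) a)) (at r)"
      by (intro has_derivative_diff *) (use s in auto)
    moreover have "(\<lambda>h. h * f' (x + r *\<^sub>R a + s *\<^sub>R b) a - h * f' (x + r *\<^sub>R a + 0 *\<^sub>R b) a)
        = (*) (f' (x + r *\<^sub>R a + s *\<^sub>R b) a - f' (x + r *\<^sub>R a) a)"
      by (simp add: fun_eq_iff algebra_simps)
    ultimately show ?thesis unfolding h_def has_field_derivative_def by simp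
  qed
  obtain r where r: "0 < r" "r < s" "h s - h 0 = (s - 0) * (f' (x + r *\<^sub>R a + s *\<^sub>R b) a - f' (x + r *\<^sub>R a) a)"
    using MVT2[of 0 s h "\<lambda>r. f' (x + r *\<^sub>R a + s *\<^sub>R b) a - f' (x + r *\<^sub>R a) a"] s h' by auto
  have "((\<lambda>t. f' (x + r *\<^sub>R a + t *\<^sub>R b) a) has_real_derivative f'' (x + r *\<^sub>R a + t *\<^sub>R b) b) (at t)"
    if "0 \<le> t" "t \<le> s" for t
  proof -
    have F: "((\<lambda>y. f' y a) has_derivative f'' (x + r *\<^sub>R a + t *\<^sub>R b)) (at (x + r *\<^sub>R a + t *\<^sub>R b))"
      using f' ball that r by simp
    have "((\<lambda>t. x + r *\<^sub>R a + t *\<^sub>R b) has_derivative (\<lambda>h. h *\<^sub>R b)) (at t)"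
      by (auto intro!: derivative_eq_intros)
    from diff_chain_at[OF this F] show ?thesis
      by (simp add: o_def linear_scale[OF has_derivative_linear[OF F]] has_field_derivative_def mult.commute[of _ "f'' _ b"])
  qed
  then obtain t where t: "0 < t" "t < s"
    "f' (x + r *\<^sub>R a + s *\<^sub>R b) a - f' (x + r *\<^sub>R a + 0 *\<^sub>R b) a = (s - 0) * f'' (x + r *\<^sub>R a + t *\<^sub>R b) b"
    using MVT2[of 0 s "\<lambda>t. f' (x + r *\<^sub>R a + t *\<^sub>R b) a" "\<lambda>t. f'' (x + r *\<^sub>R a + t *\<^sub>R b) b"] s by auto
  have "f (x + s *\<^sub>R a + s *\<^sub>R b) - f (x + s *\<^sub>R a) - f (x + s *\<^sub>R b) + f x = h s - h 0"
    by (simp add: h_def)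
  also have "\<dots> = s\<^sup>2 * f'' (x + r *\<^sub>R a + t *\<^sub>R b) b"
    using r(3) t(3) by (simp add: power2_eq_square)
  finally show ?thesis using ball[of r t] r t by auto
qed

lemma second_derivative_symmetric:
  fixes f :: "'a::euclidean_space \<Rightarrow> real"
  assumes S: "open S" "x \<in> S" and f: "Ck_on (Suc (Suc 0)) f S"
  shows "frechet_derivative (\<lambda>y. frechet_derivative f (at y) a) (at x) b
       = frechet_derivative (\<lambda>y. frechet_derivative f (at y) b) (at x) a"
proof (rule ccontr)
  let ?f' = "\<lambda>y. frechet_derivative f (at y)"
  let ?f'' = "\<lambda>v y. frechet_derivative (\<lambda>y. ?f' y v) (at y)"
  assume ne: "?f'' a x b \<noteq> ?f'' b x a"
  \<comment> \<open>Half the gap: one common value cannot be closer than this to both mixed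
    derivatives at x.\<close>
  define \<epsilon> where "\<epsilon> = \<bar>?f'' a x b - ?f'' b x a\<bar> / 2"
  have "\<epsilon> > 0" using ne by (simp add: \<epsilon>_def)
  have C1: "Ck_on (Suc 0) (\<lambda>y. ?f' y v) S" for v using Ck_on_frechet_derivative f S by blast
  have cont: "\<exists>d>0. \<forall>y. dist y x < d \<longrightarrow> dist (?f'' v y w) (?f'' v x w) < \<epsilon>" for v w
  proof -
    have "Ck_on 0 (\<lambda>y. ?f'' v y w) S" using Ck_on_frechet_derivative C1 S by blast
    then have "isCont (\<lambda>y. ?f'' v y w) x"
      using S continuous_on_eq_continuous_at by auto
    then show ?thesis using \<open>\<epsilon> > 0\<close> unfolding continuous_at_eps_delta by blast
  qed
  obtain d1 where d1: "d1 > 0" "\<And>y. dist y x < d1 \<Longrightarrow> dist (?f'' a y b) (?f'' a x b) < \<epsilon>"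
    using cont by blast
  obtain d2 where d2: "d2 > 0" "\<And>y. dist y x < d2 \<Longrightarrow> dist (?f'' b y a) (?f'' b x a) < \<epsilon>"
    using cont by blast
  obtain d3 where d3: "d3 > 0" "ball x d3 \<subseteq> S" using S open_contains_ball by blast
  define e where "e = min d1 (min d2 d3)"
  have e: "e > 0" "e \<le> d1" "e \<le> d2" "ball x e \<subseteq> S" using d1 d2 d3 by (auto simp: e_def)
  \<comment> \<open>Small enough that the parallelogram spanned by s times a and s times b stays in
    the ball; the added 1 keeps the denominator positive when a and b vanish.\<close>
  define s where "s = e / (2 * (norm a + norm b + 1))"
  have pos: "2 * (norm a + norm b + 1) > 0" by (smt (verit) norm_ge_zero)
  have s: "s > 0" unfolding s_def using e pos by simp
  have "s * (norm a + norm b) < s * (2 * (norm a + norm b + 1))"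
    using s by (intro mult_strict_left_mono) (smt (verit) norm_ge_zero)+
  also have "\<dots> = e" using pos by (simp add: s_def)
  finally have s2: "s * (norm a + norm b) < e" .
  then have s2': "s * (norm b + norm a) < e" by (simp add: add.commute)
  have D: "(f has_derivative ?f' y) (at y)" "((\<lambda>y. ?f' y v) has_derivative ?f'' v y) (at y)"
    if "y \<in> ball x e" for y v
    using that e Ck_on_imp_differentiable[OF f] Ck_on_imp_differentiable[OF C1] by blast+
  let ?\<Delta> = "f (x + s *\<^sub>R a + s *\<^sub>R b) - f (x + s *\<^sub>R a) - f (x + s *\<^sub>R b) + f x"
  obtain y where y: "y \<in> ball x e" "?\<Delta> = s\<^sup>2 * ?f'' a y b"
    using second_difference[OF D(1) D(2) s s2] by blast
  obtain z where z: "z \<in> ball x e"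
      "f (x + s *\<^sub>R b + s *\<^sub>R a) - f (x + s *\<^sub>R b) - f (x + s *\<^sub>R a) + f x = s\<^sup>2 * ?f'' b z a"
    using second_difference[OF D(1) D(2) s s2'] by blast
  have "x + s *\<^sub>R b + s *\<^sub>R a = x + s *\<^sub>R a + s *\<^sub>R b" by simp
  with y(2) z(2) have "s\<^sup>2 * ?f'' a y b = s\<^sup>2 * ?f'' b z a"
    by (simp only:)
  then have "?f'' a y b = ?f'' b z a" using s by simp
  moreover have "dist (?f'' a y b) (?f'' a x b) < \<epsilon>" "dist (?f'' b z a) (?f'' b x a) < \<epsilon>"
    using d1(2)[of y] d2(2)[of z] y(1) z(1) e by (auto simp: dist_commute)
  ultimately show False unfolding \<epsilon>_def dist_real_def by argo
qed

section \<open>Inner products on the plane\<close>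

definition inner_form :: "(real^2 \<Rightarrow> real^2 \<Rightarrow> real) \<Rightarrow> bool" where
  "inner_form q \<longleftrightarrow> bilinear q \<and> (\<forall>v w. q v w = q w v) \<and> (\<forall>v. v \<noteq> 0 \<longrightarrow> q v v > 0)"

definition det2 :: "real^2 \<Rightarrow> real^2 \<Rightarrow> real" where
  "det2 v w = v$1 * w$2 - v$2 * w$1"

abbreviation e1 :: "real^2" where "e1 \<equiv> axis 1 1"
abbreviation e2 :: "real^2" where "e2 \<equiv> axis 2 1"

definition gram :: "(real^2 \<Rightarrow> real^2 \<Rightarrow> real) \<Rightarrow> real" where
  "gram q = q e1 e1 * q e2 e2 - (q e1 e2)\<^sup>2"

definition area_density :: "(real^2 \<Rightarrow> real^2 \<Rightarrow> real) \<Rightarrow> real" where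
  "area_density q = sqrt (gram q)"

text \<open>A closed formula for the rotation J by a right angle, which \<open>rot\<close> only
  describes. It is found by representing the area form through the inner product: q w (J v) has to
  be the oriented area of v and w, as \<open>area_quarter_turn\<close> confirms.\<close>

definition quarter_turn :: "(real^2 \<Rightarrow> real^2 \<Rightarrow> real) \<Rightarrow> real^2 \<Rightarrow> real^2" where
  "quarter_turn q v = vector [- q e2 v / area_density q, q e1 v / area_density q]"

lemma axis2_nth: "e1 $ 1 = 1" "e1 $ 2 = 0" "e2 $ 1 = 0" "e2 $ 2 = 1"
  by (simp_all add: axis_def)

lemma vec2_expand: "(v::real^2) = v$1 *\<^sub>R e1 + v$2 *\<^sub>R e2"
  by (simp add: vec_eq_iff forall_2 axis_def)

lemma linear_vec2: "linear L \<Longrightarrow> L (v::real^2) = v$1 *\<^sub>R L e1 + v$2 *\<^sub>R L e2"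
  using arg_cong[OF vec2_expand, of L v] by (simp only: linear_add linear_scale)

lemma bilinear_vec2:
  fixes p :: "real^2 \<Rightarrow> real^2 \<Rightarrow> real"
  assumes "bilinear p"
  shows "p v w = v$1 * w$1 * p e1 e1 + v$1 * w$2 * p e1 e2 + v$2 * w$1 * p e2 e1 + v$2 * w$2 * p e2 e2"
proof -
  have "p v w = v$1 *\<^sub>R p e1 w + v$2 *\<^sub>R p e2 w"
    using linear_vec2[of "\<lambda>v. p v w" v] assms by (simp add: bilinear_def)
  moreover have "p z w = w$1 *\<^sub>R p z e1 + w$2 *\<^sub>R p z e2" for z
    using linear_vec2[of "p z" w] assms by (simp add: bilinear_def)
  ultimately show ?thesis by (simp add: algebra_simps)
qed

text \<open>A linear map acts as a derivation on the one-dimensional space of 2-forms, namely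
  through its trace. Later L is the connection in a fixed direction.\<close>

lemma trace_det2:
  assumes "linear L"
  shows "(L e1 $ 1 + L e2 $ 2) * det2 v w = det2 (L v) w + det2 v (L w)"
  by (simp add: linear_vec2[OF assms, of v] linear_vec2[OF assms, of w] det2_def algebra_simps)

lemma det_vector_eq_det2: "det (vector [v, w] :: real^2^2) = det2 v w"
  by (simp add: det_2 det2_def)

lemma det2_linear:
  fixes L :: "real^2 \<Rightarrow> real^2"
  assumes "linear L"
  shows "det2 (L v) (L w) = det (matrix L) * det2 v w"
  by (simp add: linear_vec2[OF assms, of v] linear_vec2[OF assms, of w] det2_def det_2 matrix_def
      algebra_simps)

section \<open>Rotation, area and orthogonality for one inner product\<close>

context
  fixes q :: "real^2 \<Rightarrow> real^2 \<Rightarrow> real"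
  assumes q: "inner_form q"
begin

lemma inner_form_expand:
  "q v w = v$1 * w$1 * q e1 e1 + (v$1 * w$2 + v$2 * w$1) * q e1 e2 + v$2 * w$2 * q e2 e2"
proof -
  have "q e2 e1 = q e1 e2" "bilinear q" using q unfolding inner_form_def by blast+
  then show ?thesis using bilinear_vec2[of q v w] by (simp add: algebra_simps)
qed

lemma inner_form_sym: "q v w = q w v"
  using q unfolding inner_form_def by blast

lemma inner_form_linear: "linear (q v)" "linear (\<lambda>v. q v w)"
  using q unfolding inner_form_def bilinear_def by blast+

lemma inner_form_pos: "v \<noteq> 0 \<Longrightarrow> q v v > 0"
  using q unfolding inner_form_def by blast

lemma inner_form_zero: "q v v = 0 \<longleftrightarrow> v = 0"
  using inner_form_pos[of v] linear_0[OF inner_form_linear(1)] by force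

lemma inner_form_nondegenerate: "(\<And>w. q v w = q v' w) \<Longrightarrow> v = v'"
  using inner_form_zero[of "v - v'"] linear_diff[OF inner_form_linear(2), of v v' "v - v'"] by simp

lemma gram_pos: "gram q > 0"
proof -
  have p: "q e1 e1 > 0" by (rule inner_form_pos) (simp add: axis_eq_0_iff)
  \<comment> \<open>A multiple of e2 made orthogonal to e1 by Gram-Schmidt, scaled so that no
    division occurs.\<close>
  define z :: "real^2" where "z = vector [- q e1 e2, q e1 e1]"
  have "z \<noteq> 0" using p by (auto simp: z_def vec_eq_iff forall_2)
  then have "q z z > 0" by (rule inner_form_pos)
  moreover have "q z z = q e1 e1 * gram q"
    by (subst inner_form_expand) (simp add: z_def gram_def power2_eq_square algebra_simps)
  ultimately show ?thesis using p by (simp add: zero_less_mult_iff)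
qed

lemma area_density_pos: "area_density q > 0"
  unfolding area_density_def using gram_pos by simp

lemma area_density_sq:
  "area_density q * area_density q = q e1 e1 * q e2 e2 - q e1 e2 * q e1 e2"
  unfolding area_density_def using gram_pos by (simp add: gram_def power2_eq_square)

lemma linear_quarter_turn: "linear (quarter_turn q)"
  unfolding quarter_turn_def
  by (rule linearI) (simp_all add: vec_eq_iff forall_2 linear_add[OF inner_form_linear(1)]
      linear_scale[OF inner_form_linear(1)] diff_divide_distrib add_divide_distrib)

lemma quarter_turn_nth:
  "area_density q * quarter_turn q v $ 1 = - (v$1 * q e1 e2 + v$2 * q e2 e2)"
  "area_density q * quarter_turn q v $ 2 = v$1 * q e1 e1 + v$2 * q e1 e2"
  using area_density_pos
  by (simp_all add: quarter_turn_def inner_form_expand[of e1 v] inner_form_expand[of e2 v] axis2_nth)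

lemma area_quarter_turn: "q w (quarter_turn q v) = area_density q * det2 v w"
proof -
  define r J where "r = area_density q" and "J = quarter_turn q v"
  have "r * J$1 = - (v$1 * q e1 e2 + v$2 * q e2 e2)" "r * J$2 = v$1 * q e1 e1 + v$2 * q e1 e2"
    "r * r = q e1 e1 * q e2 e2 - q e1 e2 * q e1 e2"
    unfolding r_def J_def by (rule quarter_turn_nth area_density_sq)+
  then have "r * q w J = r * (r * det2 v w)"
    unfolding inner_form_expand[of w J] det2_def by algebra
  then show ?thesis using area_density_pos by (simp add: r_def J_def)
qed

lemma quarter_turn_orthogonal: "q v (quarter_turn q v) = 0" "q (quarter_turn q v) v = 0"
  using inner_form_sym area_quarter_turn[of v v] by (auto simp: det2_def)

lemma det2_quarter_turn: "area_density q * det2 v (quarter_turn q v) = q v v"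
proof -
  have "area_density q * det2 v (quarter_turn q v) =
      v$1 * (area_density q * quarter_turn q v $ 2) - v$2 * (area_density q * quarter_turn q v $ 1)"
    by (simp add: det2_def algebra_simps)
  then show ?thesis
    unfolding quarter_turn_nth inner_form_expand[of v v] by (simp add: algebra_simps)
qed

lemma quarter_turn_norm: "q (quarter_turn q v) (quarter_turn q v) = q v v"
  using area_quarter_turn[of "quarter_turn q v" v] det2_quarter_turn[of v] by simp

text \<open>J is skew for q because the area form is alternating, and it is an isometry; together
  these force J^2 = -1.\<close>

lemma quarter_turn_twice: "quarter_turn q (quarter_turn q v) = - v"
proof (rule inner_form_nondegenerate)
  fix w
  have "q (quarter_turn q (quarter_turn q v)) w = area_density q * det2 (quarter_turn q v) w"
    using area_quarter_turn[of w "quarter_turn q v"] inner_form_sym by metis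
  also have "\<dots> = - q (quarter_turn q w) (quarter_turn q v)"
  proof -
    have "q (quarter_turn q v) (quarter_turn q w) = area_density q * det2 w (quarter_turn q v)"
      by (rule area_quarter_turn)
    then show ?thesis using inner_form_sym by (simp add: det2_def algebra_simps)
  qed
  \<comment> \<open>Polarization of \<open>quarter_turn_norm\<close>.\<close>
  also have "q (quarter_turn q w) (quarter_turn q v) = q v w"
  proof -
    let ?u = "v + w"
    have l: "quarter_turn q ?u = quarter_turn q v + quarter_turn q w"
      by (rule linear_add[OF linear_quarter_turn])
    show ?thesis
      using quarter_turn_norm[of ?u] quarter_turn_norm[of v] quarter_turn_norm[of w] inner_form_sym
      unfolding l
      by (simp add: linear_add[OF inner_form_linear(1)] linear_add[OF inner_form_linear(2)])
  qed
  finally show "q (quarter_turn q (quarter_turn q v)) w = q (- v) w"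
    by (simp add: linear_neg[OF inner_form_linear(2)])
qed

text \<open>Expansion in the orthonormal basis v, Jv. The remainder z is orthogonal to both, and the
  area form turns this into z being parallel to both, hence zero.\<close>

lemma unit_vector_decompose:
  assumes "q v v = 1"
  shows "w = q w v *\<^sub>R v + q w (quarter_turn q v) *\<^sub>R quarter_turn q v"
proof -
  let ?J = "quarter_turn q v"
  define z where "z = w - (q w v *\<^sub>R v + q w ?J *\<^sub>R ?J)"
  have zv: "q z v = 0" and zJ: "q z ?J = 0"
    unfolding z_def
    by (simp_all add: linear_diff[OF inner_form_linear(2)] linear_add[OF inner_form_linear(2)]
        linear_scale[OF inner_form_linear(2)] quarter_turn_orthogonal quarter_turn_norm assms)
  have "det2 v z = 0" using zJ area_quarter_turn[of z v] area_density_pos by simp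
  moreover have "det2 (quarter_turn q v) z = 0"
    using zv area_quarter_turn[of z "quarter_turn q v"] area_density_pos
    by (simp add: quarter_turn_twice linear_neg[OF inner_form_linear(1)])
  moreover have "det2 v ?J \<noteq> 0" using det2_quarter_turn[of v] assms by auto
  \<comment> \<open>Cramer's rule for the coordinates of z in the basis v, Jv.\<close>
  moreover have "det2 v ?J *\<^sub>R z = det2 z ?J *\<^sub>R v + det2 v z *\<^sub>R ?J"
    by (simp add: vec_eq_iff forall_2 det2_def algebra_simps)
  moreover have "det2 z ?J = - det2 ?J z" by (simp add: det2_def)
  ultimately have "z = 0" by simp
  then show ?thesis by (simp add: z_def)
qed

lemma unit_vector_exists: "v \<noteq> 0 \<Longrightarrow> q ((1 / sqrt (q v v)) *\<^sub>R v) ((1 / sqrt (q v v)) *\<^sub>R v) = 1"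
  using inner_form_pos[of v]
  by (simp add: linear_scale[OF inner_form_linear(1)] linear_scale[OF inner_form_linear(2)])

end

lemma gram_linear_pullback:
  assumes q: "inner_form q" and L: "linear L"
  shows "gram (\<lambda>v w. q (L v) (L w)) = (det (matrix L))\<^sup>2 * gram q"
proof -
  define a b c d where "a = L e1 $ 1" and "b = L e2 $ 1" and "c = L e1 $ 2" and "d = L e2 $ 2"
  have det: "det (matrix L) = a * d - b * c"
    by (simp add: det_2 matrix_def a_def b_def c_def d_def)
  show ?thesis
    unfolding gram_def det inner_form_expand[OF q, of "L _" "L _"] a_def[symmetric] b_def[symmetric]
      c_def[symmetric] d_def[symmetric]
    by algebra
qed

text \<open>For uniqueness, a vector orthogonal to u is a multiple k of Ju. Equal lengths give k^2 =
  1, and the orientation excludes k = -1.\<close>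

lemma rot_eq_quarter_turn:
  assumes q: "inner_form (g p)"
  shows "rot g p u = quarter_turn (g p) u"
  unfolding rot_def
proof (rule the_equality)
  let ?q = "g p" and ?J = "quarter_turn (g p) u"
  have "det2 u ?J > 0" if "u \<noteq> 0"
    using det2_quarter_turn[OF q, of u] inner_form_pos[OF q that] area_density_pos[OF q]
    by (metis zero_less_mult_pos)
  then show "?q ?J ?J = ?q u u \<and> ?q u ?J = 0 \<and> (u \<noteq> 0 \<longrightarrow> det (vector [u, ?J] :: real^2^2) > 0)"
    using quarter_turn_norm[OF q] quarter_turn_orthogonal[OF q] by (simp add: det_vector_eq_det2)
next
  let ?q = "g p" and ?J = "quarter_turn (g p) u"
  fix z assume z: "?q z z = ?q u u \<and> ?q u z = 0 \<and> (u \<noteq> 0 \<longrightarrow> det (vector [u, z] :: real^2^2) > 0)"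
  show "z = ?J"
  proof (cases "u = 0")
    case True
    then have "z = 0" using z inner_form_zero[OF q] by metis
    then show ?thesis using True linear_0[OF linear_quarter_turn[OF q]] by simp
  next
    case False
    let ?a = "?q u u"
    have a: "?a > 0" using inner_form_pos[OF q False] .
    have lin: "linear (?q z)" "linear (\<lambda>v. ?q v z)" for z using inner_form_linear[OF q] by blast+
    have zJ: "?q z ?J > 0"
      using z False area_density_pos[OF q] by (simp add: area_quarter_turn[OF q] det_vector_eq_det2)
    \<comment> \<open>Normalises u, as the orthonormal expansion is available for unit
      vectors.\<close>
    define s where "s = 1 / sqrt ?a"
    have s: "s * s * ?a = 1" "s > 0" using a by (auto simp: s_def)
    have u: "?q (s *\<^sub>R u) (s *\<^sub>R u) = 1"
      using s by (simp add: linear_scale[OF lin(1)] linear_scale[OF lin(2)] algebra_simps)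
    have zu: "?q z u = 0" using z inner_form_sym[OF q] by metis
    have zk: "z = (s * (s * ?q z ?J)) *\<^sub>R ?J"
      using unit_vector_decompose[OF q u, of z] zu
      by (simp add: linear_scale[OF lin(1)] linear_scale[OF lin(2)] linear_scale[OF linear_quarter_turn[OF q]]
          mult.commute mult.left_commute)
    define k where "k = s * s * ?q z ?J"
    have k: "k > 0" using s zJ by (simp add: k_def)
    have zk: "z = k *\<^sub>R ?J" using zk by (simp add: k_def mult.assoc)
    have "?a = ?q z z" using z by simp
    also have "\<dots> = k * k * ?q ?J ?J"
      by (subst (1 2) zk) (simp add: linear_scale[OF lin(1)] linear_scale[OF lin(2)])
    finally have "k * k = 1" using a by (simp add: quarter_turn_norm[OF q])
    then have "k = 1" using k by (metis square_eq_1_iff less_asym zero_less_one neg_less_0_iff_less)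
    then show ?thesis using zk by simp
  qed
qed

section \<open>The Levi-Civita connection of a metric on an open subset of the plane\<close>

context
  fixes G :: "real^2 \<Rightarrow> real^2 \<Rightarrow> real^2 \<Rightarrow> real" and U x
  assumes U: "open U" "x \<in> U"
    and inner: "\<forall>y\<in>U. inner_form (G y)"
    and dG: "\<And>b c. (\<lambda>y. G y b c) differentiable at x"
begin

lemmas inner_form_at = bspec[OF inner]

definition "dmetric a b c = frechet_derivative (\<lambda>y. G y b c) (at x) a"

lemma metric_has_derivative: "((\<lambda>y. G y b c) has_derivative (\<lambda>a. dmetric a b c)) (at x)"
  unfolding dmetric_def using dG frechet_derivative_works by blast

lemma dmetric_unique: "((\<lambda>y. G y b c) has_derivative D) (at x) \<Longrightarrow> dmetric a b c = D a"
  unfolding dmetric_def using frechet_derivative_at by metis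

lemma dmetric_sym: "dmetric a b c = dmetric a c b"
  using U metric_has_derivative[of c b]
  by (intro dmetric_unique has_derivative_transform_within_open[OF metric_has_derivative[of c b], of U])
    (use inner_form_sym[OF inner_form_at] in auto)

lemma dmetric_linear1: "linear (\<lambda>a. dmetric a b c)"
  using metric_has_derivative has_derivative_linear by blast

lemma dmetric_linear3: "linear (dmetric a b)"
proof (rule linearI)
  fix c d
  have "((\<lambda>y. G y b c + G y b d) has_derivative (\<lambda>a. dmetric a b c + dmetric a b d)) (at x)"
    by (intro has_derivative_add metric_has_derivative)
  then have "((\<lambda>y. G y b (c + d)) has_derivative (\<lambda>a. dmetric a b c + dmetric a b d)) (at x)"
    by (rule has_derivative_transform_within_open[OF _ U])
      (simp add: linear_add[OF inner_form_linear(1)[OF inner_form_at]])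
  then show "dmetric a b (c + d) = dmetric a b c + dmetric a b d" by (rule dmetric_unique)
next
  fix r c
  have "((\<lambda>y. r * G y b c) has_derivative (\<lambda>a. r * dmetric a b c)) (at x)"
    by (intro has_derivative_mult_right metric_has_derivative)
  then have "((\<lambda>y. G y b (r *\<^sub>R c)) has_derivative (\<lambda>a. r * dmetric a b c)) (at x)"
    by (rule has_derivative_transform_within_open[OF _ U])
      (simp add: linear_scale[OF inner_form_linear(1)[OF inner_form_at]])
  then show "dmetric a b (r *\<^sub>R c) = r *\<^sub>R dmetric a b c" by (simp add: dmetric_unique)
qed

lemma dmetric_linear2: "linear (\<lambda>b. dmetric a b c)"
  unfolding dmetric_sym[of a _ c] using dmetric_linear3[of a c] .

text \<open>Koszul's formula for coordinate vector fields, whose brackets vanish: the value that g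
  (nabla_a b, c) must have.\<close>

definition "koszul a b c = (dmetric a b c + dmetric b a c - dmetric c a b) / 2"

lemma koszul_linear: "linear (\<lambda>a. koszul a b c)" "linear (\<lambda>b. koszul a b c)" "linear (koszul a b)"
  by (rule linearI; simp add: koszul_def linear_add[OF dmetric_linear1] linear_add[OF dmetric_linear2]
      linear_add[OF dmetric_linear3] linear_scale[OF dmetric_linear1] linear_scale[OF dmetric_linear2]
      linear_scale[OF dmetric_linear3] field_simps)+

definition "is_levi_civita \<Gamma> \<longleftrightarrow> bilinear \<Gamma> \<and> (\<forall>a b. \<Gamma> a b = \<Gamma> b a) \<and>
  (\<forall>a b c. dmetric a b c = G x (\<Gamma> a b) c + G x b (\<Gamma> a c))"

lemma levi_civita_koszul:
  assumes "is_levi_civita \<Gamma>"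
  shows "G x (\<Gamma> a b) c = koszul a b c"
proof -
  have m: "dmetric a b c = G x (\<Gamma> a b) c + G x b (\<Gamma> a c)" and s: "\<Gamma> a b = \<Gamma> b a" for a b c
    using assms unfolding is_levi_civita_def by blast+
  show ?thesis
    unfolding koszul_def m s[of b a] s[of c a] s[of c b]
    by (simp add: inner_form_sym[OF inner_form_at[OF U(2)], of b])
qed

text \<open>Nondegeneracy of the metric transfers linearity and symmetry from \<open>koszul\<close>
  to the vector-valued map it represents.\<close>

lemma koszul_is_levi_civita:
  assumes "\<And>a b c. G x (\<Gamma> a b) c = koszul a b c"
  shows "is_levi_civita \<Gamma>"
proof -
  note q = inner_form_at[OF U(2)]
  have "bilinear \<Gamma>" unfolding bilinear_def
  proof (intro conjI allI linearI)
    fix a b c r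
    show "\<Gamma> a (b + c) = \<Gamma> a b + \<Gamma> a c" "\<Gamma> (b + c) a = \<Gamma> b a + \<Gamma> c a"
      "\<Gamma> a (r *\<^sub>R b) = r *\<^sub>R \<Gamma> a b" "\<Gamma> (r *\<^sub>R b) a = r *\<^sub>R \<Gamma> b a"
      by (rule inner_form_nondegenerate[OF q];
          simp add: linear_add[OF inner_form_linear(2)[OF q]] linear_scale[OF inner_form_linear(2)[OF q]]
            assms linear_add[OF koszul_linear(1)] linear_add[OF koszul_linear(2)]
            linear_scale[OF koszul_linear(1)] linear_scale[OF koszul_linear(2)])+
  qed
  moreover have "\<Gamma> a b = \<Gamma> b a" for a b
    by (rule inner_form_nondegenerate[OF q]) (simp add: assms koszul_def dmetric_sym[of _ a b])
  moreover have "dmetric a b c = G x (\<Gamma> a b) c + G x b (\<Gamma> a c)" for a b c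
    using inner_form_sym[OF q, of b "\<Gamma> a c"]
    by (simp add: assms koszul_def dmetric_sym[of _ c] dmetric_sym[of _ b a] field_simps)
  ultimately show ?thesis unfolding is_levi_civita_def by blast
qed

lemma levi_civita_works: "is_levi_civita (levi_civita G x)"
proof -
  note q = inner_form_at[OF U(2)]
  define u where "u = (1 / sqrt (G x e1 e1)) *\<^sub>R e1"
  have u: "G x u u = 1" unfolding u_def by (rule unit_vector_exists[OF q]) (simp add: axis_eq_0_iff)
  define v where "v = quarter_turn (G x) u"
  \<comment> \<open>The vector representing the functional \<open>koszul a b\<close>, written in the
    orthonormal basis u, v. Such a representative is unique, so the definite description in
    \<open>levi_civita\<close> is met.\<close>
  define \<Gamma> where "\<Gamma> a b = koszul a b u *\<^sub>R u + koszul a b v *\<^sub>R v" for a b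
  have "G x (\<Gamma> a b) c = koszul a b c" for a b c
  proof -
    have "koszul a b c = koszul a b (G x c u *\<^sub>R u + G x c v *\<^sub>R v)"
      using unit_vector_decompose[OF q u, of c] unfolding v_def by simp
    then show ?thesis
      unfolding \<Gamma>_def inner_form_sym[OF q, of c]
      by (simp add: linear_add[OF koszul_linear(3)] linear_scale[OF koszul_linear(3)]
        linear_add[OF inner_form_linear(2)[OF q]] linear_scale[OF inner_form_linear(2)[OF q]])
  qed
  then have "is_levi_civita \<Gamma>" by (rule koszul_is_levi_civita)
  moreover have "\<Gamma>' = \<Gamma>" if "is_levi_civita \<Gamma>'" for \<Gamma>'
    by (intro ext inner_form_nondegenerate[OF q])
      (simp add: levi_civita_koszul[OF that] levi_civita_koszul[OF \<open>is_levi_civita \<Gamma>\<close>])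
  ultimately have "is_levi_civita (THE \<Gamma>. is_levi_civita \<Gamma>)" by (rule theI)
  then show ?thesis
    unfolding levi_civita_def unfolding is_levi_civita_def[abs_def] dmetric_def .
qed

lemma levi_civita_bilinear: "bilinear (levi_civita G x)"
  and levi_civita_sym: "levi_civita G x a b = levi_civita G x b a"
  and levi_civita_metric: "((\<lambda>y. G y b c) has_derivative
    (\<lambda>a. G x (levi_civita G x a b) c + G x b (levi_civita G x a c))) (at x)"
  using levi_civita_works metric_has_derivative[of b c] unfolding is_levi_civita_def by auto

text \<open>The logarithmic derivative of the square root of det g is the trace of the Christoffel
  symbols; equivalently, the area form is parallel.\<close>

lemma area_density_has_derivative:
  "((\<lambda>y. area_density (G y)) has_derivative
     (\<lambda>a. area_density (G x) * (levi_civita G x a e1 $ 1 + levi_civita G x a e2 $ 2))) (at x)"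
proof -
  note q = inner_form_at[OF U(2)]
  let ?\<Gamma> = "levi_civita G x"
  let ?t = "\<lambda>a. ?\<Gamma> a e1 $ 1 + ?\<Gamma> a e2 $ 2"
  have "((\<lambda>y. gram (G y)) has_derivative (\<lambda>a. 2 * gram (G x) * (?\<Gamma> a e1 $ 1 + ?\<Gamma> a e2 $ 2))) (at x)"
    unfolding gram_def power2_eq_square
  proof (rule has_derivative_eq_rhs, (rule has_derivative_diff has_derivative_mult levi_civita_metric)+, rule ext)
    fix a
  have ax: "e1 $ 1 = 1" "e1 $ 2 = 0" "e2 $ 1 = 0" "e2 $ 2 = 1" by (auto simp: axis_def)
    show "G x e1 e1 * (G x (?\<Gamma> a e2) e2 + G x e2 (?\<Gamma> a e2)) + (G x (?\<Gamma> a e1) e1 + G x e1 (?\<Gamma> a e1)) * G x e2 e2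
      - (G x e1 e2 * (G x (?\<Gamma> a e1) e2 + G x e1 (?\<Gamma> a e2)) + (G x (?\<Gamma> a e1) e2 + G x e1 (?\<Gamma> a e2)) * G x e1 e2)
      = 2 * (G x e1 e1 * G x e2 e2 - G x e1 e2 * G x e1 e2) * (?\<Gamma> a e1 $ 1 + ?\<Gamma> a e2 $ 2)"
      unfolding inner_form_expand[OF q, of "?\<Gamma> a _"] inner_form_expand[OF q, of _ "?\<Gamma> a _"] axis2_nth
      by (simp add: algebra_simps)
  qed
  moreover have "(sqrt has_derivative (\<lambda>t. t / (2 * sqrt (gram (G x))))) (at (gram (G x)))"
    using DERIV_real_sqrt[OF gram_pos[OF q]]
    by (simp add: has_field_derivative_def inverse_eq_divide times_divide_eq_left[abs_def] mult.commute)
  ultimately have "((\<lambda>y. sqrt (gram (G y))) has_derivative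
      (\<lambda>a. 2 * gram (G x) * ?t a / (2 * sqrt (gram (G x))))) (at x)"
    using diff_chain_at[of "\<lambda>y. gram (G y)" _ x sqrt] by (fastforce simp: o_def)
  moreover have "2 * gram (G x) * t / (2 * sqrt (gram (G x))) = sqrt (gram (G x)) * t" for t
    using gram_pos[OF q] by (simp add: field_simps)
  ultimately show ?thesis unfolding area_density_def by simp
qed

section \<open>Product rules for vector fields along a map into the chart\<close>

context
  fixes W :: "'e::real_normed_vector set" and z
    and P P' X X' Y Y' :: "'e \<Rightarrow> real^2"
  assumes W: "open W" "z \<in> W" "P ` W \<subseteq> U" "P z = x"
    and P: "(P has_derivative P') (at z)"
    and X: "(X has_derivative X') (at z)"
    and Y: "(Y has_derivative Y') (at z)"
begin

text \<open>Compatibility of the connection with the metric, pulled back along P; the sums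
  \<open>X' h + levi_civita G x (P' h) (X z)\<close> are covariant derivatives. Allowing any map P
  lets the same rule serve on TM, with P the projection, and on parametrizations of SM.\<close>

lemma covariant_product_rule:
  "((\<lambda>z. G (P z) (X z) (Y z)) has_derivative
     (\<lambda>h. G x (X' h + levi_civita G x (P' h) (X z)) (Y z)
        + G x (X z) (Y' h + levi_civita G x (P' h) (Y z)))) (at z)"
proof -
  note q = inner_form_at[OF U(2)]
  let ?\<Gamma> = "levi_civita G x"
  have lin: "linear (?\<Gamma> a)" for a using levi_civita_bilinear unfolding bilinear_def by blast
  have bil: "bilinear (G x)" using q unfolding inner_form_def by blast
  have l1: "linear (\<lambda>v. G x v w)" and l2: "linear (G x w)" for w using inner_form_linear[OF q] by blast+
  have "bilinear (\<lambda>v w. G x (?\<Gamma> a v) w)" "bilinear (\<lambda>v w. G x v (?\<Gamma> a w))" for a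
    unfolding bilinear_def using linear_compose[OF lin l1] linear_compose[OF lin l2] l1 l2
    by (auto simp: o_def)
  note b = this[THEN bilinear_vec2] bil[THEN bilinear_vec2]
  have PG: "((\<lambda>z. G (P z) b c) has_derivative
      (\<lambda>h. G x (?\<Gamma> (P' h) b) c + G x b (?\<Gamma> (P' h) c))) (at z)" for b c
    using diff_chain_at[OF P, of "\<lambda>y. G y b c"] levi_civita_metric[of b c] W(4) by (simp add: o_def)
  have nth: "((\<lambda>z. X z $ i) has_derivative (\<lambda>h. X' h $ i)) (at z)"
     "((\<lambda>z. Y z $ i) has_derivative (\<lambda>h. Y' h $ i)) (at z)" for i
    using X Y by (auto intro: bounded_linear.has_derivative[OF bounded_linear_vec_nth])
  \<comment> \<open>The metric is known to be differentiable in the point only for constant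
    arguments, so the moving vectors are expanded in the standard basis first.\<close>
  have "((\<lambda>z. X z $ 1 * Y z $ 1 * G (P z) e1 e1 + X z $ 1 * Y z $ 2 * G (P z) e1 e2
      + X z $ 2 * Y z $ 1 * G (P z) e2 e1 + X z $ 2 * Y z $ 2 * G (P z) e2 e2)
    has_derivative (\<lambda>h. G x (X' h + ?\<Gamma> (P' h) (X z)) (Y z) + G x (X z) (Y' h + ?\<Gamma> (P' h) (Y z)))) (at z)"
  proof (rule has_derivative_eq_rhs, (rule has_derivative_add has_derivative_mult PG nth)+, rule ext)
    fix h
    show "X z $ 1 * Y z $ 1 * (G x (?\<Gamma> (P' h) e1) e1 + G x e1 (?\<Gamma> (P' h) e1))
        + (X z $ 1 * Y' h $ 1 + X' h $ 1 * Y z $ 1) * G (P z) e1 e1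
      + (X z $ 1 * Y z $ 2 * (G x (?\<Gamma> (P' h) e1) e2 + G x e1 (?\<Gamma> (P' h) e2))
        + (X z $ 1 * Y' h $ 2 + X' h $ 1 * Y z $ 2) * G (P z) e1 e2)
      + (X z $ 2 * Y z $ 1 * (G x (?\<Gamma> (P' h) e2) e1 + G x e2 (?\<Gamma> (P' h) e1))
        + (X z $ 2 * Y' h $ 1 + X' h $ 2 * Y z $ 1) * G (P z) e2 e1)
      + (X z $ 2 * Y z $ 2 * (G x (?\<Gamma> (P' h) e2) e2 + G x e2 (?\<Gamma> (P' h) e2))
        + (X z $ 2 * Y' h $ 2 + X' h $ 2 * Y z $ 2) * G (P z) e2 e2)
      = G x (X' h + ?\<Gamma> (P' h) (X z)) (Y z) + G x (X z) (Y' h + ?\<Gamma> (P' h) (Y z))"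
      unfolding linear_add[OF l1] linear_add[OF l2]
        b(1)[of _ "X z" "Y z"] b(2)[of "X z" _ "Y z"] b(3)[of "X z" "Y' h"] b(3)[of "X' h" "Y z"] W(4)
      by (simp add: algebra_simps)
  qed
  then show ?thesis
  proof (rule has_derivative_transform_within_open[OF _ W(1,2)])
    fix y assume "y \<in> W"
    then have "bilinear (G (P y))" using inner_form_at W(3) unfolding inner_form_def by blast
    from bilinear_vec2[OF this, of "X y" "Y y"]
    show "X y $ 1 * Y y $ 1 * G (P y) e1 e1 + X y $ 1 * Y y $ 2 * G (P y) e1 e2
      + X y $ 2 * Y y $ 1 * G (P y) e2 e1 + X y $ 2 * Y y $ 2 * G (P y) e2 e2 = G (P y) (X y) (Y y)"
      by simp
  qed
qed

text \<open>Parallelism of the area form: the trace coming from the density is distributed over the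
  two arguments by \<open>trace_det2\<close> and completes their derivatives to covariant
  ones.\<close>

lemma area_product_rule:
  "((\<lambda>z. area_density (G (P z)) * det2 (X z) (Y z)) has_derivative
     (\<lambda>h. area_density (G x) * (det2 (X' h + levi_civita G x (P' h) (X z)) (Y z)
        + det2 (X z) (Y' h + levi_civita G x (P' h) (Y z))))) (at z)"
proof -
  let ?\<Gamma> = "levi_civita G x"
  have lin: "linear (?\<Gamma> a)" for a using levi_civita_bilinear unfolding bilinear_def by blast
  have D: "((\<lambda>z. area_density (G (P z))) has_derivative
      (\<lambda>h. area_density (G x) * (?\<Gamma> (P' h) e1 $ 1 + ?\<Gamma> (P' h) e2 $ 2))) (at z)"
    using diff_chain_at[OF P, of "\<lambda>y. area_density (G y)"] area_density_has_derivative W(4)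
    by (simp add: o_def)
  have nth: "((\<lambda>z. X z $ i) has_derivative (\<lambda>h. X' h $ i)) (at z)"
     "((\<lambda>z. Y z $ i) has_derivative (\<lambda>h. Y' h $ i)) (at z)" for i
    using X Y by (auto intro: bounded_linear.has_derivative[OF bounded_linear_vec_nth])
  have "((\<lambda>z. det2 (X z) (Y z)) has_derivative (\<lambda>h. det2 (X' h) (Y z) + det2 (X z) (Y' h))) (at z)"
    unfolding det2_def
    by (rule has_derivative_eq_rhs, (rule has_derivative_diff has_derivative_mult nth)+)
      (simp add: fun_eq_iff algebra_simps)
  from has_derivative_mult[OF D this] show ?thesis
  proof (rule has_derivative_eq_rhs, intro ext)
    fix h
    have "det2 (v + v') w = det2 v w + det2 v' w" "det2 v (w + w') = det2 v w + det2 v w'" for v v' w w'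
      by (simp_all add: det2_def algebra_simps)
    then show "area_density (G (P z)) * (det2 (X' h) (Y z) + det2 (X z) (Y' h))
        + area_density (G x) * (?\<Gamma> (P' h) e1 $ 1 + ?\<Gamma> (P' h) e2 $ 2) * det2 (X z) (Y z)
      = area_density (G x) * (det2 (X' h + ?\<Gamma> (P' h) (X z)) (Y z)
        + det2 (X z) (Y' h + ?\<Gamma> (P' h) (Y z)))"
      unfolding mult.assoc[of "area_density (G x)"] trace_det2[OF lin] W(4) by (simp add: algebra_simps)
  qed
qed

end

end

section \<open>Charts, frames and coframes\<close>

text \<open>Makes the coframe computable. Three functionals dual to three vectors show that these
  are independent, and then the coefficients chosen by \<open>representation\<close> must be the
  values of the functionals.\<close>

lemma dual_representation:
  fixes f0 f1 f2 Z :: "'v::real_vector" and t0 t1 t2 :: "'v \<Rightarrow> real"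
  assumes lin: "linear t0" "linear t1" "linear t2"
    and t0: "t0 f0 = 1" "t0 f1 = 0" "t0 f2 = 0"
    and t1: "t1 f0 = 0" "t1 f1 = 1" "t1 f2 = 0"
    and t2: "t2 f0 = 0" "t2 f1 = 0" "t2 f2 = 1"
    and Z: "Z = t0 Z *\<^sub>R f0 + t1 Z *\<^sub>R f1 + t2 Z *\<^sub>R f2"
  shows "representation {f0, f1, f2} Z f0 = t0 Z" "representation {f0, f1, f2} Z f1 = t1 Z"
    "representation {f0, f1, f2} Z f2 = t2 Z"
proof -
  let ?B = "{f0, f1, f2}"
  have ne: "f0 \<noteq> f1" "f0 \<noteq> f2" "f1 \<noteq> f2" using t0 t1 by auto
  have coef: "t0 (\<Sum>b\<in>?B. c b *\<^sub>R b) = c f0" "t1 (\<Sum>b\<in>?B. c b *\<^sub>R b) = c f1"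
    "t2 (\<Sum>b\<in>?B. c b *\<^sub>R b) = c f2" for c
    using ne t0 t1 t2
    by (simp_all add: linear_add[OF lin(1)] linear_add[OF lin(2)] linear_add[OF lin(3)]
        linear_scale[OF lin(1)] linear_scale[OF lin(2)] linear_scale[OF lin(3)])
  have ind: "independent ?B"
  proof (rule independent_if_scalars_zero)
    fix c b assume "(\<Sum>b\<in>?B. c b *\<^sub>R b) = 0" "b \<in> ?B"
    then show "c b = 0"
      using coef[of c] linear_0[OF lin(1)] linear_0[OF lin(2)] linear_0[OF lin(3)] by auto
  qed simp
  have "t0 Z *\<^sub>R f0 + t1 Z *\<^sub>R f1 + t2 Z *\<^sub>R f2 \<in> span ?B"
    by (intro span_add span_scale span_base) auto
  then have "Z \<in> span ?B" using Z by simp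
  then have "(\<Sum>b\<in>?B. representation ?B Z b *\<^sub>R b) = Z"
    by (intro real_vector.sum_representation_eq[OF ind]) auto
  then show "representation ?B Z f0 = t0 Z" "representation ?B Z f1 = t1 Z"
    "representation ?B Z f2 = t2 Z"
    using coef[of "representation ?B Z"] by auto
qed

locale riemannian_surface =
  fixes M :: "'a topology" and A :: "'a chart set" and g :: "'a metric"
  assumes orm: "oriented_riemannian_surface M A g"
begin

lemma surf: "oriented_surface M A"
  using orm unfolding oriented_riemannian_surface_def by blast

lemma inner_form_metric: "p \<in> topspace M \<Longrightarrow> inner_form (g p)"
  using orm unfolding oriented_riemannian_surface_def inner_form_def by blast

lemma metric_smooth: "c \<in> A \<Longrightarrow> Ck_on k (\<lambda>x. metric_coord A g c x v w) (snd c ` fst c)"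
  using orm unfolding oriented_riemannian_surface_def smooth_on_def by blast

lemma transition_smooth:
  "c \<in> A \<Longrightarrow> d \<in> A \<Longrightarrow> Ck_on k (snd d \<circ> chart_inv c) (snd c ` (fst c \<inter> fst d))"
  using surf unfolding oriented_surface_def smooth_on_def by blast

lemma chart_image_open: "c \<in> A \<Longrightarrow> open (snd c ` fst c)"
  using surf unfolding oriented_surface_def by blast

lemma chart_at_in: "p \<in> topspace M \<Longrightarrow> chart_at A p \<in> A" "p \<in> topspace M \<Longrightarrow> p \<in> fst (chart_at A p)"
  using chart_at_mem[OF surf] by blast+

lemma in_topspace: "c \<in> A \<Longrightarrow> p \<in> fst c \<Longrightarrow> p \<in> topspace M"
  using dom_subset[OF surf] by blast

lemma tangent_change_linear:
  "c \<in> A \<Longrightarrow> d \<in> A \<Longrightarrow> p \<in> fst c \<Longrightarrow> p \<in> fst d \<Longrightarrow> linear (tangent_change c d p)"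
  using transition_derivative[OF surf] has_derivative_linear by blast

lemma tangent_change_compose:
  assumes "c \<in> A" "d \<in> A" "e \<in> A" "p \<in> fst c" "p \<in> fst d" "p \<in> fst e"
  shows "tangent_change d e p (tangent_change c d p v) = tangent_change c e p v"
proof -
  have "((snd e \<circ> chart_inv d) has_derivative tangent_change d e p) (at (snd d p))"
    using transition_derivative[OF surf] assms by blast
  then have "((snd e \<circ> chart_inv c) has_derivative tangent_change d e p \<circ> tangent_change c d p) (at (snd c p))"
    using has_derivative_change_chart[OF surf] assms by blast
  moreover have "((snd e \<circ> chart_inv c) has_derivative tangent_change c e p) (at (snd c p))"
    using transition_derivative[OF surf] assms by blast
  ultimately have "tangent_change d e p \<circ> tangent_change c d p = tangent_change c e p"
    by (rule has_derivative_unique)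
  then show ?thesis by (metis comp_apply)
qed

text \<open>By the cocycle rule this linear map is idempotent, and it is invertible.\<close>

lemma tangent_change_self:
  assumes "c \<in> A" "p \<in> fst c"
  shows "tangent_change c c p v = v"
  using tangent_change_inverse[OF surf, of c c p v] tangent_change_compose[of c c c p v] assms by simp

lemma metric_coord_chart:
  assumes "c \<in> A" "p \<in> fst c"
  shows "metric_coord A g c (snd c p) v w
    = g p (tangent_change c (chart_at A p) p v) (tangent_change c (chart_at A p) p w)"
  using chart_inv_chart[OF surf assms] by (simp add: metric_coord_def Let_def)

lemma inner_form_metric_coord:
  assumes "c \<in> A" "y \<in> snd c ` fst c"
  shows "inner_form (metric_coord A g c y)"
proof -
  obtain p where p: "p \<in> fst c" "y = snd c p" using assms by auto
  define d where "d = chart_at A p"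
  have d: "d \<in> A" "p \<in> fst d" using chart_at_in in_topspace assms p unfolding d_def by blast+
  have q: "inner_form (g p)" using inner_form_metric in_topspace assms p by blast
  let ?T = "tangent_change c d p"
  have T: "linear ?T" using tangent_change_linear assms p d by blast
  have m: "metric_coord A g c y v w = g p (?T v) (?T w)" for v w
    unfolding p(2) d_def by (rule metric_coord_chart[OF assms(1) p(1)])
  have inj: "?T v \<noteq> 0" if "v \<noteq> 0" for v
  proof -
    have "tangent_change d c p 0 = 0"
      using linear_0 tangent_change_linear assms p d by blast
    then show ?thesis using tangent_change_inverse[OF surf d(1) assms(1) d(2) p(1), of v] that by metis
  qed
  show ?thesis
    unfolding inner_form_def bilinear_def m
    using linear_compose[OF T inner_form_linear(1)[OF q]] linear_compose[OF T inner_form_linear(2)[OF q]]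
      inner_form_sym[OF q] inner_form_pos[OF q inj]
    by (auto simp: o_def)
qed

lemma inner_form_metric_coord_ball: "c \<in> A \<Longrightarrow> \<forall>y\<in>snd c ` fst c. inner_form (metric_coord A g c y)"
  using inner_form_metric_coord by blast

lemma metric_coord_differentiable:
  assumes "c \<in> A" "x \<in> snd c ` fst c"
  shows "(\<lambda>y. metric_coord A g c y v w) differentiable at x"
  using Ck_on_imp_differentiable[OF metric_smooth[OF assms(1)] assms(2)]
  by (rule differentiableI)

context
  fixes c x
  assumes cx: "c \<in> A" "x \<in> snd c ` fst c"
begin

lemmas coord_levi_civita_bilinear = levi_civita_bilinear
  [OF chart_image_open[OF cx(1)] cx(2) inner_form_metric_coord_ball[OF cx(1)] metric_coord_differentiable[OF cx]]
lemmas coord_levi_civita_sym = levi_civita_sym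
  [OF chart_image_open[OF cx(1)] cx(2) inner_form_metric_coord_ball[OF cx(1)] metric_coord_differentiable[OF cx]]
lemmas coord_covariant_product_rule = covariant_product_rule
  [OF chart_image_open[OF cx(1)] cx(2) inner_form_metric_coord_ball[OF cx(1)] metric_coord_differentiable[OF cx]]
lemmas coord_area_product_rule = area_product_rule
  [OF chart_image_open[OF cx(1)] cx(2) inner_form_metric_coord_ball[OF cx(1)] metric_coord_differentiable[OF cx]]

end

lemma coord_at_in: "p \<in> topspace M \<Longrightarrow> coord_at A p \<in> snd (chart_at A p) ` fst (chart_at A p)"
  unfolding coord_at_def using chart_at_in by blast

lemma metric_coord_at:
  assumes "p \<in> topspace M"
  shows "metric_coord A g (chart_at A p) (coord_at A p) = g p"
  using metric_coord_chart[OF chart_at_in[OF assms]] tangent_change_self[OF chart_at_in[OF assms]]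
  unfolding coord_at_def by (intro ext) simp

lemma christoffel_bilinear: "p \<in> topspace M \<Longrightarrow> bilinear (christoffel A g p)"
  unfolding christoffel_def
  by (rule coord_levi_civita_bilinear[OF chart_at_in(1) coord_at_in])

lemma christoffel_linear:
  assumes "p \<in> topspace M"
  shows "linear (christoffel A g p v)" "linear (\<lambda>v. christoffel A g p v w)"
  using christoffel_bilinear[OF assms] unfolding bilinear_def by blast+

lemma connector_linear:
  assumes "p \<in> topspace M"
  shows "linear (connector A g (p, v))"
  unfolding connector_def
  by (rule linearI) (simp_all add: linear_add[OF christoffel_linear(2)[OF assms]]
      linear_scale[OF christoffel_linear(2)[OF assms]] algebra_simps)

text \<open>The product rule on TM itself, with P the projection and both vector fields the
  tautological one, gives 2 g (K Z, v) as the differential of the squared norm, K being the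
  connection map. So vectors tangent to SM are those whose vertical part is orthogonal to v.\<close>

lemma SM_tangent_iff:
  assumes "p \<in> topspace M"
  shows "Z \<in> SM_tangent A g (p, v) \<longleftrightarrow> g p (connector A g (p, v) Z) v = 0"
proof -
  let ?d = "chart_at A p" and ?x = "coord_at A p"
  let ?U = "snd ?d ` fst ?d"
  let ?C = "connector A g (p, v)"
  note d = chart_at_in[OF assms] coord_at_in[OF assms]
  have "((\<lambda>z. metric_coord A g ?d (fst z) (snd z) (snd z)) has_derivative
     (\<lambda>h. metric_coord A g ?d ?x (snd h + levi_civita (metric_coord A g ?d) ?x (fst h) (snd (?x, v))) (snd (?x, v))
        + metric_coord A g ?d ?x (snd (?x, v)) (snd h + levi_civita (metric_coord A g ?d) ?x (fst h) (snd (?x, v)))))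
     (at (?x, v))"
    by (rule coord_covariant_product_rule[where W = "?U \<times> UNIV"])
      (use d chart_image_open in \<open>auto intro!: open_Times derivative_eq_intros\<close>)
  then have "((\<lambda>(x, y). metric_coord A g ?d x y y) has_derivative
     (\<lambda>h. g p (?C h) v + g p v (?C h))) (at (?x, v))"
    unfolding metric_coord_at[OF assms]
    by (simp add: case_prod_unfold connector_def christoffel_def)
  then have "frechet_derivative (\<lambda>(x, y). metric_coord A g ?d x y y) (at (?x, v))
      = (\<lambda>h. g p (?C h) v + g p v (?C h))"
    by (rule frechet_derivative_at[symmetric])
  then show ?thesis
    unfolding SM_tangent_def using inner_form_sym[OF inner_form_metric[OF assms], of v] by simp
qed

lemma horizontal_lift_eq: "horizontal_lift A g (p, v) w = (w, - christoffel A g p w v)"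
  unfolding horizontal_lift_def connector_def
  by (rule the_equality) (auto simp: prod_eq_iff eq_neg_iff_add_eq_0)

lemma vertical_lift_eq: "p \<in> topspace M \<Longrightarrow> vertical_lift A g (p, v) w = (0, w)"
  unfolding vertical_lift_def connector_def
  by (rule the_equality) (auto simp: prod_eq_iff linear_0[OF christoffel_linear(2)])

lemma rot_eq: "p \<in> topspace M \<Longrightarrow> rot g p v = quarter_turn (g p) v"
  using rot_eq_quarter_turn[OF inner_form_metric] .

section \<open>Frame, coframe and Sasaki metric at a unit vector\<close>

context
  fixes p v
  assumes pv: "(p, v) \<in> SM M g"
begin

abbreviation (input) "J \<equiv> quarter_turn (g p) v"
abbreviation (input) "nabla \<equiv> connector A g (p, v)"

lemma SM_base: "p \<in> topspace M" and SM_unit: "g p v v = 1"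
  using pv unfolding SM_def by auto

lemma frame_eq:
  "frame0 A g (p, v) = (v, - christoffel A g p v v)"
  "frame1 A g (p, v) = (J, - christoffel A g p J v)"
  "frame2 A g (p, v) = (0, J)"
  using SM_base by (simp_all add: frame0_def frame1_def frame2_def horizontal_lift_eq vertical_lift_eq rot_eq)

lemma connector_frame:
  "nabla (frame0 A g (p, v)) = 0" "nabla (frame1 A g (p, v)) = 0" "nabla (frame2 A g (p, v)) = J"
  using SM_base by (simp_all add: frame_eq connector_def linear_0[OF christoffel_linear(2)])

text \<open>The projection of Z is expanded in v and Jv; its vertical part is orthogonal to v, so
  only the Jv component remains there.\<close>

lemma SM_tangent_decompose:
  assumes "Z \<in> SM_tangent A g (p, v)"
  shows "Z = g p (fst Z) v *\<^sub>R frame0 A g (p, v) + g p (fst Z) J *\<^sub>R frame1 A g (p, v)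
    + g p (nabla Z) J *\<^sub>R frame2 A g (p, v)"
proof -
  note q = inner_form_metric[OF SM_base] and dec = unit_vector_decompose[OF inner_form_metric[OF SM_base] SM_unit]
  have 1: "fst Z = g p (fst Z) v *\<^sub>R v + g p (fst Z) J *\<^sub>R J" by (rule dec)
  have "nabla Z = g p (nabla Z) J *\<^sub>R J"
    using dec[of "nabla Z"] SM_tangent_iff[OF SM_base] assms by simp
  moreover have "christoffel A g p (fst Z) v
      = g p (fst Z) v *\<^sub>R christoffel A g p v v + g p (fst Z) J *\<^sub>R christoffel A g p J v"
    using arg_cong[OF 1, of "\<lambda>w. christoffel A g p w v"]
    by (simp only: linear_add[OF christoffel_linear(2)[OF SM_base]]
      linear_scale[OF christoffel_linear(2)[OF SM_base]])
  ultimately have "snd Z = g p (nabla Z) J *\<^sub>R J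
      - (g p (fst Z) v *\<^sub>R christoffel A g p v v + g p (fst Z) J *\<^sub>R christoffel A g p J v)"
    by (metis connector_def add_diff_cancel fst_conv snd_conv)
  then show ?thesis using 1 by (simp add: prod_eq_iff frame_eq algebra_simps)
qed

lemma coframe_eq:
  assumes "Z \<in> SM_tangent A g (p, v)"
  shows "coframe0 A g (p, v) Z = g p (fst Z) v"
    "coframe1 A g (p, v) Z = g p (fst Z) J"
    "coframe2 A g (p, v) Z = g p (nabla Z) J"
proof -
  note q = inner_form_metric[OF SM_base]
  have lin: "linear (\<lambda>Z. g p (fst Z) w)" "linear (\<lambda>Z. g p (nabla Z) w)" for w
    using linear_compose[OF linear_fst inner_form_linear(2)[OF q]]
      linear_compose[OF connector_linear[OF SM_base] inner_form_linear(2)[OF q]] by (auto simp: o_def)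
  have 0: "g p 0 w = 0" for w using linear_0[OF inner_form_linear(2)[OF q]] .
  note J = quarter_turn_orthogonal[OF q, of v] quarter_turn_norm[OF q, of v] SM_unit 0
  have fst: "g p (fst (frame0 A g (p, v))) v = 1" "g p (fst (frame1 A g (p, v))) v = 0"
    "g p (fst (frame2 A g (p, v))) v = 0" "g p (fst (frame0 A g (p, v))) J = 0"
    "g p (fst (frame1 A g (p, v))) J = 1" "g p (fst (frame2 A g (p, v))) J = 0"
    by (simp_all add: frame_eq J)
  have conn: "g p (nabla (frame0 A g (p, v))) J = 0" "g p (nabla (frame1 A g (p, v))) J = 0"
    "g p (nabla (frame2 A g (p, v))) J = 1"
    unfolding connector_frame by (simp_all add: J)
  show "coframe0 A g (p, v) Z = g p (fst Z) v" "coframe1 A g (p, v) Z = g p (fst Z) J"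
    "coframe2 A g (p, v) Z = g p (nabla Z) J"
    unfolding coframe0_def coframe1_def coframe2_def SM_frame_def
    by (rule dual_representation[OF lin(1)[of v] lin(1)[of J] lin(2)[of J] fst conn
      SM_tangent_decompose[OF assms]])+
qed

lemma sasaki_eq:
  assumes "X \<in> SM_tangent A g (p, v)" "Y \<in> SM_tangent A g (p, v)"
  shows "sasaki A g (p, v) X Y = coframe0 A g (p, v) X * coframe0 A g (p, v) Y
    + coframe1 A g (p, v) X * coframe1 A g (p, v) Y + coframe2 A g (p, v) X * coframe2 A g (p, v) Y"
proof -
  note q = inner_form_metric[OF SM_base]
  have "g p a b = g p a v * g p b v + g p a J * g p b J" for a b
    using arg_cong[OF unit_vector_decompose[OF q SM_unit, of b], of "g p a"]
    by (simp only: linear_add[OF inner_form_linear(1)[OF q]] linear_scale[OF inner_form_linear(1)[OF q]])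
       (simp add: algebra_simps)
  from this[of "fst X" "fst Y"] this[of "nabla X" "nabla Y"]
  show ?thesis
    using assms SM_tangent_iff[OF SM_base] by (simp add: sasaki_def coframe_eq)
qed

text \<open>Needed to attain the comass: a maximising 2-vector is found in coordinates and must come
  from vectors tangent to SM.\<close>

lemma coframe_onto: "\<exists>Z\<in>SM_tangent A g (p, v). coframe0 A g (p, v) Z = a0
    \<and> coframe1 A g (p, v) Z = a1 \<and> coframe2 A g (p, v) Z = a2"
proof -
  note q = inner_form_metric[OF SM_base]
  define Z where "Z = a0 *\<^sub>R frame0 A g (p, v) + a1 *\<^sub>R frame1 A g (p, v) + a2 *\<^sub>R frame2 A g (p, v)"
  have c: "nabla Z = a2 *\<^sub>R J"
    unfolding Z_def
    by (simp only: linear_add[OF connector_linear[OF SM_base]] linear_scale[OF connector_linear[OF SM_base]]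
        connector_frame) simp
  have f: "fst Z = a0 *\<^sub>R v + a1 *\<^sub>R J" by (simp add: Z_def frame_eq)
  have "Z \<in> SM_tangent A g (p, v)"
    unfolding SM_tangent_iff[OF SM_base] c
    by (simp add: linear_scale[OF inner_form_linear(2)[OF q]] quarter_turn_orthogonal[OF q])
  moreover from this have "coframe0 A g (p, v) Z = a0 \<and> coframe1 A g (p, v) Z = a1 \<and> coframe2 A g (p, v) Z = a2"
    unfolding coframe_eq[OF \<open>Z \<in> _\<close>] c f
    by (simp add: linear_scale[OF inner_form_linear(2)[OF q]] linear_add[OF inner_form_linear(2)[OF q]]
        quarter_turn_orthogonal[OF q] quarter_turn_norm[OF q] SM_unit)
  ultimately show ?thesis by blast
qed

end

section \<open>The comass\<close>

text \<open>The form taken here by the fact that all 2-vectors in dimension three are simple. For z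
  orthogonal to n, Lagrange's formula gives z x (n x z) = |z|^2 n.\<close>

lemma unit_cross_product_exists:
  assumes "norm (n::real^3) = 1"
  shows "\<exists>x y. cross3 x y = n"
proof -
  obtain z :: "real^3" where z: "z \<noteq> 0" "orthogonal n z"
    using orthogonal_to_vector_exists[of n] by auto
  have "cross3 z (cross3 n z) = (z \<bullet> z) *\<^sub>R n"
    using z(2) by (simp add: Lagrange orthogonal_def inner_commute)
  then have "cross3 z ((1 / (z \<bullet> z)) *\<^sub>R cross3 n z) = n"
    using z(1) by (simp add: cross_mult_right)
  then show ?thesis by blast
qed

lemma comass_at_eq:
  fixes b :: "real^3"
  assumes u: "u \<in> SM M g"
    and \<phi>: "\<And>X Y. \<phi> u X Y =
         b$3 * wedge (coframe0 A g) (coframe1 A g) u X Y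
       + b$2 * wedge (coframe2 A g) (coframe0 A g) u X Y
       + b$1 * wedge (coframe1 A g) (coframe2 A g) u X Y"
  shows "comass_at A g \<phi> u = ereal (norm b)"
proof -
  obtain p v where pv: "u = (p, v)" "(p, v) \<in> SM M g" using u by (cases u) auto
  \<comment> \<open>Coordinates in the orthonormal coframe: they turn the Sasaki metric into the dot
    product and the Gram determinant into the squared length of a cross product. In these
    coordinates b is the Hodge dual of the form.\<close>
  define t :: "tvec \<Rightarrow> real^3" where "t X = vector [coframe0 A g u X, coframe1 A g u X, coframe2 A g u X]" for X
  have \<phi>t: "\<phi> u X Y = b \<bullet> cross3 (t X) (t Y)" for X Y
    by (simp add: \<phi> wedge_def t_def cross3_def inner_vec_def sum_3 algebra_simps)
  have sas: "sasaki A g u X Y = t X \<bullet> t Y" if "X \<in> SM_tangent A g u" "Y \<in> SM_tangent A g u" for X Y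
    using sasaki_eq[OF pv(2)] that by (simp add: pv(1) t_def inner_vec_def sum_3)
  have unit: "(X, Y) \<in> unit_simple_2vectors A g u \<longleftrightarrow>
      X \<in> SM_tangent A g u \<and> Y \<in> SM_tangent A g u \<and> norm (cross3 (t X) (t Y)) = 1" for X Y
  proof -
    have "sqrt (sasaki A g u X X * sasaki A g u Y Y - (sasaki A g u X Y)\<^sup>2) = norm (cross3 (t X) (t Y))"
      if "X \<in> SM_tangent A g u" "Y \<in> SM_tangent A g u"
      using that by (simp add: sas norm_cross[symmetric] power2_norm_eq_inner[symmetric])
    then show ?thesis unfolding unit_simple_2vectors_def by auto
  qed
  \<comment> \<open>The direction in which Cauchy-Schwarz is an equality. If b vanishes any unit
    vector will do, but one is required, since the supremum runs over unit 2-vectors only.\<close>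
  define n where "n = (if b = 0 then axis 1 1 else (1 / norm b) *\<^sub>R b)"
  have "norm n = 1" "b \<bullet> n = norm b"
    by (auto simp: n_def power2_norm_eq_inner[symmetric] power2_eq_square)
  then obtain x y where xy: "cross3 x y = n" using unit_cross_product_exists by blast
  have "\<exists>Z\<in>SM_tangent A g u. t Z = x" for x
    using coframe_onto[OF pv(2), of "x$1" "x$2" "x$3"] unfolding pv(1)[symmetric]
    by (force simp: t_def vec_eq_iff forall_3)
  then obtain X Y where XY: "X \<in> SM_tangent A g u" "t X = x" "Y \<in> SM_tangent A g u" "t Y = y" by metis
  show ?thesis unfolding comass_at_def
  proof (rule antisym)
    show "(SUP (X, Y)\<in>unit_simple_2vectors A g u. ereal (\<phi> u X Y)) \<le> ereal (norm b)"
    proof (rule SUP_least, clarify)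
      fix X Y assume "(X, Y) \<in> unit_simple_2vectors A g u"
      then show "ereal (\<phi> u X Y) \<le> ereal (norm b)"
        using norm_cauchy_schwarz[of b "cross3 (t X) (t Y)"] by (simp add: unit \<phi>t)
    qed
    have "(X, Y) \<in> unit_simple_2vectors A g u"
      using XY xy \<open>norm n = 1\<close> by (simp add: unit)
    moreover have "\<phi> u X Y = norm b" using XY xy \<open>b \<bullet> n = norm b\<close> by (simp add: \<phi>t)
    ultimately show "ereal (norm b) \<le> (SUP (X, Y)\<in>unit_simple_2vectors A g u. ereal (\<phi> u X Y))"
      by (metis (mono_tags, lifting) SUP_upper case_prod_conv)
  qed
qed

text \<open>A supremum equals 1 iff 1 is an upper bound and no smaller number is; the square root
  respects both conditions because it is increasing and fixes 1. Phrased this way, unbounded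
  families and an empty index set are covered as well.\<close>

lemma SUP_sqrt_eq_1_iff:
  fixes h :: "'b \<Rightarrow> real"
  assumes h: "\<And>x. x \<in> S \<Longrightarrow> h x \<ge> 0"
  shows "(SUP x\<in>S. ereal (sqrt (h x))) = 1 \<longleftrightarrow> (SUP x\<in>S. ereal (h x)) = 1"
proof -
  have le: "(SUP x\<in>S. ereal (f x)) \<le> ereal a \<longleftrightarrow> (\<forall>x\<in>S. f x \<le> a)" for f :: "'b \<Rightarrow> real" and a
    by (simp add: SUP_le_iff)
  have eq: "(SUP x\<in>S. ereal (f x)) = 1 \<longleftrightarrow> (\<forall>x\<in>S. f x \<le> 1) \<and> (\<forall>a<1. \<exists>x\<in>S. a < f x)" for f :: "'b \<Rightarrow> real"
  proof
    assume *: "(SUP x\<in>S. ereal (f x)) = 1"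
    have "\<forall>x\<in>S. f x \<le> 1" using le[of f 1] * by simp
    moreover have "\<exists>x\<in>S. a < f x" if "a < 1" for a
      using le[of f a] * that by (force simp: not_le[symmetric])
    ultimately show "(\<forall>x\<in>S. f x \<le> 1) \<and> (\<forall>a<1. \<exists>x\<in>S. a < f x)" by blast
  next
    assume *: "(\<forall>x\<in>S. f x \<le> 1) \<and> (\<forall>a<1. \<exists>x\<in>S. a < f x)"
    have "(SUP x\<in>S. ereal (f x)) \<le> 1" using le[of f 1] * by (simp add: one_ereal_def)
    moreover have "1 \<le> (SUP x\<in>S. ereal (f x))"
    proof (rule ccontr)
      assume "\<not> 1 \<le> (SUP x\<in>S. ereal (f x))"
      then obtain a where "(SUP x\<in>S. ereal (f x)) < ereal a" "ereal a < 1"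
        using ereal_dense2[of "SUP x\<in>S. ereal (f x)" 1] by (force simp: one_ereal_def)
      then have "\<forall>x\<in>S. f x \<le> a" "a < 1" using le[of f a] by auto
      then show False using * by force
    qed
    ultimately show "(SUP x\<in>S. ereal (f x)) = 1" by (rule antisym)
  qed
  have "(\<forall>a<1. \<exists>x\<in>S. a < sqrt (h x)) \<longleftrightarrow> (\<forall>a<1. \<exists>x\<in>S. a < h x)"
  proof
    assume *: "\<forall>a<1. \<exists>x\<in>S. a < sqrt (h x)"
    show "\<forall>a<1. \<exists>x\<in>S. a < h x"
    proof (intro allI impI)
      fix a :: real assume "a < 1"
      then have "sqrt (max a 0) < 1" by simp
      then obtain x where "x \<in> S" "sqrt (max a 0) < sqrt (h x)" using * by blast
      then show "\<exists>x\<in>S. a < h x" by auto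
    qed
  next
    assume *: "\<forall>a<1. \<exists>x\<in>S. a < h x"
    show "\<forall>a<1. \<exists>x\<in>S. a < sqrt (h x)"
    proof (intro allI impI)
      fix a :: real assume "a < 1"
      \<comment> \<open>A negative a may have a square above 1, hence the truncation at 0.\<close>
      then have "(max a 0)\<^sup>2 < 1" by (simp add: power_less_one_iff abs_square_less_1)
      then obtain x where "x \<in> S" "(max a 0)\<^sup>2 < h x" using * by blast
      then show "\<exists>x\<in>S. a < sqrt (h x)" using real_less_rsqrt[of "max a 0" "h x"] by auto
    qed
  qed
  then show ?thesis unfolding eq by auto
qed

lemma SM_surj:
  assumes "p \<in> topspace M"
  shows "\<exists>v. (p, v) \<in> SM M g"
  using unit_vector_exists[OF inner_form_metric[OF assms], of e1] assms
  by (auto simp: SM_def axis_eq_0_iff)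

text \<open>The pointwise comass depends only on the foot of u, and no fibre is empty, so the
  supremum over SM is one over the surface.\<close>

lemma comass_eq_1_iff:
  assumes \<phi>: "\<And>u X Y. \<phi> u X Y =
           b2 (fst u) * wedge (coframe0 A g) (coframe1 A g) u X Y
         + b1 (fst u) * wedge (coframe2 A g) (coframe0 A g) u X Y
         + b0 (fst u) * wedge (coframe1 A g) (coframe2 A g) u X Y"
  shows "comass M A g \<phi> = 1 \<longleftrightarrow>
    (SUP x \<in> topspace M. ereal ((b0 x)\<^sup>2 + (b1 x)\<^sup>2 + (b2 x)\<^sup>2)) = 1"
proof -
  let ?h = "\<lambda>x. (b0 x)\<^sup>2 + (b1 x)\<^sup>2 + (b2 x)\<^sup>2"
  have "comass_at A g \<phi> u = ereal (sqrt (?h (fst u)))" if "u \<in> SM M g" for u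
  proof -
    have "norm (vector [b0 (fst u), b1 (fst u), b2 (fst u)] :: real^3) = sqrt (?h (fst u))"
      by (simp add: norm_vec_def L2_set_def sum_3)
    then show ?thesis
      using comass_at_eq[OF that, of \<phi> "vector [b0 (fst u), b1 (fst u), b2 (fst u)]"] \<phi> by simp
  qed
  then have "comass M A g \<phi> = (SUP u \<in> SM M g. ereal (sqrt (?h (fst u))))"
    unfolding comass_def by (intro SUP_cong) auto
  also have "\<dots> = (SUP x \<in> fst ` SM M g. ereal (sqrt (?h x)))" by (simp add: image_image)
  also have "fst ` SM M g = topspace M"
    using SM_surj by (force simp: SM_def)
  finally show ?thesis using SUP_sqrt_eq_1_iff[of "topspace M" ?h] by simp
qed

section \<open>Regularity of metric expressions\<close>

context
  fixes c and W :: "'e::euclidean_space set" and k and P X Y :: "'e \<Rightarrow> real^2"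
  assumes c: "c \<in> A" and W: "open W" "P ` W \<subseteq> snd c ` fst c"
    and Ck: "Ck_on k P W" "Ck_on k X W" "Ck_on k Y W"
begin

lemma Ck_on_metric_coefficient: "Ck_on k (\<lambda>z. metric_coord A g c (P z) v w) W"
  by (rule Ck_on_compose[OF W(2) Ck(1) metric_smooth[OF c]])

lemma Ck_on_metric: "Ck_on k (\<lambda>z. metric_coord A g c (P z) (X z) (Y z)) W"
proof (rule Ck_on_cong[OF W(1)])
  let ?G = "\<lambda>z. metric_coord A g c (P z)"
  show "Ck_on k (\<lambda>z. X z $ 1 * Y z $ 1 * ?G z e1 e1 + (X z $ 1 * Y z $ 2 + X z $ 2 * Y z $ 1) * ?G z e1 e2
      + X z $ 2 * Y z $ 2 * ?G z e2 e2) W"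
    by (intro Ck_on_add Ck_on_mult Ck_on_nth Ck Ck_on_metric_coefficient)
  fix z assume "z \<in> W"
  then show "X z $ 1 * Y z $ 1 * ?G z e1 e1 + (X z $ 1 * Y z $ 2 + X z $ 2 * Y z $ 1) * ?G z e1 e2
      + X z $ 2 * Y z $ 2 * ?G z e2 e2 = ?G z (X z) (Y z)"
    using inner_form_expand[OF inner_form_metric_coord[OF c], of "P z" "X z" "Y z"] W(2) by auto
qed

lemma Ck_on_area: "Ck_on k (\<lambda>z. area_density (metric_coord A g c (P z)) * det2 (X z) (Y z)) W"
proof -
  let ?G = "\<lambda>z. metric_coord A g c (P z)"
  have pos: "gram (?G z) > 0" if "z \<in> W" for z
    using gram_pos[OF inner_form_metric_coord[OF c]] W(2) that by blast
  have "Ck_on k (\<lambda>z. gram (?G z)) W"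
    unfolding gram_def power2_eq_square by (intro Ck_on_diff Ck_on_mult Ck_on_metric_coefficient)
  \<comment> \<open>The square root is written as a power, smooth on the positive reals, where the
    Gram determinant takes its values.\<close>
  then have "Ck_on k (\<lambda>z. gram (?G z) powr (1/2)) W"
    by (intro Ck_on_compose[OF _ _ Ck_on_powr]) (use pos in auto)
  then have "Ck_on k (\<lambda>z. area_density (?G z)) W"
    by (rule Ck_on_cong[OF W(1)]) (use pos in \<open>simp add: area_density_def powr_half_sqrt less_imp_le\<close>)
  then show ?thesis
    unfolding det2_def by (intro Ck_on_mult Ck_on_diff Ck_on_nth Ck)
qed

end

text \<open>The Gram determinant is multiplied by the square of the Jacobian. As the atlas is
  oriented, the square root of this is the Jacobian itself, so the area form is the same in all
  charts.\<close>

lemma area_density_metric_coord: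
  assumes "c \<in> A" "p \<in> fst c"
  shows "area_density (metric_coord A g c (snd c p)) * det2 v w
    = area_density (g p) * det2 (tangent_change c (chart_at A p) p v) (tangent_change c (chart_at A p) p w)"
proof -
  let ?d = "chart_at A p"
  let ?T = "tangent_change c ?d p"
  have p: "p \<in> topspace M" using in_topspace assms by blast
  note d = chart_at_in[OF p]
  have T: "linear ?T" using tangent_change_linear assms d by blast
  have "det (matrix ?T) > 0"
    using surf assms d unfolding oriented_surface_def by blast
  moreover have "metric_coord A g c (snd c p) = (\<lambda>v w. g p (?T v) (?T w))"
    using metric_coord_chart[OF assms] by (intro ext)
  ultimately have "area_density (metric_coord A g c (snd c p)) = det (matrix ?T) * area_density (g p)"
    by (simp add: area_density_def gram_linear_pullback[OF inner_form_metric[OF p] T] real_sqrt_mult)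
  then show ?thesis by (simp add: det2_linear[OF T])
qed

section \<open>The structure equations in a parametrization\<close>

context
  fixes V :: "(real^3) set" and F :: "real^3 \<Rightarrow> 'a tm"
begin

definition "chart_dom c = {x \<in> V. fst (F x) \<in> fst c}"
text \<open>\<open>base\<close> and \<open>fibre\<close> are the two components of F in the chart of
  TM induced by c. The chart is an explicit argument so that it stays fixed while y varies.\<close>

definition "base c y = snd c (fst (F y))"
definition "fibre c y = tangent_change (chart_at A (fst (F y))) c (fst (F y)) (snd (F y))"
abbreviation (input) "here y \<equiv> chart_at A (fst (F y))"
abbreviation (input) "DF \<equiv> tm_derivative A F"

text \<open>The pullbacks of $e^0$ and $e^1$, the latter written with the area form so that its
  derivative does not involve \<open>rot\<close>.\<close>

definition "theta0 y b = g (fst (F y)) (fst (DF y b)) (snd (F y))"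
definition "theta1 y b = area_density (g (fst (F y))) * det2 (snd (F y)) (fst (DF y b))"

context
  assumes par: "SM_parametrization M A g V F"
begin

lemma chart_dom_open: "c \<in> A \<Longrightarrow> open (chart_dom c)"
  using par unfolding SM_parametrization_def chart_dom_def by blast

lemma F_in_SM: "y \<in> V \<Longrightarrow> F y \<in> SM M g"
  using par unfolding SM_parametrization_def by blast

lemma F_base: "y \<in> V \<Longrightarrow> fst (F y) \<in> topspace M"
  and F_unit: "y \<in> V \<Longrightarrow> g (fst (F y)) (snd (F y)) (snd (F y)) = 1"
  using F_in_SM[of y] by (auto simp: SM_def)

lemma tm_chart_F: "tm_chart A c \<circ> F = (\<lambda>y. (base c y, fibre c y))"
  by (simp add: fun_eq_iff tm_chart_def base_def fibre_def)

lemma tm_chart_smooth: "c \<in> A \<Longrightarrow> Ck_on k (\<lambda>y. (base c y, fibre c y)) (chart_dom c)"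
  using par unfolding SM_parametrization_def smooth_on_def chart_dom_def tm_chart_F by blast

lemma base_smooth: "c \<in> A \<Longrightarrow> Ck_on k (base c) (chart_dom c)"
  using Ck_on_fst[OF tm_chart_smooth, of c k] by simp

lemma fibre_smooth: "c \<in> A \<Longrightarrow> Ck_on k (fibre c) (chart_dom c)"
  using Ck_on_snd[OF tm_chart_smooth, of c k] by simp

lemma base_in: "base c ` chart_dom c \<subseteq> snd c ` fst c"
  by (auto simp: base_def chart_dom_def)

lemma here_in:
  assumes "y \<in> V"
  shows "here y \<in> A" "y \<in> chart_dom (here y)" "fst (F y) \<in> fst (here y)"
  using chart_at_in F_base[OF assms] assms by (auto simp: chart_dom_def)

lemma fibre_here: "y \<in> V \<Longrightarrow> fibre (here y) y = snd (F y)"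
  unfolding fibre_def using tangent_change_self here_in by blast

lemma base_here: "base (here y) y = coord_at A (fst (F y))"
  by (simp add: base_def coord_at_def)

lemma tm_chart_has_derivative:
  assumes "y \<in> V"
  shows "((\<lambda>z. (base (here y) z, fibre (here y) z)) has_derivative DF y) (at y)"
  unfolding tm_derivative_def tm_chart_F
  by (rule Ck_on_imp_differentiable[OF tm_chart_smooth]) (use here_in[OF assms] in auto)

lemma DF_linear: "y \<in> V \<Longrightarrow> linear (DF y)"
  using tm_chart_has_derivative by (rule has_derivative_linear)

lemma DF_has_derivative:
  assumes "y \<in> V"
  shows "(base (here y) has_derivative (\<lambda>a. fst (DF y a))) (at y)"
    "(fibre (here y) has_derivative (\<lambda>a. snd (DF y a))) (at y)"
  using has_derivative_fst[OF tm_chart_has_derivative[OF assms]]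
    has_derivative_snd[OF tm_chart_has_derivative[OF assms]] by simp_all

lemma has_derivative_base_compose:
  assumes y: "y \<in> V"
    and f: "((f \<circ> chart_inv (here y)) has_derivative D) (at (coord_at A (fst (F y))))"
  shows "((\<lambda>z. f (fst (F z))) has_derivative (\<lambda>a. D (fst (DF y a)))) (at y)"
proof -
  have "((f \<circ> chart_inv (here y)) has_derivative D) (at (base (here y) y))"
    using f by (simp add: base_here)
  from diff_chain_at[OF DF_has_derivative(1)[OF y] this]
  have "((f \<circ> chart_inv (here y)) \<circ> base (here y) has_derivative (\<lambda>a. D (fst (DF y a)))) (at y)"
    by (simp add: o_def)
  then show ?thesis
  proof (rule has_derivative_transform_within_open)
    show "open (chart_dom (here y))" "y \<in> chart_dom (here y)"
      using chart_dom_open here_in y by auto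
    fix z assume "z \<in> chart_dom (here y)"
    then show "((f \<circ> chart_inv (here y)) \<circ> base (here y)) z = f (fst (F z))"
      using chart_inv_chart[OF surf here_in(1)[OF y]] by (simp add: base_def chart_dom_def)
  qed
qed

lemma base_derivative:
  assumes "c \<in> A" "y \<in> chart_dom c"
  shows "frechet_derivative (base c) (at y) a = tangent_change (here y) c (fst (F y)) (fst (DF y a))"
proof -
  have y: "y \<in> V" "fst (F y) \<in> fst c" using assms by (auto simp: chart_dom_def)
  have "((snd c \<circ> chart_inv (here y)) has_derivative tangent_change (here y) c (fst (F y)))
      (at (coord_at A (fst (F y))))"
    unfolding coord_at_def using transition_derivative[OF surf] here_in y assms by blast
  from has_derivative_base_compose[OF y(1) this]
  have "(base c has_derivative (\<lambda>a. tangent_change (here y) c (fst (F y)) (fst (DF y a)))) (at y)"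
    by (simp add: base_def[abs_def])
  then show ?thesis by (rule frechet_derivative_eq)
qed

text \<open>The definitions of \<open>theta0\<close> and \<open>theta1\<close> refer to the chart at
  the foot of F y, which changes with y. Here a single chart c serves on all of
  \<open>chart_dom c\<close>, which makes smoothness visible and differentiation possible.\<close>

lemma theta_chart:
  assumes "c \<in> A" "y \<in> chart_dom c"
  shows "theta0 y b = metric_coord A g c (base c y) (frechet_derivative (base c) (at y) b) (fibre c y)"
    "theta1 y b = area_density (metric_coord A g c (base c y))
       * det2 (fibre c y) (frechet_derivative (base c) (at y) b)"
proof -
  have y: "y \<in> V" "fst (F y) \<in> fst c" using assms by (auto simp: chart_dom_def)
  have *: "tangent_change c (here y) (fst (F y)) (tangent_change (here y) c (fst (F y)) w) = w" for w
    using tangent_change_inverse[OF surf] here_in y assms by blast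
  show "theta0 y b = metric_coord A g c (base c y) (frechet_derivative (base c) (at y) b) (fibre c y)"
    unfolding base_derivative[OF assms] fibre_def theta0_def unfolding base_def
      metric_coord_chart[OF assms(1) y(2)] * ..
  show "theta1 y b = area_density (metric_coord A g c (base c y))
       * det2 (fibre c y) (frechet_derivative (base c) (at y) b)"
    unfolding base_derivative[OF assms] fibre_def theta1_def unfolding base_def
      area_density_metric_coord[OF assms(1) y(2)] * ..
qed

lemma theta_smooth:
  assumes "c \<in> A"
  shows "Ck_on k (\<lambda>y. theta0 y b) (chart_dom c)" "Ck_on k (\<lambda>y. theta1 y b) (chart_dom c)"
proof -
  note o = chart_dom_open[OF assms]
  note sm = Ck_on_frechet_derivative[OF o base_smooth[OF assms], of _ b] base_smooth[OF assms] fibre_smooth[OF assms]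
  show "Ck_on k (\<lambda>y. theta0 y b) (chart_dom c)"
    by (rule Ck_on_cong[OF o Ck_on_metric[OF assms o base_in sm(2,1,3)]])
      (simp add: theta_chart[OF assms])
  show "Ck_on k (\<lambda>y. theta1 y b) (chart_dom c)"
    by (rule Ck_on_cong[OF o Ck_on_area[OF assms o base_in sm(2,3,1)]])
      (simp add: theta_chart[OF assms])
qed

context
  fixes y
  assumes y: "y \<in> V"
begin

abbreviation (input) "foot \<equiv> fst (F y)"
abbreviation (input) "arrow \<equiv> snd (F y)"
abbreviation (input) nablaF :: "real^3 \<Rightarrow> real^2" where "nablaF a \<equiv> connector A g (F y) (DF y a)"

lemma metric_here: "metric_coord A g (here y) (coord_at A foot) = g foot"
  by (rule metric_coord_at[OF F_base[OF y]])

lemma nabla_eq: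
  "nablaF a = snd (DF y a) + levi_civita (metric_coord A g (here y)) (coord_at A foot) (fst (DF y a)) arrow"
  by (simp add: connector_def christoffel_def)

text \<open>Along F the vector has constant length 1; differentiating this by the product rule makes
  its covariant derivative orthogonal to it.\<close>

lemma DF_tangent: "DF y a \<in> SM_tangent A g (F y)"
proof -
  note d = here_in[OF y]
  note q = inner_form_metric[OF F_base[OF y]]
  let ?d = "here y"
  have "((\<lambda>z. metric_coord A g ?d (base ?d z) (fibre ?d z) (fibre ?d z)) has_derivative
     (\<lambda>h. metric_coord A g ?d (coord_at A foot) (snd (DF y h) + levi_civita (metric_coord A g ?d) (coord_at A foot) (fst (DF y h)) (fibre ?d y)) (fibre ?d y)
        + metric_coord A g ?d (coord_at A foot) (fibre ?d y) (snd (DF y h) + levi_civita (metric_coord A g ?d) (coord_at A foot) (fst (DF y h)) (fibre ?d y))))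
     (at y)"
    by (rule coord_covariant_product_rule[OF d(1) coord_at_in[OF F_base[OF y]] chart_dom_open[OF d(1)] d(2)
          base_in base_here DF_has_derivative(1)[OF y] DF_has_derivative(2)[OF y] DF_has_derivative(2)[OF y]])
  then have *: "((\<lambda>z. metric_coord A g ?d (base ?d z) (fibre ?d z) (fibre ?d z)) has_derivative
     (\<lambda>h. g foot (nablaF h) arrow + g foot arrow (nablaF h))) (at y)"
    unfolding nabla_eq metric_here fibre_here[OF y] .
  have "((\<lambda>z. 1) has_derivative (\<lambda>h. g foot (nablaF h) arrow + g foot arrow (nablaF h))) (at y)"
  proof (rule has_derivative_transform_within_open[OF * chart_dom_open[OF d(1)] d(2)])
    fix z assume z: "z \<in> chart_dom ?d"
    then have z': "z \<in> V" "fst (F z) \<in> fst ?d" by (auto simp: chart_dom_def)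
    have "tangent_change ?d (here z) (fst (F z)) (fibre ?d z) = snd (F z)"
      unfolding fibre_def using tangent_change_inverse[OF surf] here_in[OF z'(1)] z' d by blast
    then show "metric_coord A g ?d (base ?d z) (fibre ?d z) (fibre ?d z) = 1"
      unfolding base_def metric_coord_chart[OF d(1) z'(2)] using F_unit[OF z'(1)] by simp
  qed
  then have "(\<lambda>h. g foot (nablaF h) arrow + g foot arrow (nablaF h)) = (\<lambda>h. 0)"
    by (rule has_derivative_unique) simp
  then have "g foot (nablaF a) arrow + g foot arrow (nablaF a) = 0" by metis
  then have "g foot (nablaF a) arrow = 0" using inner_form_sym[OF q, of arrow] by simp
  then show ?thesis using SM_tangent_iff[OF F_base[OF y], of "DF y a" arrow] by simp
qed

abbreviation (input) cof0 :: "real^3 \<Rightarrow> real" where "cof0 a \<equiv> coframe0 A g (F y) (DF y a)"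
abbreviation (input) cof1 :: "real^3 \<Rightarrow> real" where "cof1 a \<equiv> coframe1 A g (F y) (DF y a)"
abbreviation (input) cof2 :: "real^3 \<Rightarrow> real" where "cof2 a \<equiv> coframe2 A g (F y) (DF y a)"

lemma coframe_DF:
  "cof0 a = g foot (fst (DF y a)) arrow"
  "cof1 a = g foot (fst (DF y a)) (quarter_turn (g foot) arrow)"
  "cof2 a = g foot (nablaF a) (quarter_turn (g foot) arrow)"
  using coframe_eq[of foot arrow "DF y a"] F_in_SM[OF y] DF_tangent by auto

text \<open>A unit vector can only turn: its covariant derivative is a multiple of its rotation, and
  e^2 is the coefficient.\<close>

lemma nabla_DF: "nablaF a = cof2 a *\<^sub>R quarter_turn (g foot) arrow"
  using unit_vector_decompose[OF inner_form_metric[OF F_base[OF y]] F_unit[OF y], of "nablaF a"]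
    DF_tangent[of a] SM_tangent_iff[OF F_base[OF y], of "DF y a" arrow] by (simp add: coframe_DF)

lemma theta_coframe: "theta0 y a = cof0 a" "theta1 y a = cof1 a"
  using area_quarter_turn[OF inner_form_metric[OF F_base[OF y]]]
  by (auto simp: theta0_def theta1_def coframe_DF)

lemma base_second_derivative_symmetric:
  "frechet_derivative (\<lambda>z. frechet_derivative (base (here y)) (at z) a) (at y) b
 = frechet_derivative (\<lambda>z. frechet_derivative (base (here y)) (at z) b) (at y) a"
proof -
  note d = here_in[OF y]
  note o = chart_dom_open[OF d(1)]
  let ?P = "base (here y)"
  have nth: "frechet_derivative (\<lambda>z. ?P z $ i) (at z) b = frechet_derivative ?P (at z) b $ i"
    if "z \<in> chart_dom (here y)" for i z b
  proof -
    have "(?P has_derivative frechet_derivative ?P (at z)) (at z)"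
      using Ck_on_imp_differentiable base_smooth d that by blast
    from bounded_linear.has_derivative[OF bounded_linear_vec_nth this]
    have "((\<lambda>z. ?P z $ i) has_derivative (\<lambda>b. frechet_derivative ?P (at z) b $ i)) (at z)" .
    then show ?thesis by (rule frechet_derivative_eq)
  qed
  have nth2: "frechet_derivative (\<lambda>z. frechet_derivative (\<lambda>z. ?P z $ i) (at z) a) (at y) b
      = frechet_derivative (\<lambda>z. frechet_derivative ?P (at z) a) (at y) b $ i" for i a b
  proof -
    have "((\<lambda>z. frechet_derivative ?P (at z) a) has_derivative
        frechet_derivative (\<lambda>z. frechet_derivative ?P (at z) a) (at y)) (at y)"
      using Ck_on_imp_differentiable[OF Ck_on_frechet_derivative[OF o base_smooth[OF d(1)]] d(2)] .
    from bounded_linear.has_derivative[OF bounded_linear_vec_nth this]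
    have "((\<lambda>z. frechet_derivative ?P (at z) a $ i) has_derivative
        (\<lambda>b. frechet_derivative (\<lambda>z. frechet_derivative ?P (at z) a) (at y) b $ i)) (at y)" .
    then have "((\<lambda>z. frechet_derivative (\<lambda>z. ?P z $ i) (at z) a) has_derivative
        (\<lambda>b. frechet_derivative (\<lambda>z. frechet_derivative ?P (at z) a) (at y) b $ i)) (at y)"
      by (rule has_derivative_transform_within_open[OF _ o d(2)]) (simp add: nth)
    then show ?thesis by (rule frechet_derivative_eq)
  qed
  have "frechet_derivative (\<lambda>z. frechet_derivative ?P (at z) a) (at y) b $ i
      = frechet_derivative (\<lambda>z. frechet_derivative ?P (at z) b) (at y) a $ i" for i
    unfolding nth2[symmetric]
    by (rule second_derivative_symmetric[OF o d(2)]) (rule Ck_on_nth[OF base_smooth[OF d(1)]])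
  then show ?thesis by (simp add: vec_eq_iff)
qed

text \<open>Differentiating \<open>theta0\<close> or \<open>theta1\<close> covariantly gives a term
  with the second derivative of the base map and a term where the unit vector is differentiated.
  Antisymmetrising removes the former, and \<open>nabla_DF\<close> turns the latter into products
  with e^2.\<close>

lemma structure_equations:
  "frechet_derivative (\<lambda>z. theta0 z b) (at y) a - frechet_derivative (\<lambda>z. theta0 z a) (at y) b
    = cof2 a * cof1 b - cof1 a * cof2 b"
  "frechet_derivative (\<lambda>z. theta1 z b) (at y) a - frechet_derivative (\<lambda>z. theta1 z a) (at y) b
    = cof0 a * cof2 b - cof2 a * cof0 b"
proof -
  note d = here_in[OF y]
  note o = chart_dom_open[OF d(1)]
  note q = inner_form_metric[OF F_base[OF y]]
  let ?P = "base (here y)"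
  let ?\<Gamma> = "levi_civita (metric_coord A g (here y)) (coord_at A foot)"
  \<comment> \<open>The covariant second derivative of the base map. It is symmetric since partial
    derivatives commute and the connection has no torsion.\<close>
  define H where "H a b = frechet_derivative (\<lambda>z. frechet_derivative ?P (at z) b) (at y) a
    + ?\<Gamma> (fst (DF y a)) (fst (DF y b))" for a b
  have H: "H a b = H b a" for a b
    unfolding H_def using base_second_derivative_symmetric[of b a]
      coord_levi_civita_sym[OF d(1) coord_at_in[OF F_base[OF y]], of "fst (DF y a)" "fst (DF y b)"] by simp
  have P: "frechet_derivative ?P (at y) b = fst (DF y b)" for b
    using fun_cong[OF frechet_derivative_at[OF DF_has_derivative(1)[OF y]], of b] by simp
  have X: "((\<lambda>z. frechet_derivative ?P (at z) b) has_derivative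
      frechet_derivative (\<lambda>z. frechet_derivative ?P (at z) b) (at y)) (at y)" for b
    using Ck_on_imp_differentiable[OF Ck_on_frechet_derivative[OF o base_smooth[OF d(1)]] d(2)] .
  have lin: "linear (g foot w)" "linear (\<lambda>u. g foot u w)" for w using inner_form_linear[OF q] by blast+
  have d0: "frechet_derivative (\<lambda>z. theta0 z b) (at y) a = g foot (H a b) arrow + g foot (fst (DF y b)) (nablaF a)" for a b
  proof -
    have "((\<lambda>z. metric_coord A g (here y) (?P z) (frechet_derivative ?P (at z) b) (fibre (here y) z))
        has_derivative (\<lambda>a. g foot (H a b) arrow + g foot (fst (DF y b)) (nablaF a))) (at y)"
      using coord_covariant_product_rule[OF d(1) coord_at_in[OF F_base[OF y]] o d(2)
          base_in base_here DF_has_derivative(1)[OF y] X[of b] DF_has_derivative(2)[OF y]]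
      unfolding metric_here fibre_here[OF y] P nabla_eq H_def .
    then have "((\<lambda>z. theta0 z b) has_derivative (\<lambda>a. g foot (H a b) arrow + g foot (fst (DF y b)) (nablaF a))) (at y)"
      by (rule has_derivative_transform_within_open[OF _ o d(2)]) (simp add: theta_chart[OF d(1)])
    then show ?thesis by (rule frechet_derivative_eq)
  qed
  have d1: "frechet_derivative (\<lambda>z. theta1 z b) (at y) a
      = area_density (g foot) * (det2 (nablaF a) (fst (DF y b)) + det2 arrow (H a b))" for a b
  proof -
    have "((\<lambda>z. area_density (metric_coord A g (here y) (?P z))
          * det2 (fibre (here y) z) (frechet_derivative ?P (at z) b))
        has_derivative (\<lambda>a. area_density (g foot) * (det2 (nablaF a) (fst (DF y b)) + det2 arrow (H a b)))) (at y)"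
      using coord_area_product_rule[OF d(1) coord_at_in[OF F_base[OF y]] o d(2)
          base_in base_here DF_has_derivative(1)[OF y] DF_has_derivative(2)[OF y] X[of b]]
      unfolding metric_here fibre_here[OF y] P nabla_eq H_def .
    then have "((\<lambda>z. theta1 z b) has_derivative
        (\<lambda>a. area_density (g foot) * (det2 (nablaF a) (fst (DF y b)) + det2 arrow (H a b)))) (at y)"
      by (rule has_derivative_transform_within_open[OF _ o d(2)]) (simp add: theta_chart[OF d(1)])
    then show ?thesis by (rule frechet_derivative_eq)
  qed
  have n0: "g foot (fst (DF y b)) (nablaF a) = cof2 a * cof1 b" for a b
    by (subst nabla_DF) (simp add: linear_scale[OF lin(1)] coframe_DF)
  \<comment> \<open>The area of Jv and w is the inner product of w with J(Jv) = -v, which is the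
    source of the sign.\<close>
  have n1: "area_density (g foot) * det2 (nablaF a) (fst (DF y b)) = - cof2 a * cof0 b" for a b
  proof -
    have "area_density (g foot) * det2 (nablaF a) (fst (DF y b))
        = cof2 a * (area_density (g foot) * det2 (quarter_turn (g foot) arrow) (fst (DF y b)))"
      by (subst nabla_DF) (simp add: det2_def algebra_simps)
    also have "\<dots> = - cof2 a * cof0 b"
      unfolding area_quarter_turn[OF q, symmetric] quarter_turn_twice[OF q]
      by (simp add: linear_neg[OF lin(1)] coframe_DF)
    finally show ?thesis .
  qed
  show "frechet_derivative (\<lambda>z. theta0 z b) (at y) a - frechet_derivative (\<lambda>z. theta0 z a) (at y) b
    = cof2 a * cof1 b - cof1 a * cof2 b"
    unfolding d0 n0 H[of b a] by (simp add: algebra_simps)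
  show "frechet_derivative (\<lambda>z. theta1 z b) (at y) a - frechet_derivative (\<lambda>z. theta1 z a) (at y) b
    = cof0 a * cof2 b - cof2 a * cof0 b"
    unfolding d1 distrib_left n1 H[of b a] by (simp add: algebra_simps)
qed

end

end

end

section \<open>Closedness and the Cauchy-Riemann equation\<close>

definition "chart_deriv p f = frechet_derivative (f \<circ> chart_inv (chart_at A p)) (at (coord_at A p))"

lemma chart_deriv_works:
  assumes "Ck_fun 1 A f" "p \<in> topspace M"
  shows "((f \<circ> chart_inv (chart_at A p)) has_derivative chart_deriv p f) (at (coord_at A p))"
  unfolding chart_deriv_def
  by (rule Ck_on_imp_differentiable[of 0 _ "snd (chart_at A p) ` fst (chart_at A p)"])
    (use assms chart_at_in[OF assms(2)] coord_at_in[OF assms(2)] in \<open>auto simp: Ck_fun_def simp del: Ck_on.simps\<close>)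

lemma holomorphic_at_iff:
  fixes b0 b1 :: "'a \<Rightarrow> real"
  assumes p: "p \<in> topspace M" and b: "Ck_fun 1 A b0" "Ck_fun 1 A b1"
  shows "holomorphic_at A g (\<lambda>x. Complex (b1 x) (b0 x)) p \<longleftrightarrow>
    (\<forall>w. chart_deriv p b1 (quarter_turn (g p) w) + chart_deriv p b0 w = 0)"
proof -
  note B0 = chart_deriv_works[OF b(1) p] and B1 = chart_deriv_works[OF b(2) p]
  note lin = has_derivative_linear[OF B0] has_derivative_linear[OF B1]
  let ?f = "(\<lambda>x. Complex (b1 x) (b0 x)) \<circ> chart_inv (chart_at A p)"
  let ?D = "\<lambda>w. Complex (chart_deriv p b1 w) (chart_deriv p b0 w)"
  have "((\<lambda>x. of_real ((b1 \<circ> chart_inv (chart_at A p)) x) + \<i> * of_real ((b0 \<circ> chart_inv (chart_at A p)) x))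
      has_derivative (\<lambda>w. of_real (chart_deriv p b1 w) + \<i> * of_real (chart_deriv p b0 w))) (at (coord_at A p))"
    by (intro has_derivative_add has_derivative_mult_right has_derivative_of_real B0 B1)
  then have D: "(?f has_derivative ?D) (at (coord_at A p))"
    by (simp add: Complex_eq o_def)
  have "holomorphic_at A g (\<lambda>x. Complex (b1 x) (b0 x)) p \<longleftrightarrow>
      (\<forall>w. ?D (quarter_turn (g p) w) = \<i> * ?D w)"
    unfolding holomorphic_at_def rot_eq[OF p]
  proof (intro iffI exI[of _ ?D] conjI D, elim exE conjE)
    fix D' assume "(?f has_derivative D') (at (coord_at A p))" "\<forall>w. D' (quarter_turn (g p) w) = \<i> * D' w"
    moreover from this(1) have "D' = ?D" by (rule has_derivative_unique[OF _ D])
    ultimately show "\<forall>w. ?D (quarter_turn (g p) w) = \<i> * ?D w" by simp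
  qed
  also have "\<dots> \<longleftrightarrow> (\<forall>w. chart_deriv p b1 (quarter_turn (g p) w) + chart_deriv p b0 w = 0
      \<and> chart_deriv p b0 (quarter_turn (g p) w) = chart_deriv p b1 w)"
    by (auto simp: complex_eq_iff eq_neg_iff_add_eq_0)
  \<comment> \<open>Complex linearity amounts to two real equations; the second is the first at Jw,
    because J^2 = -1.\<close>
  also have "\<dots> \<longleftrightarrow> (\<forall>w. chart_deriv p b1 (quarter_turn (g p) w) + chart_deriv p b0 w = 0)"
  proof -
    have "chart_deriv p b0 (quarter_turn (g p) w) = chart_deriv p b1 w"
      if *: "\<forall>w. chart_deriv p b1 (quarter_turn (g p) w) + chart_deriv p b0 w = 0" for w
      using spec[OF *, of "quarter_turn (g p) w"]
      by (simp add: quarter_turn_twice[OF inner_form_metric[OF p]] linear_neg[OF lin(2)])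
    then show ?thesis by blast
  qed
  finally show ?thesis .
qed

text \<open>The pullback of e^0 ^ e^1 ^ e^2, as a determinant expanded along its entries in
  a.\<close>

definition "vol F y a b c = (let t0 = \<lambda>a. coframe0 A g (F y) (tm_derivative A F y a);
    t1 = \<lambda>a. coframe1 A g (F y) (tm_derivative A F y a);
    t2 = \<lambda>a. coframe2 A g (F y) (tm_derivative A F y a)
  in t0 a * (t1 b * t2 c - t2 b * t1 c) - t1 a * (t0 b * t2 c - t2 b * t0 c) + t2 a * (t0 b * t1 c - t1 b * t0 c))"

context
  fixes V F and \<phi> :: "'a tm \<Rightarrow> tvec \<Rightarrow> tvec \<Rightarrow> real" and b0 b1 b2 :: "'a \<Rightarrow> real"
  assumes par: "SM_parametrization M A g V F"
    and b: "Ck_fun 1 A b0" "Ck_fun 1 A b1" "Ck_fun 1 A b2"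
    and \<phi>: "\<And>u X Y. \<phi> u X Y =
           b2 (fst u) * wedge (coframe0 A g) (coframe1 A g) u X Y
         + b1 (fst u) * wedge (coframe2 A g) (coframe0 A g) u X Y
         + b0 (fst u) * wedge (coframe1 A g) (coframe2 A g) u X Y"
begin

abbreviation (input) \<theta>0 where "\<theta>0 \<equiv> theta0 F"
abbreviation (input) \<theta>1 where "\<theta>1 \<equiv> theta1 F"

text \<open>By the structure equations $e^2 \wedge e^0 = - de^1$ and $e^1 \wedge e^2 = - de^0$.\<close>

lemma pullback_eq:
  assumes "z \<in> V"
  shows "pullback A F \<phi> z a b = b2 (fst (F z)) * (\<theta>0 z a * \<theta>1 z b - \<theta>0 z b * \<theta>1 z a)
    - b1 (fst (F z)) * (frechet_derivative (\<lambda>z. \<theta>1 z b) (at z) a - frechet_derivative (\<lambda>z. \<theta>1 z a) (at z) b)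
    - b0 (fst (F z)) * (frechet_derivative (\<lambda>z. \<theta>0 z b) (at z) a - frechet_derivative (\<lambda>z. \<theta>0 z a) (at z) b)"
  unfolding pullback_def \<phi> wedge_def theta_coframe[OF par assms] structure_equations[OF par assms]
  by (simp add: algebra_simps)

text \<open>The b_2 term contributes nothing: db_2 is a combination of e^0 and e^1, and d(e^0 ^ e^1)
  = e^2 ^ e^1 ^ e^1 - e^0 ^ e^0 ^ e^2 = 0. By dd = 0 the other terms reduce to -db_1 ^ e^0 ^ e^2 and
  -db_0 ^ e^2 ^ e^1, which see only the e^1 component of db_1 and the e^0 component of db_0.\<close>

lemma ext_derivative_pullback:
  assumes y: "y \<in> V"
  shows "ext_derivative (pullback A F \<phi>) y a b c =
    (chart_deriv (fst (F y)) b1 (quarter_turn (g (fst (F y))) (snd (F y)))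
      + chart_deriv (fst (F y)) b0 (snd (F y))) * vol F y a b c"
proof -
  let ?p = "fst (F y)" and ?v = "snd (F y)"
  let ?J = "quarter_turn (g ?p) ?v"
  define T0 T1 where "T0 b h = frechet_derivative (\<lambda>z. \<theta>0 z b) (at y) h"
    and "T1 b h = frechet_derivative (\<lambda>z. \<theta>1 z b) (at y) h" for b h
  define S0 S1 where "S0 a b h = frechet_derivative (\<lambda>z. frechet_derivative (\<lambda>z. \<theta>0 z b) (at z) a) (at y) h"
    and "S1 a b h = frechet_derivative (\<lambda>z. frechet_derivative (\<lambda>z. \<theta>1 z b) (at z) a) (at y) h" for a b h
  define B where "B f h = chart_deriv ?p f (fst (tm_derivative A F y h))" for f :: "'a \<Rightarrow> real" and h
  note p = F_base[OF par y]
  note d = here_in[OF par y]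
  note o = chart_dom_open[OF par d(1)]
  have sub: "z \<in> V" if "z \<in> chart_dom V F (chart_at A ?p)" for z
    using that by (simp add: chart_dom_def)
  have sm: "Ck_on k (\<lambda>z. \<theta>0 z b) (chart_dom V F (chart_at A ?p))"
    "Ck_on k (\<lambda>z. \<theta>1 z b) (chart_dom V F (chart_at A ?p))" for k b
    using theta_smooth[OF par d(1)] by blast+
  have T: "((\<lambda>z. \<theta>0 z b) has_derivative T0 b) (at y)" "((\<lambda>z. \<theta>1 z b) has_derivative T1 b) (at y)" for b
    unfolding T0_def T1_def using Ck_on_imp_differentiable[OF sm(1) d(2)] Ck_on_imp_differentiable[OF sm(2) d(2)]
    by simp_all
  have S: "((\<lambda>z. frechet_derivative (\<lambda>z. \<theta>0 z b) (at z) a) has_derivative S0 a b) (at y)"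
    "((\<lambda>z. frechet_derivative (\<lambda>z. \<theta>1 z b) (at z) a) has_derivative S1 a b) (at y)" for a b
    unfolding S0_def S1_def
    using Ck_on_imp_differentiable[OF Ck_on_frechet_derivative[OF o sm(1)] d(2)]
      Ck_on_imp_differentiable[OF Ck_on_frechet_derivative[OF o sm(2)] d(2)] by simp_all
  \<comment> \<open>This is dd = 0 for the pullbacks of e^0 and e^1.\<close>
  have sym: "S0 a b h = S0 h b a" "S1 a b h = S1 h b a" for a b h
    unfolding S0_def S1_def by (intro second_derivative_symmetric[OF o d(2)] sm)+
  have B: "((\<lambda>z. f (fst (F z))) has_derivative B f) (at y)" if "Ck_fun 1 A f" for f
    unfolding B_def using has_derivative_base_compose[OF par y chart_deriv_works[OF that p]] .
  define E where "E a b h = b2 ?p * ((\<theta>0 y a * T1 b h + T0 a h * \<theta>1 y b) - (\<theta>0 y b * T1 a h + T0 b h * \<theta>1 y a))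
      + B b2 h * (\<theta>0 y a * \<theta>1 y b - \<theta>0 y b * \<theta>1 y a)
    - (b1 ?p * (S1 a b h - S1 b a h) + B b1 h * (T1 b a - T1 a b))
    - (b0 ?p * (S0 a b h - S0 b a h) + B b0 h * (T0 b a - T0 a b))" for a b h
  have E: "frechet_derivative (\<lambda>z. pullback A F \<phi> z a b) (at y) h = E a b h" for a b h
  proof (rule frechet_derivative_eq)
    have "((\<lambda>z. b2 (fst (F z)) * (\<theta>0 z a * \<theta>1 z b - \<theta>0 z b * \<theta>1 z a)
    - b1 (fst (F z)) * (frechet_derivative (\<lambda>z. \<theta>1 z b) (at z) a - frechet_derivative (\<lambda>z. \<theta>1 z a) (at z) b)
    - b0 (fst (F z)) * (frechet_derivative (\<lambda>z. \<theta>0 z b) (at z) a - frechet_derivative (\<lambda>z. \<theta>0 z a) (at z) b))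
      has_derivative E a b) (at y)"
      unfolding E_def T0_def[of _ a] T0_def[of _ b] T1_def[of _ a] T1_def[of _ b]
      unfolding T0_def[symmetric] T1_def[symmetric]
      by (rule has_derivative_eq_rhs, (rule has_derivative_diff has_derivative_mult T S B b)+)
        (simp add: fun_eq_iff T0_def T1_def)
    then show "((\<lambda>z. pullback A F \<phi> z a b) has_derivative E a b) (at y)"
      by (rule has_derivative_transform_within_open[OF _ o d(2)]) (use sub pullback_eq in auto)
  qed
  \<comment> \<open>A function pulled back from the surface has no derivative along the fibres, so
    its differential has no e^2 component.\<close>
  have Bt: "B f h = coframe0 A g (F y) (tm_derivative A F y h) * chart_deriv ?p f ?v
      + coframe1 A g (F y) (tm_derivative A F y h) * chart_deriv ?p f ?J" if "Ck_fun 1 A f" for f h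
  proof -
    note lin = has_derivative_linear[OF chart_deriv_works[OF that p]]
    show ?thesis
      unfolding B_def coframe_DF[OF par y]
      using arg_cong[OF unit_vector_decompose[OF inner_form_metric[OF p] F_unit[OF par y],
            of "fst (tm_derivative A F y h)"], of "chart_deriv ?p f"]
      by (simp only: linear_add[OF lin] linear_scale[OF lin] real_scaleR_def)
  qed
  have st: "T0 b a = T0 a b + (coframe2 A g (F y) (tm_derivative A F y a) * coframe1 A g (F y) (tm_derivative A F y b)
      - coframe1 A g (F y) (tm_derivative A F y a) * coframe2 A g (F y) (tm_derivative A F y b))"
    "T1 b a = T1 a b + (coframe0 A g (F y) (tm_derivative A F y a) * coframe2 A g (F y) (tm_derivative A F y b)
      - coframe2 A g (F y) (tm_derivative A F y a) * coframe0 A g (F y) (tm_derivative A F y b))" for a b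
    unfolding T0_def T1_def using structure_equations[OF par y, of b a] by linarith+
  \<comment> \<open>The symmetries and structure equations are instantiated so that, in each pair
    related by a swap of arguments, one member is eliminated; a polynomial identity remains.\<close>
  show ?thesis
    unfolding ext_derivative_def E unfolding E_def Bt[OF b(1)] Bt[OF b(2)] Bt[OF b(3)]
      theta_coframe[OF par y] sym(1)[of b c a] sym(2)[of b c a] sym(1)[of c b a] sym(2)[of c b a] sym(1)[of c a b]  sym(2)[of c a b]
      st(1)[of b a] st(1)[of c a] st(1)[of c b] st(2)[of b a] st(2)[of c a] st(2)[of c b] vol_def Let_def
    by (simp add: algebra_simps)
qed

text \<open>The coframe components of the differential of F form an endomorphism of
  \<open>real^3\<close> that is injective because F is an immersion, hence onto. On preimages of the
  standard basis the volume is 1.\<close>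

lemma vol_nonzero:
  assumes y: "y \<in> V"
  shows "\<exists>a b c. vol F y a b c \<noteq> 0"
proof -
  let ?DF = "tm_derivative A F y"
  define L :: "real^3 \<Rightarrow> real^3" where "L a = vector [coframe0 A g (F y) (?DF a), coframe1 A g (F y) (?DF a), coframe2 A g (F y) (?DF a)]" for a
  note p = F_base[OF par y]
  note q = inner_form_metric[OF p]
  have D: "linear ?DF" using DF_linear[OF par y] .
  have C: "linear (connector A g (F y))" using connector_linear[OF p, of "snd (F y)"] by simp
  have lin: "linear (\<lambda>a. g (fst (F y)) (fst (?DF a)) w)"
    "linear (\<lambda>a. g (fst (F y)) (connector A g (F y) (?DF a)) w)" for w
    using linear_compose[OF linear_compose[OF D linear_fst] inner_form_linear(2)[OF q]]
      linear_compose[OF linear_compose[OF D C] inner_form_linear(2)[OF q]] by (simp_all add: o_def)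
  have "linear L"
    unfolding L_def coframe_DF[OF par y]
    by (rule linearI) (simp_all add: vec_eq_iff forall_3 linear_add[OF lin(1)] linear_add[OF lin(2)]
      linear_scale[OF lin(1)] linear_scale[OF lin(2)])
  moreover have "a = 0" if "L a = 0" for a
  proof -
    have "coframe0 A g (F y) (?DF a) = 0 \<and> coframe1 A g (F y) (?DF a) = 0 \<and> coframe2 A g (F y) (?DF a) = 0"
      using that by (simp add: L_def vec_eq_iff forall_3)
    then have "?DF a = 0"
      using SM_tangent_decompose[of "fst (F y)" "snd (F y)" "?DF a"] F_in_SM[OF par y] DF_tangent[OF par y]
      by (simp add: coframe_DF[OF par y])
    moreover have "inj ?DF" using par y unfolding SM_parametrization_def by blast
    ultimately show "a = 0" using linear_0[OF D] by (metis injD)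
  qed
  ultimately have "surj L"
    using linear_injective_imp_surjective linear_injective_0 by blast
  then obtain a b c where "L a = axis 1 1" "L b = axis 2 1" "L c = axis 3 1" by (metis surjD)
  then have "vol F y a b c = 1"
    by (simp add: L_def vec_eq_iff forall_3 vol_def axis_def)
  then show ?thesis by (metis zero_neq_one)
qed

lemma ext_derivative_pullback_zero_iff:
  assumes y: "y \<in> V"
  shows "(\<forall>a b c. ext_derivative (pullback A F \<phi>) y a b c = 0) \<longleftrightarrow>
    chart_deriv (fst (F y)) b1 (quarter_turn (g (fst (F y))) (snd (F y)))
      + chart_deriv (fst (F y)) b0 (snd (F y)) = 0"
  using vol_nonzero[OF y] unfolding ext_derivative_pullback[OF y] by auto

end

section \<open>Existence of parametrizations\<close>

lemma Ck_on_tangent_map: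
  fixes P X :: "'e::euclidean_space \<Rightarrow> real^2"
  assumes cd: "c \<in> A" "d \<in> A" and W: "open W" "P ` W \<subseteq> snd c ` (fst c \<inter> fst d)"
    and Ck: "Ck_on k P W" "Ck_on k X W"
  shows "Ck_on k (\<lambda>z. tangent_change c d (chart_inv c (P z)) (X z)) W"
proof -
  let ?t = "\<lambda>z. frechet_derivative (snd d \<circ> chart_inv c) (at (P z))"
  have "Ck_on k (\<lambda>x. frechet_derivative (snd d \<circ> chart_inv c) (at x) e) (snd c ` (fst c \<inter> fst d))" for e
    by (rule Ck_on_frechet_derivative[OF overlap_open[OF surf cd] transition_smooth[OF cd]])
  then have "Ck_on k (\<lambda>z. ?t z e) W" for e by (rule Ck_on_compose[OF W(2) Ck(1)])
  \<comment> \<open>The derivative of the transition map is of class C^k only direction by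
    direction, so X is expanded in the standard basis.\<close>
  then have "Ck_on k (\<lambda>z. X z $ 1 *\<^sub>R ?t z e1 + X z $ 2 *\<^sub>R ?t z e2) W"
    by (intro Ck_on_add Ck_on_scaleR Ck_on_nth Ck(2))
  then show ?thesis
  proof (rule Ck_on_cong[OF W(1)])
    fix z assume "z \<in> W"
    then obtain p where p: "p \<in> fst c" "p \<in> fst d" "P z = snd c p" using W(2) by auto
    have i: "chart_inv c (P z) = p" using chart_inv_chart[OF surf cd(1) p(1)] p(3) by simp
    have "?t z = tangent_change c d p" by (simp add: tangent_change_def p(3))
    then show "X z $ 1 *\<^sub>R ?t z e1 + X z $ 2 *\<^sub>R ?t z e2 = tangent_change c d (chart_inv c (P z)) (X z)"
      using linear_vec2[OF tangent_change_linear[OF cd p(1,2)], of "X z"] i by simp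
  qed
qed

context
  fixes c :: "'a chart"
begin

text \<open>The third coordinate is the slope of the unit vector in the chart \<open>c\<close>. This covers only half
  of each circle fibre, which suffices because the Cauchy-Riemann equation is linear in the vector.\<close>

definition plane_part :: "real^3 \<Rightarrow> real^2" where "plane_part y = vector [y$1, y$2]"
definition slope_vector :: "real^3 \<Rightarrow> real^2" where "slope_vector y = vector [1, y$3]"
definition unit_slope_vector :: "real^3 \<Rightarrow> real^2" where
  "unit_slope_vector y =
     (metric_coord A g c (plane_part y) (slope_vector y) (slope_vector y) powr (-1/2)) *\<^sub>R slope_vector y"
definition slope_dom :: "(real^3) set" where "slope_dom = plane_part -` (snd c ` fst c)"
definition slope_param :: "real^3 \<Rightarrow> 'a tm" where
  "slope_param y = (let p = chart_inv c (plane_part y)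
     in (p, tangent_change c (chart_at A p) p (unit_slope_vector y)))"

context
  assumes c: "c \<in> A"
begin

lemma plane_part_linear: "bounded_linear plane_part"
  by (rule linear_conv_bounded_linear[THEN iffD1], rule linearI)
    (simp_all add: plane_part_def vec_eq_iff forall_2)

lemma Ck_on_plane_part: "Ck_on k plane_part S"
  by (rule Ck_on_bounded_linear[OF plane_part_linear])

lemma Ck_on_slope_vector: "Ck_on k slope_vector S"
proof -
  have "bounded_linear (\<lambda>y::real^3. vector [0, y$3] :: real^2)"
    by (rule linear_conv_bounded_linear[THEN iffD1], rule linearI) (simp_all add: vec_eq_iff forall_2)
  then have "Ck_on k (\<lambda>y. e1 + vector [0, y$3]) S"
    by (intro Ck_on_add Ck_on_const Ck_on_bounded_linear)
  moreover have "(\<lambda>y. e1 + vector [0, y$3]) = slope_vector"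
    by (simp add: fun_eq_iff slope_vector_def vec_eq_iff forall_2 axis2_nth)
  ultimately show ?thesis by simp
qed

lemma slope_preimage_open: "open S \<Longrightarrow> open (plane_part -` S)"
  by (rule open_vimage) (auto intro: linear_continuous_on plane_part_linear)

lemma slope_dom_open: "open slope_dom"
  unfolding slope_dom_def by (rule slope_preimage_open[OF chart_image_open[OF c]])

lemma slope_pos:
  assumes "y \<in> slope_dom"
  shows "metric_coord A g c (plane_part y) (slope_vector y) (slope_vector y) > 0"
proof (rule inner_form_pos[of "metric_coord A g c (plane_part y)"])
  show "inner_form (metric_coord A g c (plane_part y))"
    using inner_form_metric_coord[OF c] assms by (auto simp: slope_dom_def)
  show "slope_vector y \<noteq> 0" by (auto simp: slope_vector_def vec_eq_iff forall_2)
qed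

lemma Ck_on_unit_slope_vector: "Ck_on k unit_slope_vector slope_dom"
proof -
  have "Ck_on k (\<lambda>y. metric_coord A g c (plane_part y) (slope_vector y) (slope_vector y)) slope_dom"
    by (rule Ck_on_metric[OF c slope_dom_open _ Ck_on_plane_part Ck_on_slope_vector Ck_on_slope_vector])
      (auto simp: slope_dom_def)
  then have "Ck_on k (\<lambda>y. metric_coord A g c (plane_part y) (slope_vector y) (slope_vector y) powr (-1/2)) slope_dom"
    by (intro Ck_on_compose[OF _ _ Ck_on_powr]) (use slope_pos in auto)
  then show ?thesis unfolding unit_slope_vector_def[abs_def]
    by (intro Ck_on_scaleR Ck_on_slope_vector)
qed

lemma slope_base:
  assumes "y \<in> slope_dom"
  shows "fst (slope_param y) \<in> fst c" "snd c (fst (slope_param y)) = plane_part y"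
    "fst (slope_param y) = chart_inv c (plane_part y)"
proof -
  obtain p where p: "p \<in> fst c" "plane_part y = snd c p" using assms by (auto simp: slope_dom_def)
  then have "chart_inv c (plane_part y) = p" using chart_inv_chart[OF surf c] by simp
  then show "fst (slope_param y) \<in> fst c" "snd c (fst (slope_param y)) = plane_part y"
    "fst (slope_param y) = chart_inv c (plane_part y)"
    using p by (simp_all add: slope_param_def Let_def)
qed

text \<open>The passage through \<open>chart_at\<close>, forced by the representation of points of
  TM, cancels by the cocycle rule.\<close>

lemma tm_chart_slope:
  assumes "y \<in> slope_dom" "d \<in> A" "fst (slope_param y) \<in> fst d"
  shows "tm_chart A d (slope_param y) = ((snd d \<circ> chart_inv c) (plane_part y),
    tangent_change c d (chart_inv c (plane_part y)) (unit_slope_vector y))"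
proof -
  let ?p = "chart_inv c (plane_part y)"
  have p: "?p \<in> fst c" "?p \<in> fst d" "?p \<in> topspace M"
    using slope_base[OF assms(1)] assms in_topspace[OF c] by auto
  note at = chart_at_in[OF p(3)]
  have "tangent_change (chart_at A ?p) d ?p (tangent_change c (chart_at A ?p) ?p (unit_slope_vector y))
      = tangent_change c d ?p (unit_slope_vector y)"
    by (rule tangent_change_compose[OF c at(1) assms(2) p(1) at(2) p(2)])
  then show ?thesis by (simp add: tm_chart_def slope_param_def Let_def)
qed

text \<open>The quotient of components is insensitive to the normalising factor. It returns the
  third coordinate, both for injectivity and for immersivity of the parametrization.\<close>

lemma unit_slope_vector_recover:
  assumes "y \<in> slope_dom"
  shows "unit_slope_vector y $ 1 \<noteq> 0" "unit_slope_vector y $ 2 / unit_slope_vector y $ 1 = y $ 3"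
  using slope_pos[OF assms] by (auto simp: unit_slope_vector_def slope_vector_def)

lemma slope_unit:
  assumes "y \<in> slope_dom"
  shows "slope_param y \<in> SM M g"
proof -
  let ?p = "fst (slope_param y)"
  note q = inner_form_metric_coord[OF c, of "plane_part y"]
  have in_c: "plane_part y \<in> snd c ` fst c" using assms by (simp add: slope_dom_def)
  define N where "N = metric_coord A g c (plane_part y) (slope_vector y) (slope_vector y)"
  have N: "N > 0" using slope_pos[OF assms] by (simp add: N_def)
  have "g ?p (snd (slope_param y)) (snd (slope_param y))
      = metric_coord A g c (snd c ?p) (unit_slope_vector y) (unit_slope_vector y)"
    unfolding metric_coord_chart[OF c slope_base(1)[OF assms]] by (simp add: slope_param_def Let_def)
  also have "\<dots> = (N powr (-1/2)) * ((N powr (-1/2)) * N)"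
    unfolding slope_base(2)[OF assms] unit_slope_vector_def N_def
    by (simp add: linear_scale[OF inner_form_linear(1)[OF q[OF in_c]]] linear_scale[OF inner_form_linear(2)[OF q[OF in_c]]])
  also have "\<dots> = 1"
    using N by (simp add: powr_minus_divide powr_half_sqrt field_simps)
  finally show ?thesis
    using in_topspace[OF c slope_base(1)[OF assms]] by (cases "slope_param y") (simp add: SM_def)
qed

lemma slope_inj: "inj_on slope_param slope_dom"
proof (rule inj_onI)
  fix y z assume yz: "y \<in> slope_dom" "z \<in> slope_dom" "slope_param y = slope_param z"
  note y = slope_base[OF yz(1)] and z = slope_base[OF yz(2)]
  have p: "plane_part y = plane_part z" using y(2) z(2) yz(3) by simp
  have "tm_chart A c (slope_param y) = tm_chart A c (slope_param z)" using yz(3) by simp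
  then have "tangent_change c c (fst (slope_param y)) (unit_slope_vector y)
      = tangent_change c c (fst (slope_param z)) (unit_slope_vector z)"
    unfolding tm_chart_slope[OF yz(1) c y(1)] tm_chart_slope[OF yz(2) c z(1)] y(3) z(3) by simp
  then have "unit_slope_vector y = unit_slope_vector z"
    using tangent_change_self[OF c] y(1) z(1) by simp
  then have "y $ 3 = z $ 3"
    using unit_slope_vector_recover(2)[OF yz(1)] unit_slope_vector_recover(2)[OF yz(2)] by simp
  moreover have "y $ 1 = z $ 1" "y $ 2 = z $ 2"
    using p by (simp_all add: plane_part_def vec_eq_iff forall_2)
  ultimately show "y = z" by (simp add: vec_eq_iff forall_3)
qed

lemma slope_chart_dom:
  assumes "d \<in> A"
  shows "{x \<in> slope_dom. fst (slope_param x) \<in> fst d} = plane_part -` (snd c ` (fst c \<inter> fst d))"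
  using slope_base chart_inv_chart[OF surf c]
  by (auto simp: slope_dom_def slope_param_def Let_def)

lemma slope_smooth:
  assumes d: "d \<in> A"
  shows "open {x \<in> slope_dom. fst (slope_param x) \<in> fst d}"
    "Ck_on k (tm_chart A d \<circ> slope_param) {x \<in> slope_dom. fst (slope_param x) \<in> fst d}"
proof -
  let ?W = "{x \<in> slope_dom. fst (slope_param x) \<in> fst d}"
  show o: "open ?W"
    unfolding slope_chart_dom[OF d] by (rule slope_preimage_open[OF overlap_open[OF surf c d]])
  have sub: "plane_part ` ?W \<subseteq> snd c ` (fst c \<inter> fst d)" unfolding slope_chart_dom[OF d] by auto
  have "Ck_on k (\<lambda>y. ((snd d \<circ> chart_inv c) (plane_part y),
      tangent_change c d (chart_inv c (plane_part y)) (unit_slope_vector y))) ?W"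
    by (intro Ck_on_Pair Ck_on_tangent_map[OF c d o sub Ck_on_plane_part]
        Ck_on_compose[OF sub Ck_on_plane_part transition_smooth[OF c d]]
        Ck_on_subset[OF Ck_on_unit_slope_vector]) auto
  then show "Ck_on k (tm_chart A d \<circ> slope_param) ?W"
    by (rule Ck_on_cong[OF o]) (use tm_chart_slope d in auto)
qed

text \<open>X and Y below form the transition on TM back to the chart c. They recover the two base
  coordinates and the unit vector, whose quotient of components is the slope;
  \<open>kernel_component\<close> then annihilates each coordinate of a vector in the
  kernel.\<close>

lemma slope_immersion:
  assumes y: "y \<in> slope_dom"
  shows "inj (tm_derivative A slope_param y)"
proof -
  let ?p = "fst (slope_param y)"
  let ?d = "chart_at A ?p"
  let ?\<Phi> = "tm_chart A ?d \<circ> slope_param"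
  let ?W = "{x \<in> slope_dom. fst (slope_param x) \<in> fst ?d}"
  have "?p \<in> topspace M" using slope_base(1)[OF y] in_topspace[OF c] by blast
  note d = chart_at_in[OF this]
  note o = slope_smooth(1)[OF d(1)]
  have yW: "y \<in> ?W" using y d by simp
  have D: "(?\<Phi> has_derivative tm_derivative A slope_param y) (at y)"
    unfolding tm_derivative_def by (rule Ck_on_imp_differentiable[OF slope_smooth(2)[OF d(1)] yW])
  define X where "X = (\<lambda>z::tvec. (snd c \<circ> chart_inv ?d) (fst z))"
  define Y where "Y = (\<lambda>z::tvec. tangent_change ?d c (chart_inv ?d (fst z)) (snd z))"
  let ?S = "(snd ?d ` (fst ?d \<inter> fst c)) \<times> (UNIV :: (real^2) set)"
  have oS: "open ?S" using overlap_open[OF surf d(1) c] by (intro open_Times) auto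
  have "fst ` ?S \<subseteq> snd ?d ` (fst ?d \<inter> fst c)" by auto
  note sm = Ck_on_compose[OF this Ck_on_fst[OF Ck_on_id] transition_smooth[OF d(1) c]]
    Ck_on_tangent_map[OF d(1) c oS this Ck_on_fst[OF Ck_on_id] Ck_on_snd[OF Ck_on_id]]
  have left: "?\<Phi> z \<in> ?S" "X (?\<Phi> z) = plane_part z" "Y (?\<Phi> z) = unit_slope_vector z" if "z \<in> ?W" for z
  proof -
    have z: "z \<in> slope_dom" "fst (slope_param z) \<in> fst ?d" using that by auto
    have zc: "fst (slope_param z) \<in> fst c" using slope_base(1)[OF z(1)] .
    have \<Phi>: "?\<Phi> z = (snd ?d (fst (slope_param z)), tangent_change c ?d (fst (slope_param z)) (unit_slope_vector z))"
      using tm_chart_slope[OF z(1) d(1) z(2)] slope_base(3)[OF z(1)] by simp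
    then show "?\<Phi> z \<in> ?S" using z zc by auto
    show "X (?\<Phi> z) = plane_part z"
      unfolding X_def \<Phi> using chart_inv_chart[OF surf d(1) z(2)] slope_base(2)[OF z(1)] by simp
    show "Y (?\<Phi> z) = unit_slope_vector z"
      unfolding Y_def \<Phi> using chart_inv_chart[OF surf d(1) z(2)]
        tangent_change_inverse[OF surf d(1) c z(2) zc] by simp
  qed
  have "X differentiable at (?\<Phi> y)" "Y differentiable at (?\<Phi> y)"
    unfolding X_def Y_def
    using Ck_on_imp_differentiable[OF sm(1) left(1)[OF yW]] Ck_on_imp_differentiable[OF sm(2) left(1)[OF yW]]
    by (auto intro: differentiableI)
  then have nth: "(\<lambda>z. X z $ i) differentiable at (?\<Phi> y)" "(\<lambda>z. Y z $ i) differentiable at (?\<Phi> y)" for i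
    unfolding differentiable_def using bounded_linear.has_derivative[OF bounded_linear_vec_nth] by blast+
  have ratio: "(\<lambda>z. Y z $ 2 / Y z $ 1) differentiable at (?\<Phi> y)"
    using nth(2) unit_slope_vector_recover(1)[OF y] left(3)[OF yW] by (intro differentiable_divide) auto
  have "h = 0" if h: "tm_derivative A slope_param y h = 0" for h
  proof -
    have "h $ 1 = 0"
      by (rule kernel_component[OF D nth(1)[of 1] o yW _ bounded_linear_vec_nth h]) (simp add: left(2)[simplified] plane_part_def)
    moreover have "h $ 2 = 0"
      by (rule kernel_component[OF D nth(1)[of 2] o yW _ bounded_linear_vec_nth h]) (simp add: left(2)[simplified] plane_part_def)
    moreover have "h $ 3 = 0"
      by (rule kernel_component[OF D ratio o yW _ bounded_linear_vec_nth h])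
        (simp add: left(3)[simplified] unit_slope_vector_recover(2))
    ultimately show "h = 0" by (simp add: vec_eq_iff forall_3)
  qed
  then show ?thesis
    using linear_injective_0[OF has_derivative_linear[OF D]] by blast
qed

lemma slope_parametrization: "SM_parametrization M A g slope_dom slope_param"
  unfolding SM_parametrization_def smooth_on_def
  using slope_dom_open slope_inj slope_unit slope_smooth slope_immersion by blast

end

end

text \<open>Each parametrization tests the Cauchy-Riemann expression at the unit vectors it passes
  through. Holomorphy makes it vanish on all vectors; conversely, the slope parametrization in the
  chart at p passes through unit vectors that span the tangent space at p.\<close>

lemma closed_form_iff:
  fixes b0 b1 b2 :: "'a \<Rightarrow> real"
  assumes b: "Ck_fun 1 A b0" "Ck_fun 1 A b1" "Ck_fun 1 A b2"
    and \<phi>: "\<And>u X Y. \<phi> u X Y =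
           b2 (fst u) * wedge (coframe0 A g) (coframe1 A g) u X Y
         + b1 (fst u) * wedge (coframe2 A g) (coframe0 A g) u X Y
         + b0 (fst u) * wedge (coframe1 A g) (coframe2 A g) u X Y"
  shows "closed_form M A g \<phi> \<longleftrightarrow> holomorphic_surface M A g (\<lambda>x. Complex (b1 x) (b0 x))"
proof
  assume *: "holomorphic_surface M A g (\<lambda>x. Complex (b1 x) (b0 x))"
  show "closed_form M A g \<phi>" unfolding closed_form_def
  proof (intro allI impI ballI)
    fix V F y a b' c assume par: "SM_parametrization M A g V F" and y: "y \<in> V"
    have p: "fst (F y) \<in> topspace M" by (rule F_base[OF par y])
    then have "holomorphic_at A g (\<lambda>x. Complex (b1 x) (b0 x)) (fst (F y))"
      using * unfolding holomorphic_surface_def by blast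
    then show "ext_derivative (pullback A F \<phi>) y a b' c = 0"
      unfolding holomorphic_at_iff[OF p b(1,2)]
      using ext_derivative_pullback_zero_iff[OF par b \<phi> y] by blast
  qed
next
  assume *: "closed_form M A g \<phi>"
  show "holomorphic_surface M A g (\<lambda>x. Complex (b1 x) (b0 x))" unfolding holomorphic_surface_def
  proof
    fix p assume p: "p \<in> topspace M"
    let ?c = "chart_at A p"
    define l where "l w = chart_deriv p b1 (quarter_turn (g p) w) + chart_deriv p b0 w" for w
    note c = chart_at_in[OF p]
    have l: "linear l"
      unfolding l_def
      using linear_compose_add[OF linear_compose[OF linear_quarter_turn[OF inner_form_metric[OF p]]
        has_derivative_linear[OF chart_deriv_works[OF b(2) p]]]
        has_derivative_linear[OF chart_deriv_works[OF b(1) p]]] by (simp add: o_def)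
    have t: "l e1 + t * l e2 = 0" for t
    proof -
      define y :: "real^3" where "y = vector [snd ?c p $ 1, snd ?c p $ 2, t]"
      have pp: "plane_part y = snd ?c p" by (simp add: plane_part_def y_def vec_eq_iff forall_2)
      have y: "y \<in> slope_dom ?c" using c pp by (simp add: slope_dom_def)
      have fy: "fst (slope_param ?c y) = p"
        using slope_base(3)[OF c(1) y] chart_inv_chart[OF surf c] pp by simp
      \<comment> \<open>The chart of the parametrization is the one in which vectors at p are
        stored, so no change of components intervenes.\<close>
      have "snd (slope_param ?c y) = unit_slope_vector ?c y"
        using fy tangent_change_self[OF c] by (simp add: slope_param_def Let_def)
      moreover have "l (snd (slope_param ?c y)) = 0"
        using ext_derivative_pullback_zero_iff[OF slope_parametrization[OF c(1)] b \<phi> y]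
          * slope_parametrization[OF c(1)] y unfolding closed_form_def l_def fy by blast
      ultimately have "l (slope_vector y) = 0"
        using slope_pos[OF c(1) y]
        by (simp add: unit_slope_vector_def linear_scale[OF l])
      then show ?thesis
        using linear_vec2[OF l, of "slope_vector y"] by (simp add: slope_vector_def y_def)
    qed
    \<comment> \<open>The slopes 0 and 1 already give two independent vectors.\<close>
    have "l e1 = 0" "l e2 = 0" using t[of 0] t[of 1] by auto
    then have "l w = 0" for w using linear_vec2[OF l, of w] by simp
    then show "holomorphic_at A g (\<lambda>x. Complex (b1 x) (b0 x)) p"
      unfolding holomorphic_at_iff[OF p b(1,2)] l_def by blast
  qed
qed

end

theorem proposition1:
  fixes M :: "'a topology" and A :: "'a chart set" and g :: "'a metric"
    and b0 b1 b2 :: "'a \<Rightarrow> real" and \<phi> :: "'a tm \<Rightarrow> tvec \<Rightarrow> tvec \<Rightarrow> real"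
  assumes "oriented_riemannian_surface M A g"
    and "Ck_fun 1 A b0" and "Ck_fun 1 A b1" and "Ck_fun 1 A b2"
    and "\<And>u X Y. \<phi> u X Y =
           b2 (fst u) * wedge (coframe0 A g) (coframe1 A g) u X Y
         + b1 (fst u) * wedge (coframe2 A g) (coframe0 A g) u X Y
         + b0 (fst u) * wedge (coframe1 A g) (coframe2 A g) u X Y"
  shows "(comass M A g \<phi> = 1 \<longleftrightarrow>
            (SUP x \<in> topspace M. ereal ((b0 x)\<^sup>2 + (b1 x)\<^sup>2 + (b2 x)\<^sup>2)) = 1)
       \<and> (closed_form M A g \<phi> \<longleftrightarrow>
            holomorphic_surface M A g (\<lambda>x. Complex (b1 x) (b0 x)))"
proof -
  interpret riemannian_surface M A g by unfold_locales (rule assms(1))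
  show ?thesis
    using comass_eq_1_iff[OF assms(5)] closed_form_iff[OF assms(2-5)] by blast
qed

end
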